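(* Let $0\le\delta<\rho\le 1$ and $\mu_1,\mu_2\in\mathbb{R}$. Let $\sigma\in S^{\mu_1}_{\rho,\delta}(\mathbb{Z}^n\times\mathbb{T}^n)$ and $\tau\in S^{\mu_2}_{\rho,\delta}(\mathbb{Z}^n\times\mathbb{T}^n)$. Then the composition $\mathrm{Op}(\sigma)\circ\mathrm{Op}(\tau)$ (acting on $\mathcal{S}(\mathbb{Z}^n)$) is a pseudo-difference operator $\mathrm{Op}(\varsigma)$ with symbol $\varsigma\in S^{\mu_1+\mu_2}_{\rho,\delta}(\mathbb{Z}^n\times\mathbb{T}^n)$, and $$\varsigma(k,x)\sim\sum_{\alpha}\frac{1}{\alpha!}\,D_x^{(\alpha)}\sigma(k,x)\,\Delta_k^{\alpha}\tau(k,x),$$ which means that for every $N\in\mathbb{N}$ $$\varsigma-\sum_{|\alpha|<N}\frac{1}{\alpha!}\,\big(D_x^{(\alpha)}\sigma\big)\,\big(\Delta_k^{\alpha}\tau\big)\in S^{\mu_1+\mu_2-N(\rho-\delta)}_{\rho,\delta}(\mathbb{Z}^n\times\mathbb{T}^n).$$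
   Context: $\mathbb{T}^n=\mathbb{R}^n/\mathbb{Z}^n$ with normalised Lebesgue measure; $k\cdot x=\sum_j k_jx_j$; $\mathcal{S}(\mathbb{Z}^n)$ is the space of rapidly decreasing functions $f:\mathbb{Z}^n\to\mathbb{C}$ (for every $M$, $|f(k)|\le C_M(1+|k|)^{-M}$). The Fourier transform is $\widehat f(x)=\sum_{k\in\mathbb{Z}^n}e^{-2\pi i k\cdot x}f(k)$, $x\in\mathbb{T}^n$. For $\sigma:\mathbb{Z}^n\times\mathbb{T}^n\to\mathbb{C}$ the pseudo-difference operator with symbol $\sigma$ is $\mathrm{Op}(\sigma)f(k)=\int_{\mathbb{T}^n}e^{2\pi i k\cdot x}\sigma(k,x)\widehat f(x)\,dx$, $k\in\mathbb{Z}^n$. Difference operators: $\Delta^\alpha=\Delta_1^{\alpha_1}\cdots\Delta_n^{\alpha_n}$, $\Delta_j\tau(k)=\tau(k+v_j)-\tau(k)$, $v_j$ the $j$-th standard unit vector; $\Delta_k^\alpha$ indicates action in the variable $k$. Derivatives: $D_x^{(\alpha)}=D_{x_1}^{(\alpha_1)}\cdots D_{x_n}^{(\alpha_n)}$, where $D_{x_j}^{(0)}=I$ and $D_{x_j}^{(\ell)}=\prod_{m=0}^{\ell-1}\big(\frac{1}{2\pi i}\frac{\partial}{\partial x_j}-m\big)$ for $\ell\ge1$. Symbol classes: for $\mu,\rho,\delta\in\mathbb{R}$, $S^\mu_{\rho,\delta}(\mathbb{Z}^n\times\mathbb{T}^n)$ is the set of $\sigma:\mathbb{Z}^n\times\mathbb{T}^n\to\mathbb{C}$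 such that $\sigma(k,\cdot)\in C^\infty(\mathbb{T}^n)$ for all $k$ and for all multi-indices $\alpha,\beta$ there is $C_{\alpha,\beta}>0$ with $|D_x^{(\beta)}\Delta_k^\alpha\sigma(k,x)|\le C_{\alpha,\beta}(1+|k|)^{\mu-\rho|\alpha|+\delta|\beta|}$ for all $(k,x)\in\mathbb{Z}^n\times\mathbb{T}^n$. *)

theory Defs
  imports "HOL-Analysis.Analysis"
begin

text \<open>
  Functions on the torus are \<open>\<int>\<^sup>n\<close>-periodic functions on \<open>real ^ 'n\<close>, integrated over the unit
  cube. The index type is linearly ordered only so that a product of operators indexed by
  the coordinates can be written out as a composition in the order of the coordinates.
\<close>

definition real_vec :: "int ^ 'n \<Rightarrow> real ^ 'n" where
  "real_vec k = (\<chi> j. real_of_int (k $ j))"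

definition bracket :: "int ^ 'n::finite \<Rightarrow> real" where
  "bracket k = 1 + norm (real_vec k)"

definition character :: "int ^ 'n::finite \<Rightarrow> real ^ 'n \<Rightarrow> complex" where
  "character k x = exp (2 * of_real pi * \<i> * of_real (real_vec k \<bullet> x))"

definition schwartz :: "(int ^ 'n::finite \<Rightarrow> complex) set" where
  "schwartz = {f. \<forall>M::nat. \<exists>C. \<forall>k. norm (f k) \<le> C * bracket k powr (- real M)}"

definition fourier :: "(int ^ 'n::finite \<Rightarrow> complex) \<Rightarrow> real ^ 'n \<Rightarrow> complex" where
  "fourier f x = (\<Sum>\<^sub>\<infinity>k\<in>UNIV. character (- k) x * f k)"

definition Op ::
    "(int ^ 'n::finite \<Rightarrow> real ^ 'n \<Rightarrow> complex) \<Rightarrow> (int ^ 'n \<Rightarrow> complex) \<Rightarrow> int ^ 'n \<Rightarrow> complex" where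
  "Op \<sigma> f k = (LINT x : cbox 0 1 | lborel. character k x * \<sigma> k x * fourier f x)"


subsection \<open>Multi-indices\<close>

definition mi_size :: "nat ^ 'n::finite \<Rightarrow> nat" where
  "mi_size \<alpha> = (\<Sum>j\<in>UNIV. \<alpha> $ j)"

definition mi_fact :: "nat ^ 'n::finite \<Rightarrow> nat" where
  "mi_fact \<alpha> = (\<Prod>j\<in>UNIV. fact (\<alpha> $ j))"

text \<open>\<open>A\<^sub>1 (\<alpha>\<^sub>1) \<circ> \<dots> \<circ> A\<^sub>n (\<alpha>\<^sub>n)\<close> for a family of operators \<open>A\<^sub>j (\<ell>)\<close>\<close>
definition mi_compose ::
    "('n \<Rightarrow> nat \<Rightarrow> 'a \<Rightarrow> 'a) \<Rightarrow> nat ^ 'n::{finite,linorder} \<Rightarrow> 'a \<Rightarrow> 'a" where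
  "mi_compose A \<alpha> = foldr (\<lambda>j F. A j (\<alpha> $ j) \<circ> F) (sorted_list_of_set UNIV) id"


subsection \<open>Difference operators\<close>

definition diff1 :: "'n \<Rightarrow> (int ^ 'n::finite \<Rightarrow> complex) \<Rightarrow> int ^ 'n \<Rightarrow> complex" where
  "diff1 j \<tau> k = \<tau> (k + axis j 1) - \<tau> k"

definition Delta ::
    "nat ^ 'n::{finite,linorder} \<Rightarrow> (int ^ 'n::{finite,linorder} \<Rightarrow> complex) \<Rightarrow> int ^ 'n::{finite,linorder} \<Rightarrow> complex" where
  "Delta = mi_compose (\<lambda>j l. diff1 j ^^ l)"


subsection \<open>Derivatives\<close>

definition partial_deriv :: "'n \<Rightarrow> (real ^ 'n::finite \<Rightarrow> complex) \<Rightarrow> real ^ 'n \<Rightarrow> complex" where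
  "partial_deriv j g x = vector_derivative (\<lambda>t. g (x + t *\<^sub>R axis j 1)) (at 0)"

text \<open>All iterated partial derivatives, in any order, exist and are continuous.\<close>
definition smooth :: "(real ^ 'n::finite \<Rightarrow> complex) \<Rightarrow> bool" where
  "smooth g \<longleftrightarrow> (\<forall>js. continuous_on UNIV (foldr partial_deriv js g) \<and>
     (\<forall>j x. (\<lambda>t. foldr partial_deriv js g (x + t *\<^sub>R axis j 1)) differentiable at 0))"

definition smooth_torus :: "(real ^ 'n::finite \<Rightarrow> complex) set" where
  "smooth_torus = {g. smooth g \<and> (\<forall>x m. g (x + real_vec m) = g x)}"

primrec D1 :: "'n \<Rightarrow> nat \<Rightarrow> (real ^ 'n::finite \<Rightarrow> complex) \<Rightarrow> real ^ 'n \<Rightarrow> complex" where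
  "D1 j 0 g = g"
| "D1 j (Suc l) g =
     (\<lambda>x. 1 / (2 * of_real pi * \<i>) * partial_deriv j (D1 j l g) x - of_nat l * D1 j l g x)"

definition D ::
    "nat ^ 'n::{finite,linorder} \<Rightarrow> (real ^ 'n::{finite,linorder} \<Rightarrow> complex) \<Rightarrow> real ^ 'n::{finite,linorder} \<Rightarrow> complex" where
  "D = mi_compose D1"


subsection \<open>Symbol classes\<close>

definition Delta_k ::
    "nat ^ 'n::{finite,linorder} \<Rightarrow> (int ^ 'n::{finite,linorder} \<Rightarrow> real ^ 'n::{finite,linorder} \<Rightarrow> complex) \<Rightarrow>
     int ^ 'n::{finite,linorder} \<Rightarrow> real ^ 'n::{finite,linorder} \<Rightarrow> complex" where
  "Delta_k \<alpha> \<sigma> k x = Delta \<alpha> (\<lambda>k'. \<sigma> k' x) k"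

definition D_x ::
    "nat ^ 'n::{finite,linorder} \<Rightarrow> (int ^ 'n::{finite,linorder} \<Rightarrow> real ^ 'n::{finite,linorder} \<Rightarrow> complex) \<Rightarrow>
     int ^ 'n::{finite,linorder} \<Rightarrow> real ^ 'n::{finite,linorder} \<Rightarrow> complex" where
  "D_x \<beta> \<sigma> k x = D \<beta> (\<sigma> k) x"

definition symbol_class ::
    "real \<Rightarrow> real \<Rightarrow> real \<Rightarrow> (int ^ 'n::{finite,linorder} \<Rightarrow> real ^ 'n::{finite,linorder} \<Rightarrow> complex) set" where
  "symbol_class \<mu> \<rho> \<delta> =
     {\<sigma>. (\<forall>k. \<sigma> k \<in> smooth_torus) \<and>
          (\<forall>\<alpha> \<beta>. \<exists>C>0. \<forall>k x. norm (D_x \<beta> (Delta_k \<alpha> \<sigma>) k x)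
             \<le> C * bracket k powr (\<mu> - \<rho> * real (mi_size \<alpha>) + \<delta> * real (mi_size \<beta>)))}"

end

theory Submission
  imports Defs
begin

text \<open>
  Expanding \<open>\<sigma>(k,\<cdot>)\<close> into its Fourier series with coefficients \<open>c\<^sub>k(l)\<close> shows that
  \<open>Op \<sigma> \<circ> Op \<tau>\<close> has the symbol \<open>\<Sum>\<^sub>l c\<^sub>k(l) e\<^sub>l(x) \<tau>(k + l, x)\<close>. Inserting the discrete Taylor (Newton)
  expansion of \<open>\<tau>(k + l, x)\<close> in \<open>l\<close> produces the claimed asymptotic terms, because \<open>D\<^sup>(\<^sup>\<alpha>\<^sup>)\<close> multiplies the
  \<open>l\<close>-th Fourier coefficient by the falling factorial \<open>l(l-1)\<dots>(l-\<alpha>+1)\<close>. The remainder is bilinear in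
  \<open>(\<sigma>, \<tau>)\<close> and obeys a Leibniz rule for both \<open>\<partial>\<^sub>x\<close> and \<open>\<Delta>\<^sub>k\<close>, so all symbol estimates reduce to a
  sup bound for the remainder itself, uniformly over all pairs of symbols.
\<close>

subsection \<open>Periodic functions and directional derivatives\<close>

text \<open>Two losses shape the sup bound. Summing over l takes 2n powers of
  \<open>bracket_l1 l\<close>, where n is the dimension. They come from the decay of the
  coefficients of \<sigma>(k, .), where each power is one x-derivative and so costs \<delta> powers
  of \<open>bracket k\<close>. The direct bound is therefore too large by the exponent 2n\<delta>.
  This loss does not depend on N, so it can be outrun by expanding further, since each order gains
  \<rho> - \<delta>. The other loss would come from estimating \<tau> at k + l by Peetre's
  inequality alone: with s = \<mu>2 - \<rho>N it would cost \<delta>|s|, which grows with N and may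
  cancel the gain. Hence the finer bound that separates small l from large l. For large l each
  additional power of l costs \<delta> and gains a full power of \<open>bracket k\<close>, which is
  profitable because \<delta> < 1.\<close>

definition ctorus :: "(real ^ 'n::finite \<Rightarrow> complex) set" where
  "ctorus = {g. continuous_on UNIV g \<and> (\<forall>x m. g (x + real_vec m) = g x)}"

text \<open>A relation, because \<open>partial_deriv\<close> rests on the choice operator
  \<open>vector_derivative\<close> and has a value even where no derivative exists. Existence and
  value travel together through sums, products and series, and \<open>has_pd_eq\<close> recovers
  \<open>partial_deriv\<close>.\<close>

definition has_pd :: "'n \<Rightarrow> (real ^ 'n::finite \<Rightarrow> complex) \<Rightarrow> (real ^ 'n \<Rightarrow> complex) \<Rightarrow> bool" where
  "has_pd j g g' \<longleftrightarrow> (\<forall>x. ((\<lambda>t. g (x + t *\<^sub>R axis j 1)) has_vector_derivative g' x) (at 0))"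

lemma has_pd_at:
  assumes "has_pd j g g'"
  shows "((\<lambda>t. g (x + t *\<^sub>R axis j 1)) has_vector_derivative g' (x + s *\<^sub>R axis j 1)) (at s within S)"
proof -
  have h: "((\<lambda>t. g ((x + s *\<^sub>R axis j 1) + t *\<^sub>R axis j 1)) has_vector_derivative g' (x + s *\<^sub>R axis j 1)) (at (s - s))"
    using assms unfolding has_pd_def by simp
  have "((\<lambda>t. t - s) has_vector_derivative 1) (at s)"
    by (auto intro!: derivative_eq_intros)
  from vector_diff_chain_at[OF this h]
  have "((\<lambda>t. g ((x + s *\<^sub>R axis j 1) + (t - s) *\<^sub>R axis j 1)) has_vector_derivative g' (x + s *\<^sub>R axis j 1)) (at s)"
    by (simp add: o_def)
  then show ?thesis
    by (simp add: algebra_simps has_vector_derivative_at_within)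
qed

lemma has_pd_eq: "has_pd j g g' \<Longrightarrow> partial_deriv j g = g'"
  unfolding has_pd_def partial_deriv_def by (auto simp: vector_derivative_at)

lemma has_pd_add: "has_pd j g g' \<Longrightarrow> has_pd j h h' \<Longrightarrow> has_pd j (\<lambda>x. g x + h x) (\<lambda>x. g' x + h' x)"
  unfolding has_pd_def by (auto intro!: derivative_eq_intros)

lemma has_pd_diff: "has_pd j g g' \<Longrightarrow> has_pd j h h' \<Longrightarrow> has_pd j (\<lambda>x. g x - h x) (\<lambda>x. g' x - h' x)"
  unfolding has_pd_def by (auto intro!: derivative_eq_intros)

lemma has_pd_mult: "has_pd j g g' \<Longrightarrow> has_pd j h h' \<Longrightarrow> has_pd j (\<lambda>x. g x * h x) (\<lambda>x. g x * h' x + g' x * h x)"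
  unfolding has_pd_def by (auto intro!: derivative_eq_intros)

lemma has_pd_const: "has_pd j (\<lambda>x. c) (\<lambda>x. 0)"
  unfolding has_pd_def by simp

lemma has_pd_cmult: "has_pd j g g' \<Longrightarrow> has_pd j (\<lambda>x. c * g x) (\<lambda>x. c * g' x)"
  using has_pd_mult[OF has_pd_const] by fastforce

lemma has_pd_sum:
  "(\<And>i. i \<in> I \<Longrightarrow> has_pd j (g i) (g' i)) \<Longrightarrow> has_pd j (\<lambda>x. \<Sum>i\<in>I. g i x) (\<lambda>x. \<Sum>i\<in>I. g' i x)"
  by (induction I rule: infinite_finite_induct) (auto intro: has_pd_add has_pd_const)

lemma smooth_has_pd: "smooth g \<Longrightarrow> has_pd j g (partial_deriv j g)"
  unfolding smooth_def has_pd_def partial_deriv_def vector_derivative_works[symmetric]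
  by (metis foldr_Nil id_apply)

lemma smooth_partial_deriv: "smooth g \<Longrightarrow> smooth (partial_deriv j g)"
proof -
  assume g: "smooth g"
  have "foldr partial_deriv js (partial_deriv j g) = foldr partial_deriv (js @ [j]) g" for js
    by simp
  then show ?thesis using g unfolding smooth_def by metis
qed

lemma smooth_torus_ctorus: "g \<in> smooth_torus \<Longrightarrow> g \<in> ctorus"
  unfolding smooth_torus_def ctorus_def smooth_def by (auto dest: spec[of _ "[]"])

lemma smooth_torus_has_pd: "g \<in> smooth_torus \<Longrightarrow> has_pd j g (partial_deriv j g)"
  unfolding smooth_torus_def by (auto intro: smooth_has_pd)

lemma smooth_torus_partial_deriv: "g \<in> smooth_torus \<Longrightarrow> partial_deriv j g \<in> smooth_torus"
proof -
  assume g: "g \<in> smooth_torus"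
  have "partial_deriv j g (x + real_vec m) = partial_deriv j g x" for x m
  proof -
    have "g (x + real_vec m + y) = g (x + y)" for y
      using g by (simp add: smooth_torus_def add.assoc add.commute[of "real_vec m"]) (simp add: add.assoc[symmetric])
    then show ?thesis by (simp add: partial_deriv_def)
  qed
  then show ?thesis using g by (auto simp: smooth_torus_def smooth_partial_deriv)
qed

text \<open>Smoothness asks only for continuity and differentiability at every stage of repeated
  differentiation, so it holds throughout any family of continuous periodic functions that is closed
  under partial derivatives. This spares all formulas for iterated derivatives.\<close>

lemma smooth_torus_coinduct:
  assumes "X g"
    and "\<And>g. X g \<Longrightarrow> g \<in> ctorus"
    and pd: "\<And>g j. X g \<Longrightarrow> \<exists>g'. has_pd j g g' \<and> X g'"
  shows "g \<in> smooth_torus"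
proof -
  have X: "X (foldr partial_deriv js g)" for js
  proof (induction js)
    case (Cons j js)
    then show ?case using pd[OF Cons, of j] has_pd_eq by fastforce
  qed (use assms in simp)
  have "(\<lambda>t. foldr partial_deriv js g (x + t *\<^sub>R axis j 1)) differentiable at 0" for js j x
    using pd[OF X[of js]] unfolding has_pd_def
    by (meson differentiableI_vector)
  then show ?thesis
    using assms(2)[OF X] assms(2)[OF assms(1)] by (auto simp: smooth_torus_def smooth_def ctorus_def)
qed

lemma smooth_torus_lincomb:
  assumes "g \<in> smooth_torus" "h \<in> smooth_torus"
  shows "(\<lambda>x. a * g x + b * h x) \<in> smooth_torus"
proof (rule smooth_torus_coinduct[of "\<lambda>f. \<exists>g h. g \<in> smooth_torus \<and> h \<in> smooth_torus \<and> f = (\<lambda>x. a * g x + b * h x)"])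
  fix f :: "real^'n \<Rightarrow> complex" assume "\<exists>g h. g \<in> smooth_torus \<and> h \<in> smooth_torus \<and> f = (\<lambda>x. a * g x + b * h x)"
  then obtain g h where gh: "g \<in> smooth_torus" "h \<in> smooth_torus" "f = (\<lambda>x. a * g x + b * h x)"
    by blast
  then show "f \<in> ctorus" using smooth_torus_ctorus[OF gh(1)] smooth_torus_ctorus[OF gh(2)]
    by (auto simp: ctorus_def intro!: continuous_intros)
  fix j
  show "\<exists>g'. has_pd j f g' \<and> (\<exists>g h. g \<in> smooth_torus \<and> h \<in> smooth_torus \<and> g' = (\<lambda>x. a * g x + b * h x))"
    using gh has_pd_add[OF has_pd_cmult[OF smooth_torus_has_pd[OF gh(1)]] has_pd_cmult[OF smooth_torus_has_pd[OF gh(2)]]]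
      smooth_torus_partial_deriv by blast
qed (use assms in auto)

lemma smooth_torus_cmult: "g \<in> smooth_torus \<Longrightarrow> (\<lambda>x. a * g x) \<in> smooth_torus"
  using smooth_torus_lincomb[of g g a 0] by simp

lemma smooth_torus_diff:
  "g \<in> smooth_torus \<Longrightarrow> h \<in> smooth_torus \<Longrightarrow> (\<lambda>x. g x - h x) \<in> smooth_torus"
  using smooth_torus_lincomb[of g h 1 "-1"] by simp


subsection \<open>Characters\<close>

lemma real_vec_simps [simp]:
  "real_vec (k + l) = real_vec k + real_vec l" "real_vec (- k) = - real_vec k"
  "real_vec (k - l) = real_vec k - real_vec l" "real_vec 0 = 0" "real_vec (axis j 1) = axis j 1"
  "real_vec k $ i = of_int (k $ i)"
  by (auto simp: real_vec_def vec_eq_iff axis_def)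

lemma character_0 [simp]: "character 0 x = 1"
  by (simp add: character_def)

lemma norm_character [simp]: "norm (character k x) = 1"
  by (simp add: character_def norm_exp_eq_Re)

lemma character_add: "character (k + l) x = character k x * character l x"
  by (simp add: character_def inner_add_left distrib_left exp_add)

lemma character_uminus: "character (- k) x = cnj (character k x)"
  by (simp add: character_def exp_cnj)

lemma character_cancel: "character (- k) x * character k x = 1"
  by (simp add: character_add[symmetric])

lemma continuous_on_character [continuous_intros]: "continuous_on S (character k)"
  unfolding character_def by (intro continuous_intros)

lemma character_periodic: "character k (x + real_vec m) = character k x"
proof -
  have "real_vec k \<bullet> real_vec m = of_int (\<Sum>j\<in>UNIV. k $ j * m $ j)"
    by (simp add: inner_vec_def)
  then have "exp (2 * of_real pi * \<i> * of_real (real_vec k \<bullet> real_vec m)) = 1"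
    using exp_integer_2pi[of "of_int (\<Sum>j\<in>UNIV. k $ j * m $ j)"]
    by (metis Ints_of_int mult.assoc mult.commute of_real_mult of_real_numeral)
  then show ?thesis
    by (simp add: character_def inner_add_right distrib_left exp_add)
qed

lemma character_ctorus: "character k \<in> ctorus"
  by (auto simp: ctorus_def character_periodic intro: continuous_intros)

lemma ctorus_mult: "g \<in> ctorus \<Longrightarrow> h \<in> ctorus \<Longrightarrow> (\<lambda>x. g x * h x) \<in> ctorus"
  by (auto simp: ctorus_def intro!: continuous_intros)

lemma ctorus_add: "g \<in> ctorus \<Longrightarrow> h \<in> ctorus \<Longrightarrow> (\<lambda>x. g x + h x) \<in> ctorus"
  by (auto simp: ctorus_def intro!: continuous_intros)

lemma ctorus_diff: "g \<in> ctorus \<Longrightarrow> h \<in> ctorus \<Longrightarrow> (\<lambda>x. g x - h x) \<in> ctorus"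
  by (auto simp: ctorus_def intro!: continuous_intros)

lemma ctorus_const: "(\<lambda>x. c) \<in> ctorus"
  by (auto simp: ctorus_def)

lemma ctorus_sum: "(\<And>i. i \<in> I \<Longrightarrow> g i \<in> ctorus) \<Longrightarrow> (\<lambda>x. \<Sum>i\<in>I. g i x) \<in> ctorus"
  by (induction I rule: infinite_finite_induct) (auto intro: ctorus_add ctorus_const)

lemma ctorus_continuous_on: "g \<in> ctorus \<Longrightarrow> continuous_on S g"
  by (auto simp: ctorus_def intro: continuous_on_subset)

lemma ctorus_integrable: "g \<in> ctorus \<Longrightarrow> g integrable_on cbox a b"
  by (auto intro: integrable_continuous ctorus_continuous_on)

lemma has_pd_character: "has_pd j (character k) (\<lambda>x. 2 * of_real pi * \<i> * of_int (k $ j) * character k x)"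
  unfolding has_pd_def
proof
  fix x
  let ?c = "2 * of_real pi * \<i> :: complex"
  \<comment> \<open>The exponential is differentiated in a complex parameter and the result is
    restricted to real t.\<close>
  have "((\<lambda>t. exp (?c * (of_real (real_vec k \<bullet> x) + t * of_int (k $ j)))) has_field_derivative
      (?c * of_int (k $ j)) * exp (?c * of_real (real_vec k \<bullet> x))) (at (of_real 0))"
    by (auto intro!: derivative_eq_intros)
  from has_vector_derivative_real_field[OF this]
  have "((\<lambda>t. exp (?c * of_real (real_vec k \<bullet> x + t * of_int (k $ j)))) has_vector_derivative
      (?c * of_int (k $ j)) * exp (?c * of_real (real_vec k \<bullet> x))) (at 0)"
    by simp
  then show "((\<lambda>t. character k (x + t *\<^sub>R axis j 1)) has_vector_derivative 2 * of_real pi * \<i> * of_int (k $ j) * character k x) (at 0)"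
    by (simp add: character_def inner_add_right inner_axis)
qed

lemma reduce_to_unit_cube: "\<exists>m. x - real_vec m \<in> cbox 0 1"
  by (intro exI[of _ "\<chi> j. \<lfloor>x $ j\<rfloor>"]) (auto simp: mem_box_cart real_vec_def, linarith+)

lemma ctorus_bounded:
  assumes "g \<in> ctorus"
  shows "\<exists>C>0. \<forall>x. norm (g x) \<le> C"
proof -
  have "bounded (g ` cbox 0 1)"
    by (intro compact_imp_bounded compact_continuous_image ctorus_continuous_on assms compact_cbox)
  then obtain C where C: "C > 0" "\<And>x. x \<in> cbox 0 1 \<Longrightarrow> norm (g x) \<le> C"
    unfolding bounded_pos by blast
  have "norm (g x) \<le> C" for x
  proof -
    obtain m where m: "x - real_vec m \<in> cbox 0 1" using reduce_to_unit_cube by blast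
    have "g x = g (x - real_vec m)" using assms unfolding ctorus_def by (metis (mono_tags, lifting) diff_add_cancel mem_Collect_eq)
    then show ?thesis using C m by simp
  qed
  then show ?thesis using C by blast
qed

subsection \<open>Sums of functions over a dominated index set\<close>

lemma dominated_summable:
  fixes u :: "'i \<Rightarrow> 'a \<Rightarrow> complex"
  assumes "\<And>l x. norm (u l x) \<le> b l" "b summable_on UNIV"
  shows "(\<lambda>l. u l x) summable_on UNIV"
  by (rule abs_summable_summable, rule Infinite_Sum.abs_summable_on_comparison_test'[OF assms(2)]) (use assms(1) in auto)

text \<open>The Weierstrass M-test along the net of finite subsets of the index set, so that no
  enumeration of the lattice is chosen.\<close>

lemma dominated_uniform_limit:
  fixes u :: "'i \<Rightarrow> 'a \<Rightarrow> complex"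
  assumes "\<And>l x. norm (u l x) \<le> b l" "b summable_on UNIV"
  shows "uniform_limit S (\<lambda>F x. \<Sum>l\<in>F. u l x) (\<lambda>x. \<Sum>\<^sub>\<infinity>l. u l x) (finite_subsets_at_top UNIV)"
  by (rule Weierstrass_m_test_general) (use assms in auto)

lemma dominated_continuous:
  fixes u :: "'i \<Rightarrow> 'a::topological_space \<Rightarrow> complex"
  assumes "\<And>l x. norm (u l x) \<le> b l" "b summable_on UNIV" "\<And>l. continuous_on S (u l)"
  shows "continuous_on S (\<lambda>x. \<Sum>\<^sub>\<infinity>l. u l x)"
  by (rule uniform_limit_theorem[OF _ dominated_uniform_limit[of u b]])
     (use assms in \<open>auto intro!: always_eventually continuous_on_sum\<close>)

lemma dominated_has_sum_integral:
  fixes u :: "'i \<Rightarrow> 'a::euclidean_space \<Rightarrow> complex"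
  assumes "\<And>l x. norm (u l x) \<le> b l" "b summable_on UNIV" "\<And>l. continuous_on (cbox a c) (u l)"
  shows "((\<lambda>l. integral (cbox a c) (u l)) has_sum integral (cbox a c) (\<lambda>x. \<Sum>\<^sub>\<infinity>l. u l x)) UNIV"
proof -
  obtain I J where IJ: "\<And>F. ((\<lambda>x. \<Sum>l\<in>F. u l x) has_integral I F) (cbox a c)"
    "((\<lambda>x. \<Sum>\<^sub>\<infinity>l. u l x) has_integral J) (cbox a c)" "(I \<longlongrightarrow> J) (finite_subsets_at_top UNIV)"
    by (rule uniform_limit_integral_cbox[OF dominated_uniform_limit[of u b "cbox a c"]])
       (use assms in \<open>auto intro!: continuous_on_sum\<close>)
  have "I F = (\<Sum>l\<in>F. integral (cbox a c) (u l))" if "finite F" for F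
  proof -
    have "I F = integral (cbox a c) (\<lambda>x. \<Sum>l\<in>F. u l x)"
      using IJ(1)[of F] by (simp add: integral_unique)
    then show ?thesis
      using that assms(3) by (simp add: integral_sum integrable_continuous)
  qed
  then have "((\<lambda>F. \<Sum>l\<in>F. integral (cbox a c) (u l)) \<longlongrightarrow> J) (finite_subsets_at_top UNIV)"
    using IJ(3) by (rule_tac Lim_transform_eventually[OF IJ(3)]) (auto intro: eventually_finite_subsets_at_top_weakI)
  then show ?thesis
    using IJ(2) by (simp add: has_sum_def integral_unique)
qed

text \<open>The differentiated series may be integrated term by term along the line, and this
  integral is the original series up to a constant. Its integrand is continuous, so differentiating
  the integral gives the claim.\<close>

lemma dominated_has_pd:
  fixes u u' :: "'i \<Rightarrow> real ^ 'n::finite \<Rightarrow> complex"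
  assumes pd: "\<And>l. has_pd j (u l) (u' l)" and cont: "\<And>l. continuous_on UNIV (u' l)"
    and b: "\<And>l x. norm (u l x) \<le> b l" "b summable_on UNIV"
    and b': "\<And>l x. norm (u' l x) \<le> b' l" "b' summable_on UNIV"
  shows "has_pd j (\<lambda>x. \<Sum>\<^sub>\<infinity>l. u l x) (\<lambda>x. \<Sum>\<^sub>\<infinity>l. u' l x)"
  unfolding has_pd_def
proof
  fix x :: "real ^ 'n"
  let ?p = "\<lambda>t. x + t *\<^sub>R axis j 1 :: real ^ 'n"
  let ?U = "\<lambda>t. \<Sum>\<^sub>\<infinity>l. u l (?p t)" and ?U' = "\<lambda>t. \<Sum>\<^sub>\<infinity>l. u' l (?p t)"
  have c: "continuous_on S (\<lambda>t. u' l (?p t))" for l S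
    by (rule continuous_on_compose2[OF cont[of l]]) (auto intro!: continuous_intros)
  have eq: "integral {-1..t} ?U' = ?U t - ?U (-1)" if "t \<in> {-1..1}" for t
  proof -
    have "integral {-1..t} (\<lambda>t. u' l (?p t)) = u l (?p t) - u l (?p (-1))" for l
    proof (intro integral_unique fundamental_theorem_of_calculus)
      show "((\<lambda>t. u l (?p t)) has_vector_derivative u' l (?p s)) (at s within {-1..t})" for s
        by (rule has_pd_at[OF pd])
    qed (use that in auto)
    moreover have "((\<lambda>l. integral {-1..t} (\<lambda>t. u' l (?p t))) has_sum integral {-1..t} ?U') UNIV"
      using dominated_has_sum_integral[of "\<lambda>l t. u' l (?p t)" b' "-1" t] b' c by simp
    moreover have "((\<lambda>l. u l (?p t) - u l (?p (-1))) has_sum (?U t - ?U (-1))) UNIV"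
      unfolding diff_conv_add_uminus
      by (intro has_sum_add has_sum_uminusI has_sum_infsum dominated_summable[OF b])
    ultimately show ?thesis by (simp only: has_sum_unique)
  qed
  have "((\<lambda>t. integral {-1..t} ?U') has_vector_derivative ?U' 0) (at 0 within {-1..1})"
    by (intro integral_has_vector_derivative dominated_continuous[of _ b'] b' c) auto
  then have "((\<lambda>t. integral {-1..t} ?U' + ?U (-1)) has_vector_derivative ?U' 0) (at 0 within {-1..1})"
    by (simp only: has_vector_derivative_add_const)
  then have "(?U has_vector_derivative ?U' 0) (at 0 within {-1..1})"
    by (rule has_vector_derivative_transform[rotated 2]) (auto simp: eq)
  then show "(?U has_vector_derivative (\<Sum>\<^sub>\<infinity>l. u' l x)) (at 0)"
    by (simp add: at_within_Icc_at)
qed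


subsection \<open>Integration over the unit cube\<close>

lemma content_unit_cube [simp]: "measure lborel (cbox 0 (1::real ^ 'n::finite)) = 1"
  by (subst content_cbox_cart) (auto simp: interval_eq_empty_cart)

lemma ctorus_periodic_axis: "g \<in> ctorus \<Longrightarrow> g (x + axis j 1) = g x"
  unfolding ctorus_def by (metis (mono_tags, lifting) mem_Collect_eq real_vec_simps(5))

text \<open>Shifting the cube by s adds a slab beyond the top face and removes an equal one at the
  bottom face; periodicity gives both the same integral. The two cubes are compared inside the
  common box \<open>?B\<close>, split at s and at 1.\<close>

lemma integral_shift_axis:
  fixes g :: "real ^ 'n::finite \<Rightarrow> complex"
  assumes g: "g \<in> ctorus" and s: "0 \<le> s" "s \<le> 1"
  shows "integral (cbox 0 1) (\<lambda>x. g (x + s *\<^sub>R axis j 1)) = integral (cbox 0 1) g"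
proof -
  let ?v = "axis j 1 :: real ^ 'n"
  let ?B = "cbox 0 (1 + s *\<^sub>R ?v)"
  have int: "g integrable_on ?B" by (rule ctorus_integrable[OF g])
  have v: "?v \<in> Basis" by (simp add: axis_in_Basis_iff)
  define P :: "real ^ 'n \<Rightarrow> bool" where "P x \<longleftrightarrow> (\<forall>i. i \<noteq> j \<longrightarrow> 0 \<le> x $ i \<and> x $ i \<le> 1)" for x
  have box: "x \<in> cbox (a *\<^sub>R ?v) (1 + b *\<^sub>R ?v) \<longleftrightarrow> (a \<le> x $ j \<and> x $ j \<le> 1 + b) \<and> P x" for x a b
  proof -
    have "(a *\<^sub>R ?v) $ i \<le> x $ i \<and> x $ i \<le> (1 + b *\<^sub>R ?v) $ i \<longleftrightarrow>
        (if i = j then a \<le> x $ j \<and> x $ j \<le> 1 + b else 0 \<le> x $ i \<and> x $ i \<le> 1)" for i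
      by (simp add: axis_def)
    then show ?thesis unfolding mem_box_cart P_def by (metis (mono_tags, lifting))
  qed
  have v': "x \<bullet> ?v = x $ j" for x by (simp add: inner_axis)
  have sets: "cbox (0 *\<^sub>R ?v) (1 + s *\<^sub>R ?v) \<inter> {x. x \<bullet> ?v \<le> s} = cbox (0 *\<^sub>R ?v) (1 + (s - 1) *\<^sub>R ?v)"
    "cbox (0 *\<^sub>R ?v) (1 + s *\<^sub>R ?v) \<inter> {x. x \<bullet> ?v \<ge> s} = cbox (s *\<^sub>R ?v) (1 + s *\<^sub>R ?v)"
    "cbox (0 *\<^sub>R ?v) (1 + s *\<^sub>R ?v) \<inter> {x. x \<bullet> ?v \<le> 1} = cbox (0 *\<^sub>R ?v) (1 + 0 *\<^sub>R ?v)"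
    "cbox (0 *\<^sub>R ?v) (1 + s *\<^sub>R ?v) \<inter> {x. x \<bullet> ?v \<ge> 1} = cbox (1 *\<^sub>R ?v) (1 + s *\<^sub>R ?v)"
    unfolding set_eq_iff Int_iff box mem_Collect_eq v' using s by auto
  have "integral (cbox ?v (1 + s *\<^sub>R ?v)) g = integral (cbox (?v - ?v) (1 + s *\<^sub>R ?v - ?v)) (\<lambda>x. g (x + ?v))"
    by (simp only: integral_shift_cbox)
  also have "(\<lambda>x. g (x + ?v)) = g"
    by (simp add: ctorus_periodic_axis[OF g])
  finally have 1: "integral (cbox ?v (1 + s *\<^sub>R ?v)) g = integral (cbox 0 (1 + (s - 1) *\<^sub>R ?v)) g"
    by (simp add: algebra_simps)
  have "integral (cbox (s *\<^sub>R ?v) (1 + s *\<^sub>R ?v)) g = integral (cbox (s *\<^sub>R ?v - s *\<^sub>R ?v) (1 + s *\<^sub>R ?v - s *\<^sub>R ?v)) (\<lambda>x. g (x + s *\<^sub>R ?v))"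
    by (simp only: integral_shift_cbox)
  then have 2: "integral (cbox (s *\<^sub>R ?v) (1 + s *\<^sub>R ?v)) g = integral (cbox 0 1) (\<lambda>x. g (x + s *\<^sub>R ?v))"
    by simp
  show ?thesis
    using integral_split[OF int v, of s] integral_split[OF int v, of 1] 1 2 sets by simp
qed

text \<open>Average over the translations by s in [0,1] along the axis j. For fixed x the integral
  over s is \<open>h (x + axis j 1) - h x\<close>, which vanishes; for fixed s the integral over x
  does not depend on s.\<close>

lemma integral_pd_eq_0:
  fixes h h' :: "real ^ 'n::finite \<Rightarrow> complex"
  assumes pd: "has_pd j h h'" and h: "h \<in> ctorus" and h': "h' \<in> ctorus"
  shows "integral (cbox 0 1) h' = 0"
proof -
  let ?v = "axis j 1 :: real ^ 'n"
  have 0: "integral (cbox 0 (1::real)) (\<lambda>s. h' (x + s *\<^sub>R ?v)) = 0" for x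
  proof -
    have "((\<lambda>s. h' (x + s *\<^sub>R ?v)) has_integral h (x + 1 *\<^sub>R ?v) - h (x + 0 *\<^sub>R ?v)) {0..1}"
      by (intro fundamental_theorem_of_calculus has_pd_at[OF pd]) auto
    moreover have "h (x + ?v) = h x"
      by (rule ctorus_periodic_axis[OF h])
    ultimately show ?thesis by (simp add: integral_unique)
  qed
  have "continuous_on (cbox (0, 0) (1, 1::real)) (\<lambda>(x, s). h' (x + s *\<^sub>R ?v))"
    unfolding split_beta
    by (rule continuous_on_compose2[of UNIV h']) (use h' in \<open>auto simp: ctorus_def intro!: continuous_intros\<close>)
  from integral_swap_continuous[OF this]
  have "0 = integral (cbox 0 (1::real)) (\<lambda>s. integral (cbox 0 1) (\<lambda>x. h' (x + s *\<^sub>R ?v)))"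
    by (simp only: 0 integral_0)
  also have "\<dots> = integral (cbox 0 (1::real)) (\<lambda>s. integral (cbox 0 1) h')"
    by (rule integral_cong) (simp add: integral_shift_axis[OF h'])
  finally show ?thesis by simp
qed


subsection \<open>Fourier coefficients\<close>

text \<open>The l-th Fourier coefficient, taken with the gauge integral, for which the exchange and
  calculus rules below are stated. \<open>Op_eq_integral\<close> reconciles it with the Lebesgue
  integral in \<open>Op\<close>.\<close>

definition coef :: "(real ^ 'n::finite \<Rightarrow> complex) \<Rightarrow> int ^ 'n \<Rightarrow> complex" where
  "coef g l = integral (cbox 0 1) (\<lambda>x. character (- l) x * g x)"

lemma coef_integrable: "g \<in> ctorus \<Longrightarrow> (\<lambda>x. character l x * g x) integrable_on cbox a b"
  by (intro ctorus_integrable ctorus_mult character_ctorus)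

lemma coef_add: "g \<in> ctorus \<Longrightarrow> h \<in> ctorus \<Longrightarrow> coef (\<lambda>x. g x + h x) l = coef g l + coef h l"
  by (simp add: coef_def distrib_left integral_add coef_integrable)

lemma coef_diff: "g \<in> ctorus \<Longrightarrow> h \<in> ctorus \<Longrightarrow> coef (\<lambda>x. g x - h x) l = coef g l - coef h l"
  by (simp add: coef_def right_diff_distrib integral_diff coef_integrable)

lemma coef_cmult: "coef (\<lambda>x. c * g x) l = c * coef g l"
  by (simp add: coef_def mult.left_commute[of _ c])

lemma norm_coef_le:
  fixes g :: "real ^ 'n::finite \<Rightarrow> complex"
  assumes "g \<in> ctorus" "\<And>x. norm (g x) \<le> C"
  shows "norm (coef g l) \<le> C"
proof -
  have "norm (coef g l) \<le> C * measure lborel (cbox 0 (1::real^'n))"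
    unfolding coef_def
  proof (rule Henstock_Kurzweil_Integration.integrable_bound)
    show "0 \<le> C" using assms(2)[of 0] norm_ge_zero order_trans by blast
    show "(\<lambda>x. character (- l) x * g x) integrable_on cbox 0 1"
      by (rule coef_integrable[OF assms(1)])
    show "norm (character (- l) x * g x) \<le> C" for x
      using assms(2) by (simp add: norm_mult)
  qed
  then show ?thesis by simp
qed

text \<open>Integration by parts: \<open>character (- l) x * g x\<close> is periodic, so its
  derivative, given by the product rule, has integral 0.\<close>

lemma coef_pd:
  assumes "has_pd j g g'" "g \<in> ctorus" "g' \<in> ctorus"
  shows "coef g' l = 2 * of_real pi * \<i> * of_int (l $ j) * coef g l"
proof -
  let ?c = "2 * of_real pi * \<i> * of_int (l $ j) :: complex"
  have m: "(\<lambda>x. character (- l) x * g' x) \<in> ctorus" "(\<lambda>x. - ?c * (character (- l) x * g x)) \<in> ctorus"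
    by (intro ctorus_mult character_ctorus ctorus_const assms)+
  have "integral (cbox 0 1) (\<lambda>x. character (- l) x * g' x + - ?c * (character (- l) x * g x)) = 0"
  proof (rule integral_pd_eq_0)
    show "has_pd j (\<lambda>x. character (- l) x * g x) (\<lambda>x. character (- l) x * g' x + - ?c * (character (- l) x * g x))"
      using has_pd_mult[OF has_pd_character assms(1), of "- l"] by (simp add: mult.assoc)
  qed (intro ctorus_add m ctorus_mult character_ctorus assms)+
  also have "integral (cbox 0 1) (\<lambda>x. character (- l) x * g' x + - ?c * (character (- l) x * g x)) = coef g' l + - ?c * coef g l"
    unfolding coef_def by (subst integral_add[OF m[THEN ctorus_integrable]]) (simp only: integral_mult_right)
  finally show ?thesis by simp
qed

text \<open>Off the diagonal no integral is computed: by \<open>coef_pd\<close> the coefficient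
  times m_j equals the coefficient times l_j, so it vanishes as soon as m and l differ in a
  coordinate j.\<close>

lemma coef_character: "coef (character m) l = (if l = m then 1 else 0)"
proof (cases "l = m")
  case True
  then show ?thesis by (simp add: coef_def character_cancel)
next
  case False
  then obtain j where j: "l $ j \<noteq> m $ j" by (auto simp: vec_eq_iff)
  have "coef (\<lambda>x. 2 * of_real pi * \<i> * of_int (m $ j) * character m x) l = 2 * of_real pi * \<i> * of_int (l $ j) * coef (character m) l"
    by (rule coef_pd[OF has_pd_character character_ctorus]) (intro ctorus_mult ctorus_const character_ctorus)
  then have "(2 * of_real pi * \<i>) * ((of_int (m $ j) - of_int (l $ j)) * coef (character m) l) = 0"
    by (simp only: coef_cmult left_diff_distrib right_diff_distrib mult.assoc) simp
  then have "(of_int (m $ j) - of_int (l $ j)) * coef (character m) l = 0"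
    by (subst (asm) mult_eq_0_iff) simp
  then show ?thesis using j False by simp
qed

subsection \<open>Uniqueness of Fourier coefficients\<close>

inductive trig :: "(real ^ 'n::finite \<Rightarrow> complex) \<Rightarrow> bool" where
  char: "trig (character l)"
| add: "trig p \<Longrightarrow> trig q \<Longrightarrow> trig (\<lambda>x. p x + q x)"
| cmult: "trig p \<Longrightarrow> trig (\<lambda>x. c * p x)"

lemma trig_const: "trig (\<lambda>x. c)"
  using trig.cmult[OF trig.char[of 0], of c] by simp

lemma trig_sum: "(\<And>i. i \<in> I \<Longrightarrow> trig (p i)) \<Longrightarrow> trig (\<lambda>x. \<Sum>i\<in>I. p i x)"
  by (induction I rule: infinite_finite_induct) (auto intro: trig.add trig_const)

lemma trig_mult:
  assumes "trig p" "trig q"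
  shows "trig (\<lambda>x. p x * q x)"
  using assms(1)
proof induction
  case (char l)
  from assms(2) show ?case
  proof induction
    case (char m)
    then show ?case using trig.char[of "l + m"] by (simp add: character_add[abs_def])
  next
    case (add p q)
    then show ?case by (simp add: distrib_left trig.add)
  next
    case (cmult p c)
    then show ?case by (simp add: mult.left_commute trig.cmult)
  qed
next
  case (add p q)
  then show ?case by (simp add: distrib_right trig.add)
next
  case (cmult p c)
  then show ?case by (simp add: mult.assoc trig.cmult)
qed

lemma trig_ctorus: "trig p \<Longrightarrow> p \<in> ctorus"
  by (induction rule: trig.induct) (auto intro: ctorus_add ctorus_mult ctorus_const character_ctorus)

text \<open>The embedding of the torus into a Euclidean space as a product of unit circles. Its
  compact image is the set on which Stone-Weierstrass is applied.\<close>

definition circles :: "real ^ 'n::finite \<Rightarrow> complex ^ 'n" where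
  "circles x = (\<chi> j. character (axis j 1) x)"

lemma circles_eq_iff: "circles x = circles y \<longleftrightarrow> (\<exists>m. x = y + real_vec m)"
proof
  assume "circles x = circles y"
  then have e: "exp (2 * of_real pi * \<i> * of_real (x $ j)) = exp (2 * of_real pi * \<i> * of_real (y $ j))" for j
    by (simp add: circles_def vec_eq_iff character_def inner_axis inner_commute)
  have "\<exists>n::int. x $ j = y $ j + of_int n" for j
  proof -
    obtain n :: int where n: "2 * of_real pi * \<i> * of_real (x $ j) = 2 * of_real pi * \<i> * of_real (y $ j) + (of_int (2 * n) * of_real pi) * \<i>"
      using e[of j, unfolded exp_eq] by auto
    have "2 * pi * (x $ j) = 2 * pi * (y $ j + of_int n)"
      using arg_cong[OF n, of Im] by (simp add: algebra_simps)
    then show ?thesis by auto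
  qed
  then obtain n :: "'a \<Rightarrow> int" where "\<And>j. x $ j = y $ j + of_int (n j)" by metis
  then have "x = y + real_vec (\<chi> j. n j)" by (simp add: vec_eq_iff)
  then show "\<exists>m. x = y + real_vec m" by blast
next
  assume "\<exists>m. x = y + real_vec m"
  then show "circles x = circles y" by (auto simp: circles_def character_periodic)
qed

lemma continuous_on_circles: "continuous_on S circles"
  unfolding circles_def by (intro continuous_on_vec_lambda continuous_on_character)

text \<open>The real coordinates of \<open>circles x\<close> are the real and imaginary parts of the
  basic characters, hence combinations of a character and its conjugate, which is again a character.
  Sums and products follow from the closure of \<open>trig\<close>.\<close>

lemma trig_real_polynomial:
  assumes "real_polynomial_function p"
  shows "trig (\<lambda>x. complex_of_real (p (circles x)))"
  using assms
proof induction
  case (linear f)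
  have 1: "trig (\<lambda>x. complex_of_real (circles x \<bullet> b))" if bB: "b \<in> Basis" for b :: "complex ^ 'a"
  proof -
    obtain i u where b: "b = axis i u" "u = 1 \<or> u = \<i>"
      using bB unfolding Basis_vec_def Basis_complex_def by blast
    have "trig (\<lambda>x. (1/2) * (character (axis i 1) x + character (- axis i 1) x))"
      "trig (\<lambda>x. (1/(2 * \<i>)) * (character (axis i 1) x + (-1) * character (- axis i 1) x))"
      by (intro trig.intros)+
    moreover have "(1/2) * (z + cnj z) = complex_of_real (Re z)" "(1/(2 * \<i>)) * (z + (-1) * cnj z) = complex_of_real (Im z)" for z
      by (auto simp: complex_eq_iff)
    ultimately have "trig (\<lambda>x. complex_of_real (Re (character (axis i 1) x)))" "trig (\<lambda>x. complex_of_real (Im (character (axis i 1) x)))"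
      by (simp_all only: character_uminus)
    then show ?thesis using b(2) by (auto simp: b(1) inner_axis circles_def)
  qed
  have "f z = (\<Sum>b\<in>Basis. f b * (z \<bullet> b))" for z
    by (subst euclidean_representation[of z, symmetric])
       (simp only: linear_sum[OF bounded_linear.linear[OF linear]] linear_cmul[OF bounded_linear.linear[OF linear]] real_scaleR_def mult.commute)
  then have "(\<lambda>x. complex_of_real (f (circles x))) = (\<lambda>x. \<Sum>b\<in>Basis. of_real (f b) * complex_of_real (circles x \<bullet> b))"
    by (metis (no_types, lifting) of_real_mult of_real_sum sum.cong)
  then show ?case using 1 by (auto intro!: trig_sum trig.cmult)
next
  case (const c)
  then show ?case by (rule trig_const)
next
  case (add f g)
  then show ?case using trig.add by fastforce
next
  case (mult f g)
  then show ?case using trig_mult by fastforce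
qed

text \<open>A periodic function descends to a function \<open>F\<close> on the image of the torus
  under \<open>circles\<close>, and polynomials on that image pull back to trigonometric
  polynomials.\<close>

lemma trig_approximates_real:
  fixes \<phi> :: "real ^ 'n::finite \<Rightarrow> real"
  assumes c: "continuous_on UNIV \<phi>" and per: "\<And>x m. \<phi> (x + real_vec m) = \<phi> x" and e: "e > 0"
  obtains p where "trig p" "\<And>x. norm (of_real (\<phi> x) - p x) < e"
proof -
  define F where "F z = \<phi> (SOME x. x \<in> cbox 0 1 \<and> circles x = z)" for z
  have cube: "\<exists>y. y \<in> cbox 0 1 \<and> circles y = circles x" for x :: "real ^ 'n"
  proof -
    obtain m where "x - real_vec m \<in> cbox 0 1" using reduce_to_unit_cube by blast
    moreover have "circles (x - real_vec m) = circles x"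
      unfolding circles_eq_iff by (intro exI[of _ "- m"]) simp
    ultimately show ?thesis by blast
  qed
  have F: "F (circles x) = \<phi> x" for x
    using someI_ex[OF cube[of x]] per unfolding F_def circles_eq_iff by metis
  let ?T = "circles ` cbox 0 (1::real ^ 'n)"
  have T: "circles x \<in> ?T" for x using cube by (metis image_eqI)
  have comp: "compact ?T" by (intro compact_continuous_image continuous_on_circles compact_cbox)
  \<comment> \<open>A continuous map from a compact space onto a Hausdorff space is closed, hence a
    quotient map. So continuity of \<open>F\<close> may be tested on
    \<open>F \<circ> circles\<close>, which is \<phi>.\<close>
  have cont: "continuous_on ?T F"
  proof -
    let ?X = "top_of_set (cbox 0 (1::real ^ 'n))"
    have cm: "continuous_map ?X (top_of_set ?T) circles"
      using continuous_on_circles by auto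
    have "quotient_map ?X (top_of_set ?T) circles"
    proof (rule continuous_closed_imp_quotient_map[OF cm])
      show "closed_map ?X (top_of_set ?T) circles"
        by (rule continuous_imp_closed_map[OF cm])
           (auto simp: compact_space_subtopology Hausdorff_space_subtopology)
    qed simp
    moreover have "continuous_map ?X euclideanreal (F \<circ> circles)"
      using continuous_on_subset[OF c] by (simp add: F o_def)
    ultimately have "continuous_map (top_of_set ?T) euclideanreal F"
      by (rule continuous_compose_quotient_map)
    then show ?thesis by simp
  qed
  obtain g where g: "real_polynomial_function g" "\<And>z. z \<in> ?T \<Longrightarrow> \<bar>F z - g z\<bar> < e"
    using Stone_Weierstrass_real_polynomial_function[OF comp cont e] by metis
  show ?thesis
  proof
    show "trig (\<lambda>x. complex_of_real (g (circles x)))" by (rule trig_real_polynomial[OF g(1)])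
    show "norm (of_real (\<phi> x) - complex_of_real (g (circles x))) < e" for x
      using g(2)[OF T[of x]] by (simp add: F flip: of_real_diff)
  qed
qed

text \<open>Vanishing coefficients mean orthogonality to all trigonometric polynomials.
  Approximating the conjugate of h uniformly by these makes the integral of |h|^2 arbitrarily
  small.\<close>

lemma coef_eq_0_imp_0:
  fixes h :: "real ^ 'n::finite \<Rightarrow> complex"
  assumes h: "h \<in> ctorus" and 0: "\<And>l. coef h l = 0"
  shows "h x = 0"
proof -
  have trig0: "integral (cbox 0 1) (\<lambda>x. p x * h x) = 0" if "trig p" for p
    using that
  proof induction
    case (char l)
    then show ?case using 0[of "- l"] by (simp add: coef_def)
  next
    case (add p q)
    then show ?case
      by (simp add: distrib_right integral_add ctorus_integrable ctorus_mult trig_ctorus h)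
  next
    case (cmult p c)
    then show ?case by (simp add: mult.assoc)
  qed
  have cnj: "(\<lambda>x. cnj (h x)) \<in> ctorus"
    using h by (auto simp: ctorus_def intro!: continuous_intros)
  obtain C where C: "C > 0" "\<And>x. norm (h x) \<le> C" using ctorus_bounded[OF h] by blast
  have "norm (integral (cbox 0 1) (\<lambda>x. cnj (h x) * h x)) \<le> e" if e: "e > 0" for e
  proof -
    \<comment> \<open>Real and imaginary part are approximated separately, each within e/(2C); the
      total error e/C is then multiplied by the bound C of h.\<close>
    have d: "e / (2 * C) > 0" using e C by simp
    have "continuous_on UNIV (\<lambda>x. Re (h x))" "continuous_on UNIV (\<lambda>x. Im (h x))"
      using h by (auto simp: ctorus_def intro!: continuous_intros)
    moreover have "Re (h (x + real_vec m)) = Re (h x)" "Im (h (x + real_vec m)) = Im (h x)" for x m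
      using h by (auto simp: ctorus_def)
    ultimately obtain p q where pq: "trig p" "\<And>x. norm (of_real (Re (h x)) - p x) < e / (2 * C)"
      "trig q" "\<And>x. norm (of_real (Im (h x)) - q x) < e / (2 * C)"
      using trig_approximates_real[OF _ _ d] by metis
    define r where "r x = p x + (- \<i>) * q x" for x
    have r: "trig r" unfolding r_def by (intro trig.intros pq)
    have "norm (cnj (h x) - r x) \<le> e / C" for x
    proof -
      have "cnj (h x) - r x = (of_real (Re (h x)) - p x) - \<i> * (of_real (Im (h x)) - q x)"
        by (simp add: r_def complex_eq_iff)
      also have "norm \<dots> \<le> norm (of_real (Re (h x)) - p x) + norm (of_real (Im (h x)) - q x)"
        by (metis norm_triangle_ineq4 norm_mult norm_ii mult_1)
      also have "\<dots> \<le> e / (2 * C) + e / (2 * C)" using pq(2,4)[of x] by linarith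
      finally show ?thesis using C by (simp add: field_simps)
    qed
    then have b: "norm ((cnj (h x) - r x) * h x) \<le> e" for x
      unfolding norm_mult using mult_mono[of "norm (cnj (h x) - r x)" "e / C" "norm (h x)" C] C e by simp
    have "integral (cbox 0 1) (\<lambda>x. cnj (h x) * h x) = integral (cbox 0 1) (\<lambda>x. (cnj (h x) - r x) * h x)"
      using trig0[OF r]
      by (simp add: left_diff_distrib integral_diff ctorus_integrable ctorus_mult trig_ctorus r h cnj)
    moreover have "norm (integral (cbox 0 1) (\<lambda>x. (cnj (h x) - r x) * h x)) \<le> e * measure lborel (cbox 0 (1::real^'n))"
    proof (rule Henstock_Kurzweil_Integration.integrable_bound)
      show "(\<lambda>x. (cnj (h x) - r x) * h x) integrable_on cbox 0 1"
        by (intro ctorus_integrable ctorus_mult ctorus_diff cnj h trig_ctorus r)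
    qed (use e b in auto)
    ultimately show ?thesis by simp
  qed
  then have "integral (cbox 0 1) (\<lambda>x. cnj (h x) * h x) = 0"
    by (meson dense_ge norm_le_zero_iff)
  moreover have "cnj (h x) * h x = of_real ((norm (h x))\<^sup>2)" for x
    by (simp only: mult.commute[of "cnj (h x)"] complex_norm_square)
  moreover have c: "continuous_on (cbox 0 1) (\<lambda>x. (norm (h x))\<^sup>2)"
    by (intro continuous_intros ctorus_continuous_on[OF h])
  moreover have "integral (cbox 0 1) (\<lambda>x. complex_of_real ((norm (h x))\<^sup>2)) = of_real (integral (cbox 0 1) (\<lambda>x. (norm (h x))\<^sup>2))"
    by (intro integral_unique has_integral_of_real integrable_integral integrable_continuous c)
  ultimately have z: "h x = 0" if "x \<in> cbox 0 1" for x
    using that integral_cbox_eq_0_iff[of 0 1 "\<lambda>x. (norm (h x))\<^sup>2"] by (auto simp: interval_eq_empty_cart)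
  obtain m where m: "x - real_vec m \<in> cbox 0 1" using reduce_to_unit_cube by blast
  have "h x = h ((x - real_vec m) + real_vec m)" by simp
  also have "\<dots> = h (x - real_vec m)" using h by (simp only: ctorus_def mem_Collect_eq)
  finally show ?thesis using z[OF m] by simp
qed

lemma coef_inject:
  assumes "g \<in> ctorus" "h \<in> ctorus" "\<And>l. coef g l = coef h l"
  shows "g = h"
proof
  fix x
  show "g x = h x"
    using coef_eq_0_imp_0[OF ctorus_diff[OF assms(1,2)], of x] assms(3) by (simp add: coef_diff assms(1,2))
qed

subsection \<open>Weights on the lattice\<close>

text \<open>Comparable to \<open>bracket\<close>, but adapted to Fourier coefficients: the factor 1
  + |l_1| + ... + |l_n| is accounted for exactly by the function and its n first derivatives, which
  suits inductions on the power.\<close>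

definition bracket_l1 :: "int ^ 'n::finite \<Rightarrow> real" where
  "bracket_l1 l = 1 + (\<Sum>j\<in>UNIV. \<bar>of_int (l $ j)\<bar>)"

lemma bracket_l1_ge_1: "bracket_l1 l \<ge> 1"
  by (simp add: bracket_l1_def sum_nonneg)

lemma bracket_l1_pos [simp]: "bracket_l1 l > 0" "bracket_l1 l \<ge> 0" "bracket_l1 l \<noteq> 0"
  using bracket_l1_ge_1[of l] by linarith+

lemma bracket_ge_1: "bracket k \<ge> 1"
  by (simp add: bracket_def)

lemma bracket_pos [simp]: "bracket k > 0" "bracket k \<ge> 0" "bracket k \<noteq> 0"
  using bracket_ge_1[of k] by linarith+

lemma bracket_le_bracket_l1: "bracket k \<le> bracket_l1 k"
  using norm_le_l1_cart[of "real_vec k"] by (simp add: bracket_def bracket_l1_def)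

lemma bracket_l1_le_bracket: "bracket_l1 (k :: int ^ 'n::finite) \<le> of_nat CARD('n) * bracket k"
proof -
  have "\<bar>of_int (k $ j)\<bar> \<le> norm (real_vec k)" for j
    using component_le_norm_cart[of "real_vec k" j] by simp
  then have "(\<Sum>j\<in>UNIV. \<bar>of_int (k $ j)\<bar>) \<le> of_nat CARD('n) * norm (real_vec k)"
    by (intro sum_bounded_above) simp
  moreover have "1 \<le> real CARD('n)" by simp
  ultimately show ?thesis unfolding bracket_l1_def bracket_def distrib_left mult_1_right by linarith
qed

lemma bracket_l1_add_le: "bracket_l1 (k + l) \<le> bracket_l1 k * bracket_l1 l"
proof -
  let ?s = "\<lambda>k. \<Sum>j\<in>UNIV. \<bar>real_of_int (k $ j)\<bar>"
  have "?s (k + l) \<le> ?s k + ?s l"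
    unfolding sum.distrib[symmetric] by (intro sum_mono) simp
  moreover have "0 \<le> ?s k * ?s l" by (intro mult_nonneg_nonneg sum_nonneg) auto
  moreover have "bracket_l1 k * bracket_l1 l = 1 + ?s k + ?s l + ?s k * ?s l" by (simp add: bracket_l1_def algebra_simps)
  ultimately show ?thesis by (simp only: bracket_l1_def)
qed

lemma summable_on_int_inverse_square: "(\<lambda>k::int. 1 / (1 + \<bar>real_of_int k\<bar>)\<^sup>2) summable_on UNIV"
proof -
  have "summable (\<lambda>n. inverse (real (Suc n) ^ 2))"
    by (subst summable_Suc_iff) (rule inverse_power_summable, simp)
  then have s: "(\<lambda>n. 1 / (1 + real n)\<^sup>2) summable_on UNIV"
    by (intro summable_nonneg_imp_summable_on) (auto simp: field_simps)
  have "(\<lambda>k::int. 1 / (1 + \<bar>real_of_int k\<bar>)\<^sup>2) summable_on (range int)"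
    using s by (subst summable_on_reindex) (auto simp: o_def)
  moreover have "(\<lambda>k::int. 1 / (1 + \<bar>real_of_int k\<bar>)\<^sup>2) summable_on (range (\<lambda>n. - int n))"
    using s by (subst summable_on_reindex) (auto simp: o_def inj_on_def)
  ultimately have "(\<lambda>k::int. 1 / (1 + \<bar>real_of_int k\<bar>)\<^sup>2) summable_on (range int \<union> range (\<lambda>n. - int n))"
    by (rule summable_on_union)
  moreover have "range int \<union> range (\<lambda>n. - int n) = UNIV"
    by (auto simp: image_iff) (metis int_cases2)
  ultimately show ?thesis by simp
qed

text \<open>Each 1 + |l_j| is at most \<open>bracket_l1 l\<close>, so the exponent 2n leaves an
  inverse square for every coordinate. Finite sums are bounded by the n-th power of a
  one-dimensional sum.\<close>

lemma summable_bracket_l1: "(\<lambda>l :: int ^ 'n::finite. 1 / bracket_l1 l ^ (2 * CARD('n))) summable_on UNIV"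
proof (rule nonneg_bdd_above_summable_on)
  let ?q = "\<lambda>k::int. 1 / (1 + \<bar>real_of_int k\<bar>)\<^sup>2"
  let ?c = "infsum ?q UNIV"
  show "bdd_above (sum (\<lambda>l :: int ^ 'n. 1 / bracket_l1 l ^ (2 * CARD('n))) ` {F. F \<subseteq> UNIV \<and> finite F})"
  proof (rule bdd_aboveI2)
    fix F :: "(int ^ 'n) set"
    assume "F \<in> {F. F \<subseteq> UNIV \<and> finite F}"
    then have F: "finite F" by simp
    let ?I = "\<Union>l\<in>F. range (\<lambda>j. l $ j)"
    let ?P = "PiE (UNIV :: 'n set) (\<lambda>_. ?I)"
    have I: "finite ?I" using F by auto
    have b: "1 / bracket_l1 l ^ (2 * CARD('n)) \<le> (\<Prod>j\<in>UNIV. ?q (l $ j))" for l :: "int ^ 'n"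
    proof -
      have "(\<Prod>j\<in>UNIV. (1 + \<bar>real_of_int (l $ j)\<bar>)\<^sup>2) \<le> (\<Prod>j\<in>(UNIV::'n set). (bracket_l1 l)\<^sup>2)"
      proof (intro prod_mono conjI power_mono)
        fix j
        show "1 + \<bar>real_of_int (l $ j)\<bar> \<le> bracket_l1 l"
          unfolding bracket_l1_def using member_le_sum[of j UNIV "\<lambda>j. \<bar>real_of_int (l $ j)\<bar>"] by simp
      qed auto
      moreover have "(\<Prod>j\<in>UNIV. (1 + \<bar>real_of_int (l $ j)\<bar>)\<^sup>2) > 0"
        by (intro prod_pos) (auto intro!: zero_less_power)
      ultimately have "1 / (bracket_l1 l ^ (2 * CARD('n))) \<le> 1 / (\<Prod>j\<in>UNIV. (1 + \<bar>real_of_int (l $ j)\<bar>)\<^sup>2)"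
        by (intro divide_left_mono) (auto simp: power_mult prod_constant)
      then show ?thesis by (simp add: prod_dividef)
    qed
    have "F \<subseteq> vec_lambda ` ?P"
    proof
      fix l assume "l \<in> F"
      then show "l \<in> vec_lambda ` ?P"
        by (intro image_eqI[of _ _ "\<lambda>j. l $ j"]) auto
    qed
    then have "(\<Sum>l\<in>F. 1 / bracket_l1 l ^ (2 * CARD('n))) \<le> (\<Sum>l\<in>vec_lambda ` ?P. \<Prod>j\<in>UNIV. ?q (l $ j))"
      using I by (intro order_trans[OF sum_mono[OF b] sum_mono2]) (auto intro!: finite_PiE prod_nonneg)
    also have "\<dots> = (\<Sum>f\<in>?P. \<Prod>j\<in>UNIV. ?q (f j))"
      by (subst sum.reindex) (auto simp: inj_on_def vec_lambda_inject)
    also have "\<dots> = (\<Prod>j\<in>(UNIV::'n set). \<Sum>k\<in>?I. ?q k)"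
      by (rule prod_sum_PiE[symmetric]) (use I in auto)
    also have "\<dots> \<le> (\<Prod>j\<in>(UNIV::'n set). ?c)"
      by (intro prod_mono conjI sum_nonneg finite_sum_le_infsum[OF summable_on_int_inverse_square I]) auto
    finally show "(\<Sum>l\<in>F. 1 / bracket_l1 l ^ (2 * CARD('n))) \<le> (\<Prod>j\<in>(UNIV::'n set). ?c)" .
  qed
qed simp

lemma weight_sum:
  fixes c :: "int ^ 'n::finite \<Rightarrow> 'a::real_normed_vector"
  assumes "norm (c l) * bracket_l1 l ^ (2 * CARD('n)) \<le> C"
  shows "norm (c l) \<le> C * (1 / bracket_l1 l ^ (2 * CARD('n)))"
  using assms by (simp add: pos_le_divide_eq)

lemma summable_const_bracket_l1: "(\<lambda>l :: int ^ 'n::finite. C * (1 / bracket_l1 l ^ (2 * CARD('n)))) summable_on UNIV"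
  by (intro summable_on_cmult_right summable_bracket_l1)


subsection \<open>Fourier inversion for smooth functions on the torus\<close>

text \<open>Normalised so that the Fourier multiplier is exactly the integer l_j;
  \<open>D1 j a\<close> is the product of \<open>scaled_pd j\<close> minus m over m < a.\<close>

definition scaled_pd :: "'n \<Rightarrow> (real ^ 'n::finite \<Rightarrow> complex) \<Rightarrow> real ^ 'n \<Rightarrow> complex" where
  "scaled_pd j g x = 1 / (2 * of_real pi * \<i>) * partial_deriv j g x"

lemma scaled_pd_smooth_torus: "g \<in> smooth_torus \<Longrightarrow> scaled_pd j g \<in> smooth_torus"
  unfolding scaled_pd_def[abs_def] by (intro smooth_torus_cmult smooth_torus_partial_deriv)

lemma scaled_pd_has_pd: "has_pd j g g' \<Longrightarrow> scaled_pd j g = (\<lambda>x. 1 / (2 * of_real pi * \<i>) * g' x)"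
  by (simp add: scaled_pd_def[abs_def] has_pd_eq)

lemma smooth_torus_has_pd_scaled_pd: "g \<in> smooth_torus \<Longrightarrow> has_pd j g (\<lambda>x. 2 * of_real pi * \<i> * scaled_pd j g x)"
  using smooth_torus_has_pd[of g j] by (simp add: scaled_pd_def)

lemma coef_scaled_pd:
  assumes "g \<in> smooth_torus"
  shows "coef (scaled_pd j g) l = of_int (l $ j) * coef g l"
proof -
  have "coef (partial_deriv j g) l = 2 * of_real pi * \<i> * of_int (l $ j) * coef g l"
    using assms by (intro coef_pd smooth_torus_has_pd smooth_torus_ctorus smooth_torus_partial_deriv)
  then show ?thesis unfolding scaled_pd_def[abs_def] coef_cmult by simp
qed

text \<open>Induction over all smooth functions at once: in the new factor
  \<open>bracket_l1 l\<close> the summand 1 keeps g and |l_j| replaces g by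
  \<open>scaled_pd j g\<close>, and both are covered at exponent M.\<close>

lemma coef_decay:
  "g \<in> smooth_torus \<Longrightarrow> \<exists>C. \<forall>l. norm (coef g l) * bracket_l1 l ^ M \<le> C"
proof (induction M arbitrary: g)
  case 0
  obtain C where "\<forall>x. norm (g x) \<le> C" using ctorus_bounded[OF smooth_torus_ctorus[OF 0]] by blast
  then show ?case using norm_coef_le[OF smooth_torus_ctorus[OF 0]] by auto
next
  case (Suc M)
  obtain C where C: "\<And>l. norm (coef g l) * bracket_l1 l ^ M \<le> C" using Suc.IH[OF Suc.prems] by blast
  have "\<forall>j. \<exists>C. \<forall>l. norm (coef (scaled_pd j g) l) * bracket_l1 l ^ M \<le> C"
    using Suc.IH[OF scaled_pd_smooth_torus[OF Suc.prems]] by blast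
  then obtain K where K: "\<And>j l. norm (coef (scaled_pd j g) l) * bracket_l1 l ^ M \<le> K j" by metis
  have "norm (coef g l) * bracket_l1 l ^ Suc M \<le> C + (\<Sum>j\<in>UNIV. K j)" for l
  proof -
    have "norm (coef g l) * bracket_l1 l ^ Suc M = norm (coef g l) * bracket_l1 l ^ M + (\<Sum>j\<in>UNIV. norm (coef (scaled_pd j g) l) * bracket_l1 l ^ M)"
      by (simp add: coef_scaled_pd[OF Suc.prems] norm_mult bracket_l1_def[of l] distrib_left sum_distrib_left sum_distrib_right algebra_simps)
    also have "\<dots> \<le> C + (\<Sum>j\<in>UNIV. K j)"
      by (intro add_mono C sum_mono K)
    finally show ?thesis .
  qed
  then show ?case by blast
qed

lemma Fourier_series:
  fixes c :: "int ^ 'n::finite \<Rightarrow> complex"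
  assumes C: "\<And>l. norm (c l) * bracket_l1 l ^ (2 * CARD('n)) \<le> C"
  defines "G \<equiv> \<lambda>x. \<Sum>\<^sub>\<infinity>l. c l * character l x"
  shows "G \<in> ctorus" "coef G m = c m"
proof -
  have b: "norm (c l * character l x) \<le> C * (1 / bracket_l1 l ^ (2 * CARD('n)))" for l x
    using weight_sum[of c l C, OF C] by (simp add: norm_mult)
  show "G \<in> ctorus"
    unfolding ctorus_def G_def mem_Collect_eq
    by (intro conjI dominated_continuous[OF b summable_const_bracket_l1] continuous_intros) (simp_all add: character_periodic)
  have "((\<lambda>l. integral (cbox 0 1) (\<lambda>x. character (- m) x * (c l * character l x))) has_sum
      integral (cbox 0 1) (\<lambda>x. \<Sum>\<^sub>\<infinity>l. character (- m) x * (c l * character l x))) UNIV"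
    by (rule dominated_has_sum_integral[OF _ summable_const_bracket_l1[of C]])
       (use b in \<open>auto simp: norm_mult intro!: continuous_intros\<close>)
  moreover have "integral (cbox 0 1) (\<lambda>x. character (- m) x * (c l * character l x)) = (if l = m then c m else 0)" for l
    using coef_cmult[of "c l" "character l" m] by (auto simp: coef_character) (auto simp: coef_def)
  ultimately have "((\<lambda>l. if l = m then c m else 0) has_sum coef G m) UNIV"
    by (simp add: coef_def G_def infsum_cmult_right')
  moreover have "((\<lambda>l. if l = m then c m else 0) has_sum c m) UNIV"
    using has_sum_finite_neutralI[of "{m}" UNIV "\<lambda>l. if l = m then c m else 0"] by simp
  ultimately show "coef G m = c m" by (rule has_sum_unique)
qed

text \<open>The series is a continuous function with the same coefficients as g, so uniqueness of
  coefficients identifies the two.\<close>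

lemma Fourier_inversion:
  assumes "g \<in> smooth_torus"
  shows "g x = (\<Sum>\<^sub>\<infinity>l. coef g l * character l x)"
proof -
  obtain C where C: "\<And>l. norm (coef g l) * bracket_l1 l ^ (2 * CARD('a)) \<le> C" using coef_decay[OF assms] by blast
  have "g = (\<lambda>x. \<Sum>\<^sub>\<infinity>l. coef g l * character l x)"
    by (intro coef_inject smooth_torus_ctorus assms Fourier_series(2)[OF C, symmetric] Fourier_series(1)[OF C])
  then show ?thesis by metis
qed


subsection \<open>Multi-indices\<close>

text \<open>Induction over the coordinates, with \<open>P\<close> recording the order accumulated so
  far. It hides the list of coordinates, so later arguments treat a single
  \<open>A j (\<alpha> $ j)\<close>.\<close>

lemma mi_compose_rule:
  assumes "P 0 id" "\<And>j m F. P m F \<Longrightarrow> P (m + \<alpha> $ j) (A j (\<alpha> $ j) \<circ> F)"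
  shows "P (mi_size \<alpha>) (mi_compose A \<alpha>)"
proof -
  have "P (\<Sum>j\<leftarrow>xs. \<alpha> $ j) (foldr (\<lambda>j F. A j (\<alpha> $ j) \<circ> F) xs id)" for xs
  proof (induction xs)
    case (Cons j xs)
    then show ?case using assms(2)[OF Cons, of j] by (simp add: add.commute comp_def)
  qed (simp add: assms(1)[unfolded id_def] id_def)
  from this[of "sorted_list_of_set UNIV"] show ?thesis
    unfolding mi_compose_def mi_size_def by (simp add: sum_list_distinct_conv_sum_set)
qed

text \<open>The additional factor \<open>f j\<close> sits in the middle of the composition;
  commutation moves it to the right end.\<close>

lemma mi_compose_funpow_Suc:
  assumes comm: "\<And>i j. f i \<circ> f j = f j \<circ> f i"
  shows "mi_compose (\<lambda>j l. f j ^^ l) (\<alpha> + axis j 1) = mi_compose (\<lambda>j l. f j ^^ l) \<alpha> \<circ> f j"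
proof -
  define C where "C \<alpha> xs = foldr (\<lambda>j F. (f j ^^ (\<alpha> $ j)) \<circ> F) xs id" for \<alpha> xs
  have C_Cons: "C \<alpha> (i # xs) = (f i ^^ (\<alpha> $ i)) \<circ> C \<alpha> xs" for \<alpha> i xs
    by (simp add: C_def)
  have pow: "(f i ^^ n) \<circ> f j = f j \<circ> (f i ^^ n)" for i j n
  proof (induction n)
    case (Suc n)
    have "(f i ^^ Suc n) \<circ> f j = f i \<circ> ((f i ^^ n) \<circ> f j)" by (simp add: o_assoc)
    also have "\<dots> = (f i \<circ> f j) \<circ> (f i ^^ n)" by (simp only: Suc o_assoc)
    finally show ?case by (simp only: comm[of i j] o_assoc funpow.simps)
  qed simp
  have fold: "C \<alpha> xs \<circ> f j = f j \<circ> C \<alpha> xs" for \<alpha> xs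
  proof (induction xs)
    case (Cons i xs)
    have "C \<alpha> (i # xs) \<circ> f j = (f i ^^ (\<alpha> $ i)) \<circ> (C \<alpha> xs \<circ> f j)" by (simp only: C_Cons o_assoc)
    also have "\<dots> = ((f i ^^ (\<alpha> $ i)) \<circ> f j) \<circ> C \<alpha> xs" by (simp only: Cons o_assoc)
    finally show ?case by (simp only: C_Cons pow o_assoc)
  qed (simp add: C_def)
  have "C (\<alpha> + axis j 1) xs = (if j \<in> set xs then C \<alpha> xs \<circ> f j else C \<alpha> xs)" if "distinct xs" for xs
    using that
  proof (induction xs)
    case (Cons i xs)
    show ?case
    proof (cases "i = j")
      case True
      have "C (\<alpha> + axis j 1) (i # xs) = (f j ^^ Suc (\<alpha> $ j)) \<circ> C \<alpha> xs"
        using Cons True by (simp add: axis_def C_Cons)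
      also have "\<dots> = (f j ^^ (\<alpha> $ j)) \<circ> (f j \<circ> C \<alpha> xs)"
        by (simp only: funpow_Suc_right o_assoc)
      finally show ?thesis using True by (simp add: fold[symmetric] C_Cons o_assoc)
    next
      case False
      then show ?thesis using Cons by (simp add: axis_def C_Cons o_assoc)
    qed
  qed (simp add: C_def)
  from this[of "sorted_list_of_set UNIV"] show ?thesis by (simp add: mi_compose_def C_def)
qed

lemma diff1_commute: "diff1 i \<circ> diff1 j = diff1 j \<circ> diff1 i"
  by (auto simp: diff1_def fun_eq_iff algebra_simps)

lemma Delta_Suc: "Delta (\<alpha> + axis j 1) t = Delta \<alpha> (diff1 j t)"
  unfolding Delta_def using fun_cong[OF mi_compose_funpow_Suc[OF diff1_commute]] by (simp only: comp_apply)

lemma mi_size_add_axis: "mi_size (\<alpha> + axis j 1) = Suc (mi_size \<alpha>)"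
  by (simp add: mi_size_def sum.distrib axis_def)

lemma mi_size_0 [simp]: "mi_size 0 = 0"
  by (simp add: mi_size_def)

lemma mi_compose_pointwise:
  "mi_compose (\<lambda>j l \<sigma> k. A j l (\<sigma> k)) \<beta> \<sigma> k = mi_compose A \<beta> (\<sigma> k)"
proof -
  have "foldr (\<lambda>j F. (\<lambda>\<sigma> k. A j (\<beta> $ j) (\<sigma> k)) \<circ> F) xs id \<sigma> k = foldr (\<lambda>j F. A j (\<beta> $ j) \<circ> F) xs id (\<sigma> k)" for xs
    by (induction xs) auto
  then show ?thesis by (simp add: mi_compose_def)
qed


subsection \<open>The operators \<open>D\<^sup>(\<^sup>\<beta>\<^sup>)\<close> as Fourier multipliers\<close>

definition falling :: "int ^ 'n::finite \<Rightarrow> nat ^ 'n \<Rightarrow> complex" where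
  "falling l \<beta> = (\<Prod>j\<in>UNIV. \<Prod>m<\<beta> $ j. of_int (l $ j) - of_nat m)"

lemma falling_add_axis: "falling l (\<beta> + axis j 1) = (of_int (l $ j) - of_nat (\<beta> $ j)) * falling l \<beta>"
proof -
  have "falling l (\<beta> + axis j 1) = (\<Prod>i\<in>UNIV. (if i = j then of_int (l $ j) - of_nat (\<beta> $ j) else 1) * (\<Prod>m<\<beta> $ i. of_int (l $ i) - of_nat m))"
    unfolding falling_def by (intro prod.cong) (auto simp: axis_def)
  then show ?thesis by (simp add: prod.distrib falling_def)
qed

lemma D1_Suc: "D1 j (Suc a) g = (\<lambda>x. scaled_pd j (D1 j a g) x - of_nat a * D1 j a g x)"
  by (simp add: scaled_pd_def)

lemma D1_multiplier:
  assumes g: "g \<in> smooth_torus"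
  shows "D1 j a g \<in> smooth_torus"
    and "coef (D1 j a g) l = (\<Prod>m<a. of_int (l $ j) - of_nat m) * coef g l"
proof (induction a)
  case (Suc a)
  case 1
  then show ?case using Suc unfolding D1_Suc by (intro smooth_torus_diff smooth_torus_cmult scaled_pd_smooth_torus)
next
  case (Suc a)
  case 2
  have "coef (D1 j (Suc a) g) l = coef (scaled_pd j (D1 j a g)) l - of_nat a * coef (D1 j a g) l"
    unfolding D1_Suc coef_cmult[symmetric] using Suc
    by (intro coef_diff smooth_torus_ctorus smooth_torus_cmult scaled_pd_smooth_torus)
  then show ?case using Suc by (simp add: coef_scaled_pd algebra_simps)
qed (use g in auto)

lemma D_multiplier:
  assumes g: "g \<in> smooth_torus"
  shows "D \<beta> g \<in> smooth_torus" and "coef (D \<beta> g) l = falling l \<beta> * coef g l"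
proof -
  let ?F = "\<lambda>xs. foldr (\<lambda>j F. D1 j (\<beta> $ j) \<circ> F) xs id g"
  have *: "?F xs \<in> smooth_torus \<and> coef (?F xs) l = (\<Prod>j\<leftarrow>xs. \<Prod>m<\<beta> $ j. of_int (l $ j) - of_nat m) * coef g l" for xs
    by (induction xs) (simp_all add: g D1_multiplier)
  from *[of "sorted_list_of_set UNIV"] show "D \<beta> g \<in> smooth_torus" "coef (D \<beta> g) l = falling l \<beta> * coef g l"
    by (simp_all add: D_def mi_compose_def falling_def prod.distinct_set_conv_list[symmetric])
qed

text \<open>On Fourier coefficients this is the factor l_j written as (l_j - \<beta>_j) + \<beta>_j
  in front of the falling factorial. It links the first-order derivatives of the Leibniz rule to the
  operators \<open>D \<beta>\<close> of the symbol class.\<close>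

lemma D_scaled_pd:
  assumes g: "g \<in> smooth_torus"
  shows "D \<beta> (scaled_pd j g) = (\<lambda>x. D (\<beta> + axis j 1) g x + of_nat (\<beta> $ j) * D \<beta> g x)"
proof (rule coef_inject)
  show "D \<beta> (scaled_pd j g) \<in> ctorus" by (intro smooth_torus_ctorus D_multiplier scaled_pd_smooth_torus g)
  have 1: "D (\<beta> + axis j 1) g \<in> ctorus" "(\<lambda>x. of_nat (\<beta> $ j) * D \<beta> g x) \<in> ctorus"
    by (intro smooth_torus_ctorus smooth_torus_cmult D_multiplier g)+
  then show "(\<lambda>x. D (\<beta> + axis j 1) g x + of_nat (\<beta> $ j) * D \<beta> g x) \<in> ctorus"
    by (rule ctorus_add)
  show "coef (D \<beta> (scaled_pd j g)) l = coef (\<lambda>x. D (\<beta> + axis j 1) g x + of_nat (\<beta> $ j) * D \<beta> g x) l" for l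
    by (simp only: coef_add[OF 1] coef_cmult D_multiplier(2) scaled_pd_smooth_torus g coef_scaled_pd falling_add_axis) (simp add: algebra_simps)
qed

subsection \<open>Difference operators\<close>

definition diff_k :: "'n \<Rightarrow> (int ^ 'n::finite \<Rightarrow> real ^ 'n \<Rightarrow> complex) \<Rightarrow> int ^ 'n \<Rightarrow> real ^ 'n \<Rightarrow> complex" where
  "diff_k j \<sigma> k x = \<sigma> (k + axis j 1) x - \<sigma> k x"

definition deriv_x :: "'n \<Rightarrow> (int ^ 'n::finite \<Rightarrow> real ^ 'n \<Rightarrow> complex) \<Rightarrow> int ^ 'n \<Rightarrow> real ^ 'n \<Rightarrow> complex" where
  "deriv_x j \<sigma> k = scaled_pd j (\<sigma> k)"

lemma diff1_symbol: "diff1 j (\<lambda>k. \<sigma> k x) = (\<lambda>k. diff_k j \<sigma> k x)"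
  by (simp add: diff1_def diff_k_def fun_eq_iff)

lemma funpow_diff_k: "(diff_k j ^^ l) \<sigma> k x = (diff1 j ^^ l) (\<lambda>k. \<sigma> k x) k"
  by (induction l arbitrary: k) (simp_all add: diff_k_def diff1_def)

lemma Delta_k_eq_mi_compose: "Delta_k \<alpha> \<sigma> = mi_compose (\<lambda>j l. diff_k j ^^ l) \<alpha> \<sigma>"
proof -
  have "foldr (\<lambda>j F. (diff_k j ^^ (\<alpha> $ j)) \<circ> F) xs id \<sigma> k x =
    foldr (\<lambda>j F. (diff1 j ^^ (\<alpha> $ j)) \<circ> F) xs id (\<lambda>k. \<sigma> k x) k" for xs k x
    by (induction xs arbitrary: k) (simp_all add: funpow_diff_k)
  then show ?thesis by (simp add: Delta_k_def[abs_def] Delta_def mi_compose_def fun_eq_iff)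
qed

lemma Delta_k_add_axis: "Delta_k (\<alpha> + axis j 1) \<sigma> = Delta_k \<alpha> (diff_k j \<sigma>)"
  unfolding Delta_k_def[abs_def] Delta_Suc diff1_symbol ..

lemma mi_compose_0: "(\<And>j. A j 0 = id) \<Longrightarrow> mi_compose A 0 = id"
  using mi_compose_rule[of "\<lambda>m F. F = id" 0 A] by simp

lemma Delta_0 [simp]: "Delta 0 t = t"
  by (simp add: Delta_def mi_compose_0)

lemma Delta_k_0 [simp]: "Delta_k 0 \<sigma> = \<sigma>"
  by (simp add: Delta_k_def fun_eq_iff)

lemma D_0 [simp]: "D 0 g = g"
  unfolding D_def by (subst mi_compose_0) (auto simp: fun_eq_iff)

lemma Delta_shift: "Delta \<alpha> (\<lambda>k. t (k + m)) k = Delta \<alpha> t (k + m)"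
proof -
  have pow: "(diff1 j ^^ l) (\<lambda>k. t (k + m)) = (\<lambda>k. (diff1 j ^^ l) t (k + m))" for j l t
    by (induction l) (simp_all add: diff1_def fun_eq_iff add_ac)
  have "\<forall>t. Delta \<alpha> (\<lambda>k. t (k + m)) = (\<lambda>k. Delta \<alpha> t (k + m))"
    unfolding Delta_def
    by (rule mi_compose_rule[of "\<lambda>_ F. \<forall>t. F (\<lambda>k. t (k + m)) = (\<lambda>k. F t (k + m))"]) (simp_all add: pow)
  then show ?thesis by metis
qed

lemma Delta_diff: "Delta \<alpha> (\<lambda>k. s k - t k) = (\<lambda>k. Delta \<alpha> s k - Delta \<alpha> t k)"
proof -
  have pow: "(diff1 j ^^ l) (\<lambda>k. s k - t k) = (\<lambda>k. (diff1 j ^^ l) s k - (diff1 j ^^ l) t k)" for j l s t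
    by (induction l) (simp_all add: diff1_def fun_eq_iff)
  have "\<forall>s t. Delta \<alpha> (\<lambda>k. s k - t k) = (\<lambda>k. Delta \<alpha> s k - Delta \<alpha> t k)"
    unfolding Delta_def
    by (rule mi_compose_rule[of "\<lambda>_ F. \<forall>s t. F (\<lambda>k. s k - t k) = (\<lambda>k. F s k - F t k)"]) (simp_all add: pow)
  then show ?thesis by blast
qed

lemma Delta_diff1: "Delta \<alpha> (diff1 j t) k = Delta \<alpha> t (k + axis j 1) - Delta \<alpha> t k"
  unfolding diff1_def[abs_def] Delta_diff by (simp add: Delta_shift)

lemma scaled_pd_diff:
  assumes "g \<in> smooth_torus" "h \<in> smooth_torus"
  shows "scaled_pd j (\<lambda>x. g x - h x) = (\<lambda>x. scaled_pd j g x - scaled_pd j h x)"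
  using scaled_pd_has_pd[OF has_pd_diff[OF smooth_torus_has_pd smooth_torus_has_pd, OF assms]]
  by (simp add: scaled_pd_def[abs_def] right_diff_distrib diff_divide_distrib)

text \<open>Both claims go through one induction: the derivative is passed through a difference by
  differentiability of the two functions in it, which the first claim provides.\<close>

lemma Delta_k_smooth_torus_deriv_x:
  assumes "\<And>k. \<sigma> k \<in> smooth_torus"
  shows "Delta_k \<alpha> \<sigma> k \<in> smooth_torus" and "Delta_k \<alpha> (deriv_x j \<sigma>) = deriv_x j (Delta_k \<alpha> \<sigma>)"
proof -
  let ?P = "\<lambda>F. \<forall>\<sigma>. (\<forall>k. \<sigma> k \<in> smooth_torus) \<longrightarrow> (\<forall>k. F \<sigma> k \<in> smooth_torus) \<and> F (deriv_x j \<sigma>) = deriv_x j (F \<sigma>)"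
  have step: "?P (diff_k i \<circ> F)" if "?P F" for i F
    using that by (auto simp: diff_k_def[abs_def] deriv_x_def[abs_def] scaled_pd_diff smooth_torus_diff fun_eq_iff)
  have pow: "?P ((diff_k i ^^ l) \<circ> F)" if "?P F" for i l F
  proof (induction l)
    case (Suc l)
    then show ?case using step[OF Suc, of i] by (simp only: funpow.simps o_assoc)
  qed (use that in simp)
  have "?P (mi_compose (\<lambda>j l. diff_k j ^^ l) \<alpha>)"
    by (rule mi_compose_rule[of "\<lambda>_. ?P"]) (rule pow | simp)+
  then show "Delta_k \<alpha> \<sigma> k \<in> smooth_torus" "Delta_k \<alpha> (deriv_x j \<sigma>) = deriv_x j (Delta_k \<alpha> \<sigma>)"
    unfolding Delta_k_eq_mi_compose using assms by blast+
qed


subsection \<open>Closure properties of symbol classes\<close>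

lemma bracket_powr_mono: "a \<le> b \<Longrightarrow> bracket k powr a \<le> bracket k powr b"
  by (intro powr_mono bracket_ge_1)

lemma symbol_class_smooth_torus: "\<sigma> \<in> symbol_class \<mu> \<rho> \<delta> \<Longrightarrow> \<sigma> k \<in> smooth_torus"
  by (simp add: symbol_class_def)

lemma symbol_class_bound:
  "\<sigma> \<in> symbol_class \<mu> \<rho> \<delta> \<Longrightarrow> \<exists>C>0. \<forall>k x. norm (D_x \<beta> (Delta_k \<alpha> \<sigma>) k x)
     \<le> C * bracket k powr (\<mu> - \<rho> * real (mi_size \<alpha>) + \<delta> * real (mi_size \<beta>))"
  by (simp add: symbol_class_def)

lemma symbol_class_bound_0:
  assumes "\<sigma> \<in> symbol_class \<mu> \<rho> \<delta>"
  shows "\<exists>C>0. \<forall>k x. norm (\<sigma> k x) \<le> C * bracket k powr \<mu>"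
  using symbol_class_bound[OF assms, of 0 0] by (simp add: D_x_def)

text \<open>By \<open>D_scaled_pd\<close> the derivative of index \<beta> becomes one of index
  \<beta> + e_j plus a multiple of one of index \<beta>. The latter has the smaller weight because
  \<delta> is nonnegative and \<open>bracket k\<close> is at least 1.\<close>

lemma deriv_x_symbol_class:
  assumes \<sigma>: "\<sigma> \<in> symbol_class \<mu> \<rho> \<delta>" and "\<delta> \<ge> 0"
  shows "deriv_x j \<sigma> \<in> symbol_class (\<mu> + \<delta>) \<rho> \<delta>"
  unfolding symbol_class_def mem_Collect_eq
proof (intro conjI allI)
  have s: "\<sigma> k \<in> smooth_torus" for k using \<sigma> by (rule symbol_class_smooth_torus)
  show "deriv_x j \<sigma> k \<in> smooth_torus" for k by (simp add: deriv_x_def scaled_pd_smooth_torus s)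
  fix \<alpha> \<beta>
  obtain C1 where C1: "C1 > 0" "\<And>k x. norm (D_x (\<beta> + axis j 1) (Delta_k \<alpha> \<sigma>) k x)
      \<le> C1 * bracket k powr (\<mu> - \<rho> * real (mi_size \<alpha>) + \<delta> * real (mi_size (\<beta> + axis j 1)))"
    using symbol_class_bound[OF \<sigma>] by blast
  obtain C2 where C2: "C2 > 0" "\<And>k x. norm (D_x \<beta> (Delta_k \<alpha> \<sigma>) k x)
      \<le> C2 * bracket k powr (\<mu> - \<rho> * real (mi_size \<alpha>) + \<delta> * real (mi_size \<beta>))"
    using symbol_class_bound[OF \<sigma>] by blast
  let ?e = "\<mu> + \<delta> - \<rho> * real (mi_size \<alpha>) + \<delta> * real (mi_size \<beta>)"
  have "norm (D_x \<beta> (Delta_k \<alpha> (deriv_x j \<sigma>)) k x) \<le> (C1 + real (\<beta> $ j) * C2) * bracket k powr ?e" for k x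
  proof -
    have "D_x \<beta> (Delta_k \<alpha> (deriv_x j \<sigma>)) k x = D_x (\<beta> + axis j 1) (Delta_k \<alpha> \<sigma>) k x + of_nat (\<beta> $ j) * D_x \<beta> (Delta_k \<alpha> \<sigma>) k x"
      unfolding D_x_def Delta_k_smooth_torus_deriv_x(2)[OF s] deriv_x_def
      by (simp only: D_scaled_pd[OF Delta_k_smooth_torus_deriv_x(1)[OF s]])
    also have "norm \<dots> \<le> norm (D_x (\<beta> + axis j 1) (Delta_k \<alpha> \<sigma>) k x) + real (\<beta> $ j) * norm (D_x \<beta> (Delta_k \<alpha> \<sigma>) k x)"
      by (rule order_trans[OF norm_triangle_ineq]) (simp add: norm_mult)
    also have "\<dots> \<le> C1 * bracket k powr ?e + real (\<beta> $ j) * (C2 * bracket k powr ?e)"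
    proof (intro add_mono mult_left_mono)
      show "norm (D_x (\<beta> + axis j 1) (Delta_k \<alpha> \<sigma>) k x) \<le> C1 * bracket k powr ?e"
        using C1(2)[of k x] unfolding mi_size_add_axis by (simp add: algebra_simps)
      show "norm (D_x \<beta> (Delta_k \<alpha> \<sigma>) k x) \<le> C2 * bracket k powr ?e"
        by (rule order_trans[OF C2(2)]) (use C2(1) \<open>\<delta> \<ge> 0\<close> in \<open>auto intro!: mult_left_mono bracket_powr_mono\<close>)
    qed simp
    finally show ?thesis by (simp add: algebra_simps)
  qed
  then show "\<exists>C>0. \<forall>k x. norm (D_x \<beta> (Delta_k \<alpha> (deriv_x j \<sigma>)) k x) \<le> C * bracket k powr ?e"
    using C1 C2 by (intro exI[of _ "C1 + real (\<beta> $ j) * C2"]) (auto intro: add_pos_nonneg)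
qed

lemma diff_k_symbol_class:
  assumes \<sigma>: "\<sigma> \<in> symbol_class \<mu> \<rho> \<delta>"
  shows "diff_k j \<sigma> \<in> symbol_class (\<mu> - \<rho>) \<rho> \<delta>"
  unfolding symbol_class_def mem_Collect_eq
proof (intro conjI allI)
  show "diff_k j \<sigma> k \<in> smooth_torus" for k
    unfolding diff_k_def[abs_def] by (intro smooth_torus_diff symbol_class_smooth_torus[OF \<sigma>])
  show "\<exists>C>0. \<forall>k x. norm (D_x \<beta> (Delta_k \<alpha> (diff_k j \<sigma>)) k x)
     \<le> C * bracket k powr (\<mu> - \<rho> - \<rho> * real (mi_size \<alpha>) + \<delta> * real (mi_size \<beta>))" for \<alpha> \<beta>
    using symbol_class_bound[OF \<sigma>, where \<beta> = \<beta> and \<alpha> = "\<alpha> + axis j 1"]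
    unfolding Delta_k_add_axis mi_size_add_axis by (simp add: algebra_simps)
qed


subsection \<open>Peetre's inequality\<close>

lemma bracket_add_le: "bracket (k + l) \<le> bracket k + bracket l - 1"
  using norm_triangle_ineq[of "real_vec k" "real_vec l"] by (simp add: bracket_def)

lemma bracket_uminus [simp]: "bracket (- l) = bracket l"
  by (simp add: bracket_def)

lemma bracket_add_le_mult: "bracket (k + l) \<le> bracket k * bracket l"
proof -
  have "0 \<le> (bracket k - 1) * (bracket l - 1)"
    using bracket_ge_1[of k] bracket_ge_1[of l] by simp
  then show ?thesis using bracket_add_le[of k l] by (simp add: algebra_simps)
qed

text \<open>For s \<ge> 0 this is submultiplicativity; for s < 0 it is submultiplicativity for k =
  (k + l) - l, raised to the power s.\<close>

lemma bracket_powr_add_le: "bracket (k + l) powr s \<le> bracket k powr s * bracket l powr \<bar>s\<bar>"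
proof (cases "s \<ge> 0")
  case True
  then show ?thesis using powr_mono2[OF _ _ bracket_add_le_mult, of s k l] by (simp add: powr_mult)
next
  case False
  have "bracket k \<le> bracket (k + l) * bracket l" using bracket_add_le_mult[of "k + l" "- l"] by simp
  then have "(bracket (k + l) * bracket l) powr s \<le> bracket k powr s"
    using False by (intro powr_mono2') auto
  then have "bracket (k + l) powr s * bracket l powr s * bracket l powr (- s) \<le> bracket k powr s * bracket l powr (- s)"
    by (intro mult_right_mono) (auto simp: powr_mult)
  moreover have "bracket l powr s * bracket l powr (- s) = 1" by (simp flip: powr_add)
  ultimately show ?thesis using False by (simp add: mult.assoc)
qed

text \<open>
  Near the diagonal the shift costs only a constant; away from it the weight in \<open>l\<close> buys an
  arbitrary negative power of \<open>bracket k\<close>.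
\<close>

lemma bracket_powr_add_le_split:
  fixes s :: real and A P :: nat
  assumes A: "\<bar>s\<bar> \<le> real A"
  shows "bracket (k + l) powr s \<le>
    (2 powr \<bar>s\<bar> + 2 ^ P) * bracket k powr s * (1 + bracket_l1 l ^ (A + P) * bracket k powr (- real P))"
proof (cases "2 * bracket l \<le> bracket k")
  case True
  \<comment> \<open>Here \<open>bracket l\<close> is at most half of \<open>bracket k\<close>, so
    the shift changes \<open>bracket k\<close> by a factor of at most 2 either way.\<close>
  have le: "bracket k \<le> bracket (k + l) * 2"
    using bracket_add_le[of "k + l" "- l"] True by simp
  have ge: "bracket (k + l) \<le> bracket k * 2"
    using bracket_add_le[of k l] True bracket_ge_1[of l] by simp
  have "bracket (k + l) powr s \<le> bracket k powr s * 2 powr \<bar>s\<bar>"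
  proof (cases "s \<ge> 0")
    case True
    then show ?thesis using powr_mono2[OF _ _ ge, of s] by (simp add: powr_mult)
  next
    case False
    then have "(bracket (k + l) * 2) powr s \<le> bracket k powr s"
      using le by (intro powr_mono2') auto
    then have "bracket (k + l) powr s * 2 powr s * 2 powr (- s) \<le> bracket k powr s * 2 powr (- s)"
      by (intro mult_right_mono) (auto simp: powr_mult)
    moreover have "(2::real) powr s * 2 powr (- s) = 1" by (simp flip: powr_add)
    ultimately show ?thesis using False by (simp add: mult.assoc)
  qed
  also have "\<dots> \<le> (2 powr \<bar>s\<bar> + 2 ^ P) * bracket k powr s * 1"
    by (simp add: algebra_simps)
  also have "\<dots> \<le> (2 powr \<bar>s\<bar> + 2 ^ P) * bracket k powr s * (1 + bracket_l1 l ^ (A + P) * bracket k powr (- real P))"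
    by (intro mult_left_mono) auto
  finally show ?thesis .
next
  case False
  \<comment> \<open>In this case the quotient is at least 1, so its P-th power may be inserted as a
    factor. It is the source of \<open>2 ^ P\<close> and of the gain
    \<open>bracket k powr (- real P)\<close>.\<close>
  have 1: "1 \<le> (2 * bracket_l1 l / bracket k) ^ P"
    using False bracket_le_bracket_l1[of l] by (intro one_le_power) (simp add: pos_le_divide_eq)
  have "bracket l powr \<bar>s\<bar> \<le> bracket_l1 l powr real A"
    using A bracket_le_bracket_l1[of l] bracket_l1_ge_1[of l] by (intro order_trans[OF powr_mono2 powr_mono]) auto
  then have 2: "bracket l powr \<bar>s\<bar> \<le> bracket_l1 l ^ A" by (simp add: powr_realpow)
  have "bracket (k + l) powr s \<le> bracket k powr s * bracket l powr \<bar>s\<bar> * 1"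
    using bracket_powr_add_le[of k l s] by simp
  also have "\<dots> \<le> bracket k powr s * bracket_l1 l ^ A * (2 * bracket_l1 l / bracket k) ^ P"
    using 1 2 by (intro mult_mono) auto
  also have "\<dots> = 2 ^ P * bracket k powr s * (bracket_l1 l ^ (A + P) * bracket k powr (- real P))"
    by (simp add: powr_minus powr_realpow power_add power_divide power_mult_distrib field_simps)
  also have "\<dots> \<le> (2 powr \<bar>s\<bar> + 2 ^ P) * bracket k powr s * (1 + bracket_l1 l ^ (A + P) * bracket k powr (- real P))"
    by (intro mult_mono) auto
  finally show ?thesis .
qed

text \<open>For a fixed shift m Peetre's inequality costs only the constant
  \<open>bracket m powr \<bar>?e\<bar>\<close>. Shifted symbols arise from the discrete Leibniz
  rule.\<close>

lemma shift_symbol_class: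
  fixes \<sigma> :: "int ^ 'n::{finite,linorder} \<Rightarrow> real ^ 'n::{finite,linorder} \<Rightarrow> complex"
  assumes \<sigma>: "\<sigma> \<in> symbol_class \<mu> \<rho> \<delta>"
  shows "(\<lambda>k. \<sigma> (k + m)) \<in> symbol_class \<mu> \<rho> \<delta>"
  unfolding symbol_class_def mem_Collect_eq
proof (intro conjI allI)
  show "\<sigma> (k + m) \<in> smooth_torus" for k by (rule symbol_class_smooth_torus[OF \<sigma>])
  fix \<alpha> \<beta> :: "nat ^ 'n::{finite,linorder}"
  let ?e = "\<mu> - \<rho> * real (mi_size \<alpha>) + \<delta> * real (mi_size \<beta>)"
  obtain C where C: "C > 0" "\<And>k x. norm (D_x \<beta> (Delta_k \<alpha> \<sigma>) k x) \<le> C * bracket k powr ?e"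
    using symbol_class_bound[OF \<sigma>] by blast
  have "norm (D_x \<beta> (Delta_k \<alpha> (\<lambda>k. \<sigma> (k + m))) k x) \<le> (C * bracket m powr \<bar>?e\<bar>) * bracket k powr ?e" for k x
  proof -
    have "Delta_k \<alpha> (\<lambda>k. \<sigma> (k + m)) k = Delta_k \<alpha> \<sigma> (k + m)" for k
      by (simp add: Delta_k_def fun_eq_iff Delta_shift[of \<alpha> "\<lambda>k. \<sigma> k _"])
    then have "norm (D_x \<beta> (Delta_k \<alpha> (\<lambda>k. \<sigma> (k + m))) k x) \<le> C * bracket (k + m) powr ?e"
      using C(2)[of "k + m" x] by (simp add: D_x_def)
    also have "\<dots> \<le> C * (bracket k powr ?e * bracket m powr \<bar>?e\<bar>)"
      using C(1) by (intro mult_left_mono bracket_powr_add_le) auto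
    finally show ?thesis by (simp add: mult_ac)
  qed
  then show "\<exists>C>0. \<forall>k x. norm (D_x \<beta> (Delta_k \<alpha> (\<lambda>k. \<sigma> (k + m))) k x) \<le> C * bracket k powr ?e"
    using C(1) by (intro exI[of _ "C * bracket m powr \<bar>?e\<bar>"]) auto
qed

subsection \<open>Discrete Taylor expansion\<close>

text \<open>The coefficients of Newton's expansion in l. The entries of l may be negative, hence the
  generalised binomial coefficient.\<close>

definition mbinom :: "int ^ 'n::finite \<Rightarrow> nat ^ 'n \<Rightarrow> complex" where
  "mbinom l \<alpha> = (\<Prod>j\<in>UNIV. of_int (l $ j) gchoose (\<alpha> $ j))"

lemma falling_eq_mbinom: "falling l \<alpha> = of_nat (mi_fact \<alpha>) * mbinom l \<alpha>"
  by (simp add: falling_def mbinom_def mi_fact_def prod.distrib[symmetric] gbinomial_mult_fact atLeast0LessThan)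

lemma mbinom_axis_Suc: "mbinom (l + axis j 1) (\<alpha> + axis j 1) = mbinom l (\<alpha> + axis j 1) + mbinom l \<alpha>"
proof -
  have split: "mbinom l \<alpha> = (of_int (l $ j) gchoose (\<alpha> $ j)) * (\<Prod>i\<in>UNIV - {j}. of_int (l $ i) gchoose (\<alpha> $ i))" for l \<alpha>
    unfolding mbinom_def by (rule prod.remove) auto
  have rest: "(\<Prod>i\<in>UNIV - {j}. of_int (l' $ i) gchoose (\<alpha>' $ i)) = (\<Prod>i\<in>UNIV - {j}. of_int (l $ i) gchoose (\<alpha> $ i) :: complex)"
    if "\<And>i. i \<noteq> j \<Longrightarrow> l' $ i = l $ i \<and> \<alpha>' $ i = \<alpha> $ i" for l' \<alpha>'
    by (intro prod.cong) (use that in auto)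
  have 1: "(l + axis j 1) $ j = l $ j + 1" "(\<alpha> + axis j 1) $ j = Suc (\<alpha> $ j)" by (simp_all add: axis_def)
  have 2: "(\<Prod>i\<in>UNIV - {j}. of_int ((l + axis j 1) $ i) gchoose ((\<alpha> + axis j 1) $ i)) = (\<Prod>i\<in>UNIV - {j}. of_int (l $ i) gchoose (\<alpha> $ i) :: complex)"
    "(\<Prod>i\<in>UNIV - {j}. of_int (l $ i) gchoose ((\<alpha> + axis j 1) $ i)) = (\<Prod>i\<in>UNIV - {j}. of_int (l $ i) gchoose (\<alpha> $ i) :: complex)"
    by (rule rest; simp add: axis_def)+
  show ?thesis
    unfolding split[of "l + axis j 1"] split[of l] 1 2 of_int_add of_int_1 gbinomial_Suc_Suc
    by (simp add: algebra_simps)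
qed

lemma mbinom_axis_0: "\<alpha> $ j = 0 \<Longrightarrow> mbinom (l + axis j 1) \<alpha> = mbinom l \<alpha>"
  unfolding mbinom_def by (intro prod.cong) (auto simp: axis_def)

lemma mbinom_0: "mbinom 0 \<alpha> = (if \<alpha> = 0 then 1 else 0)"
proof (cases "\<alpha> = 0")
  case False
  then obtain j where "\<alpha> $ j \<noteq> 0" by (auto simp: vec_eq_iff)
  then obtain m where "\<alpha> $ j = Suc m" by (cases "\<alpha> $ j") auto
  then have "(0::complex) gchoose (\<alpha> $ j) = 0" by simp
  then show ?thesis using False by (auto simp: mbinom_def)
qed (simp add: mbinom_def)

lemma finite_mi_size: "finite {\<alpha> :: nat ^ 'n::finite. mi_size \<alpha> < N}"
proof (rule finite_subset)
  show "{\<alpha> :: nat ^ 'n. mi_size \<alpha> < N} \<subseteq> vec_lambda ` (PiE UNIV (\<lambda>_. {..<N}))"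
  proof
    fix \<alpha> :: "nat ^ 'n" assume "\<alpha> \<in> {\<alpha>. mi_size \<alpha> < N}"
    moreover have "\<alpha> $ j \<le> mi_size \<alpha>" for j unfolding mi_size_def by (rule member_le_sum) auto
    ultimately show "\<alpha> \<in> vec_lambda ` (PiE UNIV (\<lambda>_. {..<N}))"
      by (intro image_eqI[of _ _ "\<lambda>j. \<alpha> $ j"]) (auto intro: le_less_trans)
  qed
  show "finite (vec_lambda ` (PiE (UNIV :: 'n set) (\<lambda>_. {..<N})))"
    by (intro finite_imageI finite_PiE) auto
qed

text \<open>Because the bound on \<open>mi_size\<close> is strict, N = 0 leaves the plain shifted
  value. This is why \<open>comp_rem 0\<close> below is the whole symbol of the composition.\<close>

definition taylor_rem :: "nat \<Rightarrow> (int ^ 'n::{finite,linorder} \<Rightarrow> complex) \<Rightarrow> int ^ 'n::{finite,linorder} \<Rightarrow> int ^ 'n::{finite,linorder} \<Rightarrow> complex" where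
  "taylor_rem N t k l = t (k + l) - (\<Sum>\<alpha> | mi_size \<alpha> < N. mbinom l \<alpha> * Delta \<alpha> t k)"

lemma taylor_rem_0 [simp]: "taylor_rem 0 t k l = t (k + l)"
  by (simp add: taylor_rem_def)

lemma taylor_rem_Suc_at_0:
  fixes t :: "int ^ 'n::{finite,linorder} \<Rightarrow> complex"
  shows "taylor_rem (Suc N) t k 0 = 0"
proof -
  have "(\<Sum>\<alpha> | mi_size \<alpha> < Suc N. mbinom 0 \<alpha> * Delta \<alpha> t k) = (\<Sum>\<alpha> | mi_size (\<alpha> :: nat ^ 'n::{finite,linorder}) < Suc N. if \<alpha> = 0 then t k else 0)"
    by (intro sum.cong) (auto simp: mbinom_0)
  also have "\<dots> = t k" by (subst sum.delta[OF finite_mi_size]) simp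
  finally show ?thesis by (simp add: taylor_rem_def)
qed

text \<open>Pascal's rule applied to every Newton term. Terms with \<alpha>_j = 0 do not depend on
  l_j and cancel; the remaining indices have the form \<alpha> + e_j with |\<alpha>| < N.\<close>

lemma taylor_rem_difference:
  "taylor_rem (Suc N) t k (l + axis j 1) - taylor_rem (Suc N) t k l = taylor_rem N (diff1 j t) k l"
proof -
  let ?S = "{\<alpha>. mi_size \<alpha> < Suc N}" and ?i = "\<lambda>\<alpha>. \<alpha> + axis j 1"
  let ?f = "\<lambda>\<alpha>. (mbinom (l + axis j 1) \<alpha> - mbinom l \<alpha>) * Delta \<alpha> t k"
  have "(\<Sum>\<alpha>\<in>?S. ?f \<alpha>) = (\<Sum>\<alpha>\<in>?i ` {\<alpha>. mi_size \<alpha> < N}. ?f \<alpha>)"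
  proof (rule sum.mono_neutral_right[OF finite_mi_size])
    show "?i ` {\<alpha>. mi_size \<alpha> < N} \<subseteq> ?S" by (auto simp only: mi_size_add_axis mem_Collect_eq image_iff)
    show "\<forall>\<alpha>\<in>?S - ?i ` {\<alpha>. mi_size \<alpha> < N}. ?f \<alpha> = 0"
    proof
      fix \<alpha> assume \<alpha>: "\<alpha> \<in> ?S - ?i ` {\<alpha>. mi_size \<alpha> < N}"
      have "\<alpha> $ j = 0"
      proof (rule ccontr)
        assume "\<alpha> $ j \<noteq> 0"
        then have "\<alpha> = ?i (\<alpha> - axis j 1)" by (auto simp: vec_eq_iff axis_def)
        moreover from this have "mi_size (\<alpha> - axis j 1) < N" using \<alpha> mi_size_add_axis[of "\<alpha> - axis j 1" j] by simp
        ultimately show False using \<alpha> by blast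
      qed
      then show "?f \<alpha> = 0" by (simp add: mbinom_axis_0)
    qed
  qed
  also have "\<dots> = (\<Sum>\<alpha> | mi_size \<alpha> < N. ?f (?i \<alpha>))"
    by (subst sum.reindex) (auto simp: inj_on_def)
  also have "\<dots> = (\<Sum>\<alpha> | mi_size \<alpha> < N. mbinom l \<alpha> * Delta \<alpha> (diff1 j t) k)"
    by (intro sum.cong refl) (simp only: mbinom_axis_Suc Delta_Suc add_diff_cancel_left')
  finally have "(\<Sum>\<alpha>\<in>?S. mbinom (l + axis j 1) \<alpha> * Delta \<alpha> t k) - (\<Sum>\<alpha>\<in>?S. mbinom l \<alpha> * Delta \<alpha> t k)
      = (\<Sum>\<alpha> | mi_size \<alpha> < N. mbinom l \<alpha> * Delta \<alpha> (diff1 j t) k)"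
    by (simp only: left_diff_distrib sum_subtractf)
  then show ?thesis by (simp add: taylor_rem_def diff1_def[of _ _ "k + l"] add.assoc algebra_simps)
qed

lemma taylor_rem_shift: "taylor_rem N (\<lambda>k. t (k + m)) k l = taylor_rem N t (k + m) l"
  by (simp add: taylor_rem_def Delta_shift add_ac)

text \<open>Here the base point k moves while l is fixed, in contrast to
  \<open>taylor_rem_difference\<close>; this form serves the Leibniz rule in k.\<close>

lemma taylor_rem_diff1: "taylor_rem N (diff1 j t) k l = taylor_rem N t (k + axis j 1) l - taylor_rem N t k l"
  by (simp add: taylor_rem_def Delta_diff1 diff1_def[of _ _ "k + l"] right_diff_distrib sum_subtractf add_ac)

definition norm_l1 :: "int ^ 'n::finite \<Rightarrow> nat" where
  "norm_l1 l = (\<Sum>j\<in>UNIV. nat \<bar>l $ j\<bar>)"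

lemma bracket_l1_eq_norm_l1: "bracket_l1 l = 1 + real (norm_l1 l)"
  by (simp add: bracket_l1_def norm_l1_def)

lemma norm_l1_step:
  assumes "norm_l1 l = Suc n"
  obtains j where "norm_l1 (l - axis j 1) = n" | j where "norm_l1 (l + axis j 1) = n"
proof -
  have split: "norm_l1 m = nat \<bar>m $ j\<bar> + (\<Sum>i\<in>UNIV - {j}. nat \<bar>m $ i\<bar>)" for m j
    unfolding norm_l1_def by (rule sum.remove) auto
  obtain j where j: "l $ j \<noteq> 0" using assms by (force simp: norm_l1_def)
  have rest: "(\<Sum>i\<in>UNIV - {j}. nat \<bar>(l - axis j 1) $ i\<bar>) = (\<Sum>i\<in>UNIV - {j}. nat \<bar>l $ i\<bar>)"
    "(\<Sum>i\<in>UNIV - {j}. nat \<bar>(l + axis j 1) $ i\<bar>) = (\<Sum>i\<in>UNIV - {j}. nat \<bar>l $ i\<bar>)"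
    by (intro sum.cong; simp add: axis_def)+
  show ?thesis
  proof (cases "l $ j > 0")
    case True
    then have "norm_l1 (l - axis j 1) = n"
      using assms split[of l j] split[of "l - axis j 1" j] unfolding rest by (simp add: axis_def)
    then show ?thesis by (rule that)
  next
    case False
    then have "norm_l1 (l + axis j 1) = n"
      using assms j split[of l j] split[of "l + axis j 1" j] unfolding rest by (simp add: axis_def)
    then show ?thesis by (rule that(2))
  qed
qed

text \<open>A unit step towards 0 lowers \<open>norm_l1\<close> by one, so \<open>norm_l1 l\<close>
  steps join 0 to l without leaving the ball of radius L, and each changes F by at most B.\<close>

lemma norm_le_path:
  fixes F :: "int ^ 'n::finite \<Rightarrow> 'a::real_normed_vector"
  assumes 0: "F 0 = 0" and step: "\<And>j m. norm_l1 m \<le> L \<Longrightarrow> norm (F (m + axis j 1) - F m) \<le> B"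
    and "norm_l1 l \<le> L"
  shows "norm (F l) \<le> real (norm_l1 l) * B"
  using assms(3)
proof (induction "norm_l1 l" arbitrary: l)
  case 0
  then have "l = 0" by (simp add: norm_l1_def vec_eq_iff)
  then show ?case using assms(1) by (simp add: norm_l1_def)
next
  case (Suc n)
  from Suc.hyps(2)[symmetric] show ?case
  proof (cases rule: norm_l1_step)
    case (1 j)
    have "norm (F l) \<le> norm (F (l - axis j 1)) + norm (F l - F (l - axis j 1))"
      using norm_triangle_sub[of "F l" "F (l - axis j 1)"] by simp
    also have "\<dots> \<le> real n * B + B"
      using Suc.hyps(1)[of "l - axis j 1"] step[of "l - axis j 1" j] 1 Suc.prems Suc.hyps(2)
      by (intro add_mono) auto
    finally show ?thesis using Suc.hyps(2)[symmetric] by (simp add: algebra_simps)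
  next
    case (2 j)
    have "norm (F l) \<le> norm (F (l + axis j 1)) + norm (F (l + axis j 1) - F l)"
      using norm_triangle_sub[of "F l" "F (l + axis j 1)"] by (simp add: norm_minus_commute)
    also have "\<dots> \<le> real n * B + B"
      using Suc.hyps(1)[of "l + axis j 1"] step[of l j] 2 Suc.prems Suc.hyps(2)
      by (intro add_mono) auto
    finally show ?thesis using Suc.hyps(2)[symmetric] by (simp add: algebra_simps)
  qed
qed

text \<open>A unit step in l turns the remainder of order N + 1 of \<tau> into the remainder of
  order N of \<open>diff_k j \<tau>\<close>, whose symbol order is lower by \<rho>; adding up along
  a path gives one more factor \<open>norm_l1 l\<close>. The majorant W is monotone so that its
  value at l dominates those at all points of the path.\<close>

lemma taylor_rem_bound:
  fixes W :: "int ^ 'n::{finite,linorder} \<Rightarrow> nat \<Rightarrow> real"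
  assumes mono: "\<And>k m n. m \<le> n \<Longrightarrow> W k m \<le> W k n" and nonneg: "\<And>k n. W k n \<ge> 0"
    and W: "\<And>k l. bracket (k + l) powr s \<le> W k (norm_l1 l)"
  shows "\<tau> \<in> symbol_class (s + \<rho> * real N) \<rho> \<delta> \<Longrightarrow>
    \<exists>C\<ge>0. \<forall>k l x. norm (taylor_rem N (\<lambda>k. \<tau> k x) k l) \<le> C * real (norm_l1 l) ^ N * W k (norm_l1 l)"
proof (induction N arbitrary: \<tau>)
  case 0
  then have "\<tau> \<in> symbol_class s \<rho> \<delta>" by simp
  then obtain C where C: "C > 0" "\<And>k x. norm (\<tau> k x) \<le> C * bracket k powr s"
    using symbol_class_bound_0 by blast
  have "norm (taylor_rem 0 (\<lambda>k. \<tau> k x) k l) \<le> C * real (norm_l1 l) ^ 0 * W k (norm_l1 l)" for k l x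
    using order_trans[OF C(2)[of "k + l" x] mult_left_mono[OF W[of k l], of C]] C(1) by simp
  then show ?case using C(1) by (intro exI[of _ C]) auto
next
  case (Suc N)
  have "\<exists>C\<ge>0. \<forall>k l x. norm (taylor_rem N (\<lambda>k. diff_k j \<tau> k x) k l) \<le> C * real (norm_l1 l) ^ N * W k (norm_l1 l)" for j
    using diff_k_symbol_class[OF Suc.prems, of j] by (intro Suc.IH) (simp add: algebra_simps)
  then obtain K where K: "\<And>j. K j \<ge> 0"
    "\<And>j k l x. norm (taylor_rem N (\<lambda>k. diff_k j \<tau> k x) k l) \<le> K j * real (norm_l1 l) ^ N * W k (norm_l1 l)"
    by metis
  let ?C = "\<Sum>j\<in>UNIV. K j"
  have C: "K j \<le> ?C" "0 \<le> ?C" for j using K(1) by (auto intro: member_le_sum sum_nonneg)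
  have "norm (taylor_rem (Suc N) (\<lambda>k. \<tau> k x) k l) \<le> real (norm_l1 l) * (?C * real (norm_l1 l) ^ N * W k (norm_l1 l))" for k l x
  proof (rule norm_le_path[of "taylor_rem (Suc N) (\<lambda>k. \<tau> k x) k" "norm_l1 l" _ l])
    fix j and m :: "int ^ 'n::{finite,linorder}" assume m: "norm_l1 m \<le> norm_l1 l"
    have "norm (taylor_rem N (\<lambda>k. diff_k j \<tau> k x) k m) \<le> K j * real (norm_l1 m) ^ N * W k (norm_l1 m)"
      by (rule K(2))
    also have "\<dots> \<le> ?C * real (norm_l1 l) ^ N * W k (norm_l1 l)"
      using m K(1) C nonneg mono by (intro mult_mono power_mono) auto
    finally show "norm (taylor_rem (Suc N) (\<lambda>k. \<tau> k x) k (m + axis j 1) - taylor_rem (Suc N) (\<lambda>k. \<tau> k x) k m)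
        \<le> ?C * real (norm_l1 l) ^ N * W k (norm_l1 l)"
      by (simp only: taylor_rem_difference diff1_symbol)
  qed (simp_all add: taylor_rem_Suc_at_0)
  then show ?case using C(2) by (intro exI[of _ ?C]) (simp add: mult_ac)
qed

subsection \<open>The remainder of the composition expansion\<close>

text \<open>The argument of \<open>coef_decay\<close> with the dependence on k recorded: each power
  of \<open>bracket_l1 l\<close> is bought with at most one derivative in x, hence with \<delta>
  powers of \<open>bracket k\<close>.\<close>

lemma coef_symbol_decay:
  fixes \<sigma> :: "int ^ 'n::{finite,linorder} \<Rightarrow> real ^ 'n::{finite,linorder} \<Rightarrow> complex"
  assumes "0 \<le> \<delta>"
  shows "\<sigma> \<in> symbol_class \<mu> \<rho> \<delta> \<Longrightarrow>
    \<exists>C\<ge>0. \<forall>k l. norm (coef (\<sigma> k) l) * bracket_l1 l ^ M \<le> C * bracket k powr (\<mu> + \<delta> * real M)"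
proof (induction M arbitrary: \<sigma> \<mu>)
  case 0
  obtain C where C: "C > 0" "\<And>k x. norm (\<sigma> k x) \<le> C * bracket k powr \<mu>"
    using symbol_class_bound_0[OF 0] by blast
  have "norm (coef (\<sigma> k) l) \<le> C * bracket k powr \<mu>" for k l
    by (intro norm_coef_le smooth_torus_ctorus symbol_class_smooth_torus[OF 0] C(2))
  then show ?case using C(1) by (intro exI[of _ C]) auto
next
  case (Suc M)
  let ?w = "\<lambda>k. bracket k powr (\<mu> + \<delta> * real (Suc M))"
  obtain C where C: "C \<ge> 0" "\<And>k l. norm (coef (\<sigma> k) l) * bracket_l1 l ^ M \<le> C * bracket k powr (\<mu> + \<delta> * real M)"
    using Suc.IH[OF Suc.prems] by blast
  have "\<exists>C\<ge>0. \<forall>k l. norm (coef (deriv_x j \<sigma> k) l) * bracket_l1 l ^ M \<le> C * ?w k" for j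
    using Suc.IH[OF deriv_x_symbol_class[OF Suc.prems assms, of j]] by (simp add: algebra_simps)
  then obtain K where K: "\<And>j. K j \<ge> 0" "\<And>j k l. norm (coef (deriv_x j \<sigma> k) l) * bracket_l1 l ^ M \<le> K j * ?w k"
    by metis
  have "norm (coef (\<sigma> k) l) * bracket_l1 l ^ Suc M \<le> (C + (\<Sum>j\<in>UNIV. K j)) * ?w k" for k l
  proof -
    have "norm (coef (\<sigma> k) l) * bracket_l1 l ^ Suc M = norm (coef (\<sigma> k) l) * bracket_l1 l ^ M + (\<Sum>j\<in>UNIV. norm (coef (deriv_x j \<sigma> k) l) * bracket_l1 l ^ M)"
      by (simp add: deriv_x_def coef_scaled_pd[OF symbol_class_smooth_torus[OF Suc.prems]] norm_mult bracket_l1_def[of l] distrib_left sum_distrib_left sum_distrib_right algebra_simps)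
    also have "\<dots> \<le> C * ?w k + (\<Sum>j\<in>UNIV. K j * ?w k)"
    proof (intro add_mono sum_mono K(2))
      show "norm (coef (\<sigma> k) l) * bracket_l1 l ^ M \<le> C * ?w k"
        by (rule order_trans[OF C(2)]) (use C(1) assms in \<open>auto intro!: mult_left_mono bracket_powr_mono\<close>)
    qed
    finally show ?thesis by (simp add: distrib_right sum_distrib_right)
  qed
  then show ?case using C(1) K(1) by (intro exI[of _ "C + (\<Sum>j\<in>UNIV. K j)"]) (auto intro!: add_nonneg_nonneg sum_nonneg)
qed

definition rem_term ::
    "nat \<Rightarrow> (int ^ 'n::{finite,linorder} \<Rightarrow> real ^ 'n::{finite,linorder} \<Rightarrow> complex) \<Rightarrow>
     (int ^ 'n::{finite,linorder} \<Rightarrow> real ^ 'n::{finite,linorder} \<Rightarrow> complex) \<Rightarrow>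
     int ^ 'n::{finite,linorder} \<Rightarrow> int ^ 'n::{finite,linorder} \<Rightarrow> real ^ 'n::{finite,linorder} \<Rightarrow> complex" where
  "rem_term N \<sigma> \<tau> k l x = coef (\<sigma> k) l * character l x * taylor_rem N (\<lambda>k. \<tau> k x) k l"

definition comp_rem ::
    "nat \<Rightarrow> (int ^ 'n::{finite,linorder} \<Rightarrow> real ^ 'n::{finite,linorder} \<Rightarrow> complex) \<Rightarrow>
     (int ^ 'n::{finite,linorder} \<Rightarrow> real ^ 'n::{finite,linorder} \<Rightarrow> complex) \<Rightarrow>
     int ^ 'n::{finite,linorder} \<Rightarrow> real ^ 'n::{finite,linorder} \<Rightarrow> complex" where
  "comp_rem N \<sigma> \<tau> k x = (\<Sum>\<^sub>\<infinity>l. rem_term N \<sigma> \<tau> k l x)"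

text \<open>The Taylor remainder brings in \<open>norm_l1 l ^ N\<close>, and summability over l asks
  for 2n more powers. The decay of the coefficients supplies these N + 2n powers at the price
  \<delta> each, which explains the exponent.\<close>

lemma rem_term_bound:
  fixes \<sigma> \<tau> :: "int ^ 'n::{finite,linorder} \<Rightarrow> real ^ 'n::{finite,linorder} \<Rightarrow> complex"
  assumes \<delta>: "0 \<le> \<delta>" "\<delta> < 1"
    and \<sigma>: "\<sigma> \<in> symbol_class \<mu>1 \<rho> \<delta>" and \<tau>: "\<tau> \<in> symbol_class \<mu>2 \<rho> \<delta>"
  shows "\<exists>C\<ge>0. \<forall>k l x. norm (rem_term N \<sigma> \<tau> k l x) \<le>
    C * bracket k powr (\<mu>1 + \<mu>2 - real N * (\<rho> - \<delta>) + \<delta> * real (2 * CARD('n))) * (1 / bracket_l1 l ^ (2 * CARD('n)))"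
proof -
  define d where "d = 2 * CARD('n)"
  define s where "s = \<mu>2 - \<rho> * real N"
  obtain A :: nat where A: "\<bar>s\<bar> \<le> real A" using real_arch_simple by blast
  \<comment> \<open>P is so large that the gain \<open>bracket k powr (- real P)\<close> pays for
    the A + P additional powers of l, at \<delta> each, in the second summand of W. This is where
    \<delta> < 1 enters.\<close>
  obtain P :: nat where "\<delta> * real A / (1 - \<delta>) \<le> real P" using real_arch_simple by blast
  then have P: "\<delta> * real (A + P) \<le> real P" using \<delta> by (simp add: field_simps)
  define K :: real where "K = 2 powr \<bar>s\<bar> + 2 ^ P"
  have K: "K \<ge> 0" by (simp add: K_def)
  define W :: "int ^ 'n::{finite,linorder} \<Rightarrow> nat \<Rightarrow> real"
    where "W k n = K * bracket k powr s * (1 + (1 + real n) ^ (A + P) * bracket k powr (- real P))" for k n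
  have "\<exists>C\<ge>0. \<forall>k l x. norm (taylor_rem N (\<lambda>k. \<tau> k x) k l) \<le> C * real (norm_l1 l) ^ N * W k (norm_l1 l)"
  proof (rule taylor_rem_bound)
    show "W k m \<le> W k n" if "m \<le> n" for k m n
      unfolding W_def using that K by (intro mult_left_mono add_left_mono mult_right_mono power_mono) auto
    show "W k n \<ge> 0" for k n
      unfolding W_def using K by (intro mult_nonneg_nonneg add_nonneg_nonneg zero_le_power) auto
    show "bracket (k + l) powr s \<le> W k (norm_l1 l)" for k l
      using bracket_powr_add_le_split[OF A, of k l P] by (simp add: W_def K_def bracket_l1_eq_norm_l1)
    show "\<tau> \<in> symbol_class (s + \<rho> * real N) \<rho> \<delta>" using \<tau> by (simp add: s_def)
  qed
  then obtain R where R: "R \<ge> 0" "\<And>k l x. norm (taylor_rem N (\<lambda>k. \<tau> k x) k l) \<le> R * real (norm_l1 l) ^ N * W k (norm_l1 l)"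
    by blast
  define e where "e = \<mu>1 + \<delta> * real (N + d)"
  obtain C1 where C1: "C1 \<ge> 0" "\<And>k l. norm (coef (\<sigma> k) l) * bracket_l1 l ^ (N + d) \<le> C1 * bracket k powr e"
    using coef_symbol_decay[OF \<delta>(1) \<sigma>, of "N + d"] unfolding e_def by blast
  obtain C2 where C2: "C2 \<ge> 0" "\<And>k l. norm (coef (\<sigma> k) l) * bracket_l1 l ^ (N + d + (A + P)) \<le> C2 * bracket k powr (\<mu>1 + \<delta> * real (N + d + (A + P)))"
    using coef_symbol_decay[OF \<delta>(1) \<sigma>, of "N + d + (A + P)"] by blast
  have "norm (rem_term N \<sigma> \<tau> k l x) * bracket_l1 l ^ d \<le> R * K * (C1 + C2) * bracket k powr (s + e)" for k l x
  proof -
    let ?c = "norm (coef (\<sigma> k) l)" and ?p = "bracket k powr (- real P)"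
    have W: "W k (norm_l1 l) = K * bracket k powr s * (1 + bracket_l1 l ^ (A + P) * ?p)"
      by (simp add: W_def bracket_l1_eq_norm_l1)
    have "norm (taylor_rem N (\<lambda>k. \<tau> k x) k l) \<le> R * bracket_l1 l ^ N * (K * bracket k powr s * (1 + bracket_l1 l ^ (A + P) * ?p))"
      unfolding W[symmetric]
      by (rule order_trans[OF R(2)], intro mult_right_mono mult_left_mono power_mono)
         (use R(1) K in \<open>auto simp: bracket_l1_eq_norm_l1 W_def\<close>)
    then have "norm (rem_term N \<sigma> \<tau> k l x) * bracket_l1 l ^ d \<le> ?c * (R * bracket_l1 l ^ N * (K * bracket k powr s * (1 + bracket_l1 l ^ (A + P) * ?p))) * bracket_l1 l ^ d"
      unfolding rem_term_def norm_mult norm_character mult_1_right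
      by (intro mult_right_mono mult_left_mono) auto
    also have "\<dots> = R * K * bracket k powr s * (?c * bracket_l1 l ^ (N + d) + (?c * bracket_l1 l ^ (N + d + (A + P))) * ?p)"
      by (simp add: power_add algebra_simps)
    also have "\<dots> \<le> R * K * bracket k powr s * (C1 * bracket k powr e + C2 * bracket k powr e)"
    proof (intro mult_left_mono add_mono)
      show "?c * bracket_l1 l ^ (N + d) \<le> C1 * bracket k powr e" by (rule C1(2))
      have "(?c * bracket_l1 l ^ (N + d + (A + P))) * ?p \<le> (C2 * bracket k powr (\<mu>1 + \<delta> * real (N + d + (A + P)))) * ?p"
        by (intro mult_right_mono C2(2)) auto
      also have "\<dots> = C2 * bracket k powr (\<mu>1 + \<delta> * real (N + d + (A + P)) - real P)"
        by (simp add: powr_add[symmetric])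
      also have "\<dots> \<le> C2 * bracket k powr e"
        using C2(1) P unfolding e_def by (intro mult_left_mono bracket_powr_mono) (auto simp: algebra_simps)
      finally show "(?c * bracket_l1 l ^ (N + d + (A + P))) * ?p \<le> C2 * bracket k powr e" .
    qed (use R K in auto)
    finally show ?thesis by (simp add: powr_add algebra_simps)
  qed
  then have "norm (rem_term N \<sigma> \<tau> k l x) \<le> R * K * (C1 + C2) * bracket k powr (s + e) * (1 / bracket_l1 l ^ d)" for k l x
    by (simp add: pos_le_divide_eq)
  moreover have "s + e = \<mu>1 + \<mu>2 - real N * (\<rho> - \<delta>) + \<delta> * real (2 * CARD('n))"
    by (simp add: s_def e_def d_def algebra_simps)
  ultimately show ?thesis
    using R(1) K C1(1) C2(1) by (intro exI[of _ "R * K * (C1 + C2)"]) (auto simp: d_def)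
qed

lemma taylor_rem_symbol:
  "taylor_rem N (\<lambda>k. \<tau> k x) k l = \<tau> (k + l) x - (\<Sum>\<alpha> | mi_size \<alpha> < N. mbinom l \<alpha> * Delta_k \<alpha> \<tau> k x)"
  by (simp add: taylor_rem_def Delta_k_def)

lemma rem_term_ctorus:
  assumes "\<And>k. \<tau> k \<in> smooth_torus"
  shows "rem_term N \<sigma> \<tau> k l \<in> ctorus"
  unfolding rem_term_def[abs_def] taylor_rem_symbol
  by (intro ctorus_mult ctorus_diff ctorus_sum ctorus_const character_ctorus smooth_torus_ctorus Delta_k_smooth_torus_deriv_x(1) assms)

text \<open>Differentiating the character brings down l_j, which turns
  \<open>coef (\<sigma> k) l\<close> into the coefficient of \<open>deriv_x j \<sigma>\<close>; the
  Taylor remainder is linear and passes the derivative on to \<tau>.\<close>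

lemma rem_term_has_pd:
  assumes \<sigma>: "\<And>k. \<sigma> k \<in> smooth_torus" and \<tau>: "\<And>k. \<tau> k \<in> smooth_torus"
  shows "has_pd j (rem_term N \<sigma> \<tau> k l)
    (\<lambda>x. 2 * of_real pi * \<i> * (rem_term N (deriv_x j \<sigma>) \<tau> k l x + rem_term N \<sigma> (deriv_x j \<tau>) k l x))"
proof -
  let ?c = "2 * of_real pi * \<i> :: complex"
  have "has_pd j (\<lambda>x. taylor_rem N (\<lambda>k. \<tau> k x) k l)
      (\<lambda>x. ?c * scaled_pd j (\<tau> (k + l)) x - (\<Sum>\<alpha> | mi_size \<alpha> < N. mbinom l \<alpha> * (?c * scaled_pd j (Delta_k \<alpha> \<tau> k) x)))"
    unfolding taylor_rem_symbol
    by (intro has_pd_diff has_pd_sum has_pd_cmult smooth_torus_has_pd_scaled_pd Delta_k_smooth_torus_deriv_x(1) \<tau>)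
  also have "(\<lambda>x. ?c * scaled_pd j (\<tau> (k + l)) x - (\<Sum>\<alpha> | mi_size \<alpha> < N. mbinom l \<alpha> * (?c * scaled_pd j (Delta_k \<alpha> \<tau> k) x)))
      = (\<lambda>x. ?c * taylor_rem N (\<lambda>k. deriv_x j \<tau> k x) k l)"
    unfolding taylor_rem_symbol[of N "deriv_x j \<tau>"]
    unfolding Delta_k_smooth_torus_deriv_x(2)[OF \<tau>] deriv_x_def
    by (simp only: right_diff_distrib sum_distrib_left mult.left_commute)
  finally have 1: "has_pd j (\<lambda>x. taylor_rem N (\<lambda>k. \<tau> k x) k l) (\<lambda>x. ?c * taylor_rem N (\<lambda>k. deriv_x j \<tau> k x) k l)" .
  have c: "coef (deriv_x j \<sigma> k) l = of_int (l $ j) * coef (\<sigma> k) l"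
    by (simp add: deriv_x_def coef_scaled_pd \<sigma>)
  have "has_pd j (\<lambda>x. coef (\<sigma> k) l * character l x) (\<lambda>x. coef (\<sigma> k) l * (?c * of_int (l $ j) * character l x))"
    by (intro has_pd_cmult has_pd_character)
  from has_pd_mult[OF this 1] show ?thesis
    unfolding rem_term_def[abs_def] c by (simp add: algebra_simps)
qed

section \<open>Convergence of the remainder series and its Leibniz rules\<close>

context
  fixes \<rho> \<delta> :: real
  assumes \<delta>: "0 \<le> \<delta>" "\<delta> < \<rho>" "\<rho> \<le> 1"
begin

lemma rem_term_dominated:
  fixes \<sigma> \<tau> :: "int ^ 'n::{finite,linorder} \<Rightarrow> real ^ 'n::{finite,linorder} \<Rightarrow> complex"
  assumes \<sigma>: "\<sigma> \<in> symbol_class \<mu>1 \<rho> \<delta>" and \<tau>: "\<tau> \<in> symbol_class \<mu>2 \<rho> \<delta>"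
  obtains C where "\<And>l x. norm (rem_term N \<sigma> \<tau> k l x) \<le> C * (1 / bracket_l1 l ^ (2 * CARD('n)))"
  using rem_term_bound[OF \<delta>(1) _ \<sigma> \<tau>, of N] \<delta> by (meson order_less_le_trans)

lemma rem_term_summable:
  assumes "\<sigma> \<in> symbol_class \<mu>1 \<rho> \<delta>" "\<tau> \<in> symbol_class \<mu>2 \<rho> \<delta>"
  shows "(\<lambda>l. rem_term N \<sigma> \<tau> k l x) summable_on UNIV"
  using rem_term_dominated[OF assms, of N k] dominated_summable[OF _ summable_const_bracket_l1] by metis

lemma comp_rem_ctorus:
  assumes \<sigma>: "\<sigma> \<in> symbol_class \<mu>1 \<rho> \<delta>" and \<tau>: "\<tau> \<in> symbol_class \<mu>2 \<rho> \<delta>"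
  shows "comp_rem N \<sigma> \<tau> k \<in> ctorus"
proof -
  have t: "rem_term N \<sigma> \<tau> k l \<in> ctorus" for l
    by (intro rem_term_ctorus symbol_class_smooth_torus[OF \<tau>])
  obtain C where C: "\<And>l x. norm (rem_term N \<sigma> \<tau> k l x) \<le> C * (1 / bracket_l1 l ^ (2 * CARD('a)))"
    using rem_term_dominated[OF \<sigma> \<tau>] by blast
  have "continuous_on UNIV (\<lambda>x. \<Sum>\<^sub>\<infinity>l. rem_term N \<sigma> \<tau> k l x)"
    by (rule dominated_continuous[OF C summable_const_bracket_l1]) (rule ctorus_continuous_on[OF t])
  moreover have "rem_term N \<sigma> \<tau> k l (x + real_vec m) = rem_term N \<sigma> \<tau> k l x" for l x m
    using t[of l] by (simp add: ctorus_def)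
  ultimately show ?thesis by (simp add: ctorus_def comp_rem_def[abs_def])
qed

lemma comp_rem_has_pd:
  assumes \<sigma>: "\<sigma> \<in> symbol_class \<mu>1 \<rho> \<delta>" and \<tau>: "\<tau> \<in> symbol_class \<mu>2 \<rho> \<delta>"
  shows "has_pd j (comp_rem N \<sigma> \<tau> k)
    (\<lambda>x. 2 * of_real pi * \<i> * (comp_rem N (deriv_x j \<sigma>) \<tau> k x + comp_rem N \<sigma> (deriv_x j \<tau>) k x))"
proof -
  note s = symbol_class_smooth_torus[OF \<sigma>] and t = symbol_class_smooth_torus[OF \<tau>]
  note \<sigma>' = deriv_x_symbol_class[OF \<sigma> \<delta>(1), of j] and \<tau>' = deriv_x_symbol_class[OF \<tau> \<delta>(1), of j]
  let ?c = "2 * of_real pi * \<i> :: complex"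
  obtain C where C: "\<And>l x. norm (rem_term N \<sigma> \<tau> k l x) \<le> C * (1 / bracket_l1 l ^ (2 * CARD('a)))"
    using rem_term_dominated[OF \<sigma> \<tau>] by blast
  obtain C1 where C1: "\<And>l x. norm (rem_term N (deriv_x j \<sigma>) \<tau> k l x) \<le> C1 * (1 / bracket_l1 l ^ (2 * CARD('a)))"
    using rem_term_dominated[OF \<sigma>' \<tau>] by blast
  obtain C2 where C2: "\<And>l x. norm (rem_term N \<sigma> (deriv_x j \<tau>) k l x) \<le> C2 * (1 / bracket_l1 l ^ (2 * CARD('a)))"
    using rem_term_dominated[OF \<sigma> \<tau>'] by blast
  have "has_pd j (\<lambda>x. \<Sum>\<^sub>\<infinity>l. rem_term N \<sigma> \<tau> k l x)
    (\<lambda>x. \<Sum>\<^sub>\<infinity>l. ?c * (rem_term N (deriv_x j \<sigma>) \<tau> k l x + rem_term N \<sigma> (deriv_x j \<tau>) k l x))"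
  proof (rule dominated_has_pd[OF rem_term_has_pd _ C summable_const_bracket_l1 _ summable_const_bracket_l1])
    show "continuous_on UNIV (\<lambda>x. ?c * (rem_term N (deriv_x j \<sigma>) \<tau> k l x + rem_term N \<sigma> (deriv_x j \<tau>) k l x))" for l
      by (intro continuous_intros ctorus_continuous_on rem_term_ctorus symbol_class_smooth_torus[OF \<tau>] symbol_class_smooth_torus[OF \<tau>'])
    show "norm (?c * (rem_term N (deriv_x j \<sigma>) \<tau> k l x + rem_term N \<sigma> (deriv_x j \<tau>) k l x)) \<le> (2 * pi * (C1 + C2)) * (1 / bracket_l1 l ^ (2 * CARD('a)))" for l x
    proof -
      have "norm (?c * (rem_term N (deriv_x j \<sigma>) \<tau> k l x + rem_term N \<sigma> (deriv_x j \<tau>) k l x))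
          = 2 * pi * norm (rem_term N (deriv_x j \<sigma>) \<tau> k l x + rem_term N \<sigma> (deriv_x j \<tau>) k l x)"
        by (simp add: norm_mult)
      also have "\<dots> \<le> 2 * pi * (C1 * (1 / bracket_l1 l ^ (2 * CARD('a))) + C2 * (1 / bracket_l1 l ^ (2 * CARD('a))))"
        by (intro mult_left_mono order_trans[OF norm_triangle_ineq] add_mono C1 C2) simp
      finally show ?thesis by (simp only: distrib_right distrib_left mult.assoc)
    qed
  qed (use s t in auto)
  then show ?thesis
    unfolding comp_rem_def[abs_def] infsum_cmult_right'
    by (simp only: infsum_add[OF rem_term_summable[OF \<sigma>' \<tau>] rem_term_summable[OF \<sigma> \<tau>']])
qed

lemma deriv_x_comp_rem:
  assumes \<sigma>: "\<sigma> \<in> symbol_class \<mu>1 \<rho> \<delta>" and \<tau>: "\<tau> \<in> symbol_class \<mu>2 \<rho> \<delta>"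
  shows "deriv_x j (comp_rem N \<sigma> \<tau>) = (\<lambda>k x. comp_rem N (deriv_x j \<sigma>) \<tau> k x + comp_rem N \<sigma> (deriv_x j \<tau>) k x)"
  by (rule ext) (simp add: deriv_x_def[of j "comp_rem N \<sigma> \<tau>"] scaled_pd_has_pd[OF comp_rem_has_pd[OF \<sigma> \<tau>]])

text \<open>For each l, the rule \<Delta>(ab)(k) = \<Delta>a(k) b(k + e_j) + a(k) \<Delta>b(k) is
  applied to the coefficient a and the Taylor remainder b. The shift falls on \<tau>, which stays in
  its class by \<open>shift_symbol_class\<close>.\<close>

lemma diff_k_comp_rem:
  assumes \<sigma>: "\<sigma> \<in> symbol_class \<mu>1 \<rho> \<delta>" and \<tau>: "\<tau> \<in> symbol_class \<mu>2 \<rho> \<delta>"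
  shows "diff_k j (comp_rem N \<sigma> \<tau>) =
    (\<lambda>k x. comp_rem N (diff_k j \<sigma>) (\<lambda>k. \<tau> (k + axis j 1)) k x + comp_rem N \<sigma> (diff_k j \<tau>) k x)"
proof (intro ext)
  fix k x
  note diff_k = diff_k_symbol_class[OF \<sigma>, of j] diff_k_symbol_class[OF \<tau>, of j] and sh = shift_symbol_class[OF \<tau>, of "axis j 1"]
  have c: "coef (diff_k j \<sigma> k) l = coef (\<sigma> (k + axis j 1)) l - coef (\<sigma> k) l" for l
    unfolding diff_k_def[abs_def] by (intro coef_diff smooth_torus_ctorus symbol_class_smooth_torus[OF \<sigma>])
  have "rem_term N (diff_k j \<sigma>) (\<lambda>k. \<tau> (k + axis j 1)) k l x + rem_term N \<sigma> (diff_k j \<tau>) k l x =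
      rem_term N \<sigma> \<tau> (k + axis j 1) l x - rem_term N \<sigma> \<tau> k l x" for l
    unfolding rem_term_def c diff1_symbol[symmetric] taylor_rem_diff1 taylor_rem_shift[of N "\<lambda>k. \<tau> k x"]
    by (simp add: algebra_simps)
  then have "(\<Sum>\<^sub>\<infinity>l. rem_term N (diff_k j \<sigma>) (\<lambda>k. \<tau> (k + axis j 1)) k l x + rem_term N \<sigma> (diff_k j \<tau>) k l x)
     = (\<Sum>\<^sub>\<infinity>l. rem_term N \<sigma> \<tau> (k + axis j 1) l x + - rem_term N \<sigma> \<tau> k l x)"
    by simp
  then show "diff_k j (comp_rem N \<sigma> \<tau>) k x = comp_rem N (diff_k j \<sigma>) (\<lambda>k. \<tau> (k + axis j 1)) k x + comp_rem N \<sigma> (diff_k j \<tau>) k x"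
    using infsum_add[OF rem_term_summable[OF diff_k(1) sh] rem_term_summable[OF \<sigma> diff_k(2)], of N k x N]
      infsum_add[OF rem_term_summable[OF \<sigma> \<tau>] summable_on_uminus[THEN iffD2, OF rem_term_summable[OF \<sigma> \<tau>]], of N "k + axis j 1" x N k x]
    unfolding diff_k_def[of j "comp_rem N \<sigma> \<tau>"] comp_rem_def infsum_uminus diff_conv_add_uminus by simp
qed

end

subsection \<open>A criterion for membership in symbol classes\<close>

text \<open>\<open>F \<mu>\<close> stands for a graded family stable under one derivative and one
  difference, with the expected change of order. Iterated derivatives and differences of a member
  are again members, so the sup bound for members yields all symbol estimates. Linear combinations
  are needed because \<open>D1\<close> subtracts multiples of lower-order terms.\<close>

lemma symbol_classI:
  fixes F :: "real \<Rightarrow> (int ^ 'n::{finite,linorder} \<Rightarrow> real ^ 'n::{finite,linorder} \<Rightarrow> complex) \<Rightarrow> bool"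
  assumes "0 \<le> \<delta>" and F: "F \<mu> \<sigma>"
    and ctorus: "\<And>\<mu> \<sigma> k. F \<mu> \<sigma> \<Longrightarrow> \<sigma> k \<in> ctorus"
    and pd: "\<And>\<mu> \<sigma> k j. F \<mu> \<sigma> \<Longrightarrow> has_pd j (\<sigma> k) (\<lambda>x. 2 * of_real pi * \<i> * deriv_x j \<sigma> k x)"
    and bound: "\<And>\<mu> \<sigma>. F \<mu> \<sigma> \<Longrightarrow> \<exists>C\<ge>0. \<forall>k x. norm (\<sigma> k x) \<le> C * bracket k powr \<mu>"
    and deriv_x: "\<And>\<mu> \<sigma> j. F \<mu> \<sigma> \<Longrightarrow> F (\<mu> + \<delta>) (deriv_x j \<sigma>)"
    and diff_k: "\<And>\<mu> \<sigma> j. F \<mu> \<sigma> \<Longrightarrow> F (\<mu> - \<rho>) (diff_k j \<sigma>)"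
    and lin: "\<And>\<mu> \<sigma> \<tau> a b. F \<mu> \<sigma> \<Longrightarrow> F \<mu> \<tau> \<Longrightarrow> F \<mu> (\<lambda>k x. a * \<sigma> k x + b * \<tau> k x)"
    and mono: "\<And>\<mu> \<mu>' \<sigma>. F \<mu> \<sigma> \<Longrightarrow> \<mu> \<le> \<mu>' \<Longrightarrow> F \<mu>' \<sigma>"
  shows "\<sigma> \<in> symbol_class \<mu> \<rho> \<delta>"
  unfolding symbol_class_def mem_Collect_eq
proof (intro conjI allI)
  fix k
  show "\<sigma> k \<in> smooth_torus"
  proof (rule smooth_torus_coinduct[of "\<lambda>g. \<exists>\<mu> \<sigma>. F \<mu> \<sigma> \<and> g = \<sigma> k"])
    fix g j assume "\<exists>\<mu> \<sigma>. F \<mu> \<sigma> \<and> g = \<sigma> k"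
    then obtain \<mu> \<sigma> where F: "F \<mu> \<sigma>" and g: "g = \<sigma> k" by blast
    let ?\<sigma> = "\<lambda>k x. 2 * of_real pi * \<i> * deriv_x j \<sigma> k x"
    have "F (\<mu> + \<delta>) ?\<sigma>"
      using lin[OF deriv_x[OF F] deriv_x[OF F], of "2 * of_real pi * \<i>" j 0 j] by simp
    then show "\<exists>g'. has_pd j g g' \<and> (\<exists>\<mu> \<sigma>. F \<mu> \<sigma> \<and> g' = \<sigma> k)"
      using pd[OF F, of j k] unfolding g by blast
  qed (use F ctorus in auto)
next
  fix \<alpha> \<beta> :: "nat ^ 'n::{finite,linorder}"
  have pow: "F (\<mu> - \<rho> * real l) ((diff_k j ^^ l) \<sigma>)" if "F \<mu> \<sigma>" for \<mu> \<sigma> j l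
  proof (induction l)
    case (Suc l)
    then show ?case using diff_k[OF Suc, of j] by (simp add: algebra_simps)
  qed (use that in simp)
  have "\<forall>\<mu> \<sigma>. F \<mu> \<sigma> \<longrightarrow> F (\<mu> - \<rho> * real (mi_size \<alpha>)) (Delta_k \<alpha> \<sigma>)"
    unfolding Delta_k_eq_mi_compose
  proof (rule mi_compose_rule[of "\<lambda>m T. \<forall>\<mu> \<sigma>. F \<mu> \<sigma> \<longrightarrow> F (\<mu> - \<rho> * real m) (T \<sigma>)"])
    fix j m T
    assume T: "\<forall>\<mu> \<sigma>. F \<mu> \<sigma> \<longrightarrow> F (\<mu> - \<rho> * real m) (T \<sigma>)"
    show "\<forall>\<mu> \<sigma>. F \<mu> \<sigma> \<longrightarrow> F (\<mu> - \<rho> * real (m + \<alpha> $ j)) (((diff_k j ^^ (\<alpha> $ j)) \<circ> T) \<sigma>)"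
    proof (intro allI impI)
      fix \<mu> \<sigma> assume "F \<mu> \<sigma>"
      then have "F (\<mu> - \<rho> * real m - \<rho> * real (\<alpha> $ j)) ((diff_k j ^^ (\<alpha> $ j)) (T \<sigma>))" using T pow by blast
      then show "F (\<mu> - \<rho> * real (m + \<alpha> $ j)) (((diff_k j ^^ (\<alpha> $ j)) \<circ> T) \<sigma>)" by (simp add: algebra_simps)
    qed
  qed simp
  then have 1: "F (\<mu> - \<rho> * real (mi_size \<alpha>)) (Delta_k \<alpha> \<sigma>)" using F by blast
  have D1: "F (\<mu> + \<delta> * real l) (\<lambda>k. D1 j l (\<sigma> k))" if "F \<mu> \<sigma>" for \<mu> \<sigma> j l
  proof (induction l)
    case (Suc l)
    \<comment> \<open>The term subtracted in \<open>D1\<close> has order lower by \<delta>, so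
      \<open>mono\<close> lifts it to the common order before \<open>lin\<close> applies.\<close>
    have "F (\<mu> + \<delta> * real l + \<delta>) (\<lambda>k. D1 j l (\<sigma> k))"
      by (rule mono[OF Suc]) (use assms in simp)
    then have "F (\<mu> + \<delta> * real l + \<delta>) (\<lambda>k x. 1 * deriv_x j (\<lambda>k. D1 j l (\<sigma> k)) k x + - of_nat l * D1 j l (\<sigma> k) x)"
      by (intro lin deriv_x Suc)
    then show ?case unfolding D1_Suc by (simp add: deriv_x_def algebra_simps)
  qed (use that in \<open>simp add: mono\<close>)
  have "\<forall>\<mu> \<sigma>. F \<mu> \<sigma> \<longrightarrow> F (\<mu> + \<delta> * real (mi_size \<beta>)) (mi_compose (\<lambda>j l \<sigma> k. D1 j l (\<sigma> k)) \<beta> \<sigma>)"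
  proof (rule mi_compose_rule[of "\<lambda>m T. \<forall>\<mu> \<sigma>. F \<mu> \<sigma> \<longrightarrow> F (\<mu> + \<delta> * real m) (T \<sigma>)"])
    fix j m T
    assume T: "\<forall>\<mu> \<sigma>. F \<mu> \<sigma> \<longrightarrow> F (\<mu> + \<delta> * real m) (T \<sigma>)"
    show "\<forall>\<mu> \<sigma>. F \<mu> \<sigma> \<longrightarrow> F (\<mu> + \<delta> * real (m + \<beta> $ j)) (((\<lambda>\<sigma> k. D1 j (\<beta> $ j) (\<sigma> k)) \<circ> T) \<sigma>)"
    proof (intro allI impI)
      fix \<mu> \<sigma> assume "F \<mu> \<sigma>"
      then have "F (\<mu> + \<delta> * real m + \<delta> * real (\<beta> $ j)) (\<lambda>k. D1 j (\<beta> $ j) (T \<sigma> k))" using T D1 by blast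
      then show "F (\<mu> + \<delta> * real (m + \<beta> $ j)) (((\<lambda>\<sigma> k. D1 j (\<beta> $ j) (\<sigma> k)) \<circ> T) \<sigma>)" by (simp add: algebra_simps)
    qed
  qed simp
  then have "F (\<mu> - \<rho> * real (mi_size \<alpha>) + \<delta> * real (mi_size \<beta>)) (mi_compose (\<lambda>j l \<sigma> k. D1 j l (\<sigma> k)) \<beta> (Delta_k \<alpha> \<sigma>))"
    using 1 by blast
  moreover have "mi_compose (\<lambda>j l \<sigma> k. D1 j l (\<sigma> k)) \<beta> (Delta_k \<alpha> \<sigma>) = D_x \<beta> (Delta_k \<alpha> \<sigma>)"
    by (simp add: fun_eq_iff D_x_def D_def mi_compose_pointwise)
  ultimately obtain C where "C \<ge> 0" "\<forall>k x. norm (D_x \<beta> (Delta_k \<alpha> \<sigma>) k x) \<le> C * bracket k powr (\<mu> - \<rho> * real (mi_size \<alpha>) + \<delta> * real (mi_size \<beta>))"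
    using bound by metis
  moreover from this have "C * bracket k powr (\<mu> - \<rho> * real (mi_size \<alpha>) + \<delta> * real (mi_size \<beta>))
      \<le> (C + 1) * bracket k powr (\<mu> - \<rho> * real (mi_size \<alpha>) + \<delta> * real (mi_size \<beta>))" for k
    by (intro mult_right_mono) auto
  ultimately show "\<exists>C>0. \<forall>k x. norm (D_x \<beta> (Delta_k \<alpha> \<sigma>) k x) \<le> C * bracket k powr (\<mu> - \<rho> * real (mi_size \<alpha>) + \<delta> * real (mi_size \<beta>))"
    by (intro exI[of _ "C + 1"]) (auto intro: order_trans)
qed

lemma sum_bound:
  fixes f :: "'i \<Rightarrow> 'a \<Rightarrow> 'b \<Rightarrow> complex"
  assumes "\<And>i. i \<in> I \<Longrightarrow> \<exists>C\<ge>0. \<forall>k x. norm (f i k x) \<le> C * w k"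
  shows "\<exists>C\<ge>0. \<forall>k x. norm (\<Sum>i\<in>I. f i k x) \<le> C * w k"
proof -
  obtain C where C: "\<And>i. i \<in> I \<Longrightarrow> C i \<ge> 0" "\<And>i k x. i \<in> I \<Longrightarrow> norm (f i k x) \<le> C i * w k"
    using assms by metis
  have "norm (\<Sum>i\<in>I. f i k x) \<le> (\<Sum>i\<in>I. C i) * w k" for k x
    unfolding sum_distrib_right by (intro order_trans[OF norm_sum] sum_mono C(2))
  then show ?thesis using C(1) by (intro exI[of _ "\<Sum>i\<in>I. C i"]) (auto intro: sum_nonneg)
qed

lemma Fourier_has_sum:
  assumes "g \<in> smooth_torus"
  shows "((\<lambda>l. coef g l * character l x) has_sum g x) UNIV"
proof -
  obtain C where C: "\<And>l. norm (coef g l) * bracket_l1 l ^ (2 * CARD('a)) \<le> C" using coef_decay[OF assms] by blast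
  have "(\<lambda>l. coef g l * character l x) summable_on UNIV"
    by (rule dominated_summable[where u = "\<lambda>l x. coef g l * character l x", OF _ summable_const_bracket_l1[of C]])
       (use weight_sum[of "coef g", OF C] in \<open>simp add: norm_mult\<close>)
  then show ?thesis using Fourier_inversion[OF assms, of x] by simp
qed

lemma has_sum_sum:
  fixes f :: "'i \<Rightarrow> 'a \<Rightarrow> complex"
  shows "(\<And>i. i \<in> I \<Longrightarrow> (f i has_sum s i) A) \<Longrightarrow> ((\<lambda>l. \<Sum>i\<in>I. f i l) has_sum (\<Sum>i\<in>I. s i)) A"
  by (induction I rule: infinite_finite_induct) (auto intro: has_sum_add)

text \<open>
  The Leibniz rules for \<open>comp_rem\<close> map the span of all remainders to itself, with the orders
  shifted as in the definition of the symbol classes.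
\<close>

inductive rem_span :: "real \<Rightarrow> real \<Rightarrow> nat \<Rightarrow> real \<Rightarrow> (int ^ 'n::{finite,linorder} \<Rightarrow> real ^ 'n::{finite,linorder} \<Rightarrow> complex) \<Rightarrow> bool"
  for \<rho> \<delta> N where
  rem: "\<sigma> \<in> symbol_class \<mu>1 \<rho> \<delta> \<Longrightarrow> \<tau> \<in> symbol_class \<mu>2 \<rho> \<delta> \<Longrightarrow> \<mu> = \<mu>1 + \<mu>2 - real N * (\<rho> - \<delta>) \<Longrightarrow>
    rem_span \<rho> \<delta> N \<mu> (comp_rem N \<sigma> \<tau>)"
| lin: "rem_span \<rho> \<delta> N \<mu> \<sigma> \<Longrightarrow> rem_span \<rho> \<delta> N \<mu> \<tau> \<Longrightarrow> rem_span \<rho> \<delta> N \<mu> (\<lambda>k x. a * \<sigma> k x + b * \<tau> k x)"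
| mono: "rem_span \<rho> \<delta> N \<mu> \<sigma> \<Longrightarrow> \<mu> \<le> \<mu>' \<Longrightarrow> rem_span \<rho> \<delta> N \<mu>' \<sigma>"

section \<open>Sup bound for the remainder and stability of the span of remainders\<close>

context
  fixes \<rho> \<delta> :: real
  assumes \<delta>: "0 \<le> \<delta>" "\<delta> < \<rho>" "\<rho> \<le> 1"
begin

text \<open>Since \<open>falling l \<alpha>\<close> divided by \<alpha>! is
  \<open>mbinom l \<alpha>\<close>, summing the \<alpha>-th Newton term over l yields the Fourier
  series of \<open>D \<alpha> (\<sigma> k)\<close>, up to a factor independent of l. The order N can
  thus be changed at the cost of explicit terms.\<close>

lemma comp_rem_eq:
  assumes \<sigma>: "\<sigma> \<in> symbol_class \<mu>1 \<rho> \<delta>" and \<tau>: "\<tau> \<in> symbol_class \<mu>2 \<rho> \<delta>"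
  shows "comp_rem N \<sigma> \<tau> k x = comp_rem 0 \<sigma> \<tau> k x -
    (\<Sum>\<alpha> | mi_size \<alpha> < N. 1 / of_nat (mi_fact \<alpha>) * D_x \<alpha> \<sigma> k x * Delta_k \<alpha> \<tau> k x)"
proof -
  note s = symbol_class_smooth_torus[OF \<sigma>, of k]
  have fact: "of_nat (mi_fact \<alpha>) \<noteq> (0::complex)" for \<alpha> :: "nat ^ 'a::{finite,linorder}"
    by (simp add: mi_fact_def)
  have "((\<lambda>l. coef (\<sigma> k) l * character l x * (mbinom l \<alpha> * Delta_k \<alpha> \<tau> k x)) has_sum
      1 / of_nat (mi_fact \<alpha>) * D_x \<alpha> \<sigma> k x * Delta_k \<alpha> \<tau> k x) UNIV" for \<alpha>
  proof -
    have "((\<lambda>l. coef (D \<alpha> (\<sigma> k)) l * character l x) has_sum D_x \<alpha> \<sigma> k x) UNIV"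
      unfolding D_x_def by (intro Fourier_has_sum D_multiplier s)
    from has_sum_cmult_right[OF this, of "1 / of_nat (mi_fact \<alpha>) * Delta_k \<alpha> \<tau> k x"]
    show ?thesis
      unfolding D_multiplier(2)[OF s] falling_eq_mbinom using fact[of \<alpha>] by (simp add: field_simps)
  qed
  then have 1: "((\<lambda>l. \<Sum>\<alpha> | mi_size \<alpha> < N. coef (\<sigma> k) l * character l x * (mbinom l \<alpha> * Delta_k \<alpha> \<tau> k x)) has_sum
      (\<Sum>\<alpha> | mi_size \<alpha> < N. 1 / of_nat (mi_fact \<alpha>) * D_x \<alpha> \<sigma> k x * Delta_k \<alpha> \<tau> k x)) UNIV"
    by (intro has_sum_sum)
  have "((\<lambda>l. rem_term 0 \<sigma> \<tau> k l x) has_sum comp_rem 0 \<sigma> \<tau> k x) UNIV"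
    unfolding comp_rem_def by (intro has_sum_infsum rem_term_summable[OF \<delta> \<sigma> \<tau>])
  from has_sum_add[OF this has_sum_uminusI[OF 1]]
  have "((\<lambda>l. rem_term N \<sigma> \<tau> k l x) has_sum comp_rem 0 \<sigma> \<tau> k x -
      (\<Sum>\<alpha> | mi_size \<alpha> < N. 1 / of_nat (mi_fact \<alpha>) * D_x \<alpha> \<sigma> k x * Delta_k \<alpha> \<tau> k x)) UNIV"
    by (simp add: rem_term_def taylor_rem_symbol[of N] right_diff_distrib sum_distrib_left)
  then show ?thesis unfolding comp_rem_def by (simp add: infsumI)
qed

text \<open>The termwise bound is summed over l; the excess
  \<open>\<delta> * real (2 * CARD('n))\<close> is the price of the weight that makes this sum
  converge.\<close>

lemma comp_rem_bound_with_loss: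
  fixes \<sigma> \<tau> :: "int ^ 'n::{finite,linorder} \<Rightarrow> real ^ 'n::{finite,linorder} \<Rightarrow> complex"
  assumes \<sigma>: "\<sigma> \<in> symbol_class \<mu>1 \<rho> \<delta>" and \<tau>: "\<tau> \<in> symbol_class \<mu>2 \<rho> \<delta>"
  shows "\<exists>C\<ge>0. \<forall>k x. norm (comp_rem N \<sigma> \<tau> k x) \<le>
    C * bracket k powr (\<mu>1 + \<mu>2 - real N * (\<rho> - \<delta>) + \<delta> * real (2 * CARD('n)))"
proof -
  have "\<delta> < 1" using \<delta> by simp
  let ?w = "\<lambda>k. bracket k powr (\<mu>1 + \<mu>2 - real N * (\<rho> - \<delta>) + \<delta> * real (2 * CARD('n)))"
  let ?S = "\<Sum>\<^sub>\<infinity>l :: int ^ 'n::{finite,linorder}. 1 / bracket_l1 l ^ (2 * CARD('n))"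
  obtain C where C: "C \<ge> 0" "\<And>k l x. norm (rem_term N \<sigma> \<tau> k l x) \<le> C * ?w k * (1 / bracket_l1 l ^ (2 * CARD('n)))"
    using rem_term_bound[OF \<delta>(1) \<open>\<delta> < 1\<close> \<sigma> \<tau>, of N] by blast
  have "norm (comp_rem N \<sigma> \<tau> k x) \<le> C * ?w k * ?S" for k x
    by (rule norm_infsum_le[where f = "\<lambda>l. rem_term N \<sigma> \<tau> k l x" and X = UNIV
          and g = "\<lambda>l. C * ?w k * (1 / bracket_l1 l ^ (2 * CARD('n)))"])
       (use C(2) in \<open>auto simp: comp_rem_def intro!: has_sum_infsum rem_term_summable[OF \<delta> \<sigma> \<tau>] has_sum_cmult_right summable_bracket_l1 simp del: times_divide_eq_right mult_1_right\<close>)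
  moreover have "?S \<ge> 0" by (intro infsum_nonneg) simp
  ultimately show ?thesis using C(1) by (intro exI[of _ "C * ?S"]) (auto simp: mult_ac)
qed

text \<open>The loss \<open>2 n \<delta>\<close> is absorbed by expanding to a higher order and estimating the extra terms directly.\<close>

lemma comp_rem_bound:
  fixes \<sigma> \<tau> :: "int ^ 'n::{finite,linorder} \<Rightarrow> real ^ 'n::{finite,linorder} \<Rightarrow> complex"
  assumes \<sigma>: "\<sigma> \<in> symbol_class \<mu>1 \<rho> \<delta>" and \<tau>: "\<tau> \<in> symbol_class \<mu>2 \<rho> \<delta>"
  shows "\<exists>C\<ge>0. \<forall>k x. norm (comp_rem N \<sigma> \<tau> k x) \<le> C * bracket k powr (\<mu>1 + \<mu>2 - real N * (\<rho> - \<delta>))"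
proof -
  let ?e = "\<mu>1 + \<mu>2 - real N * (\<rho> - \<delta>)"
  let ?t = "\<lambda>\<alpha> k x. 1 / of_nat (mi_fact \<alpha>) * D_x \<alpha> \<sigma> k x * Delta_k \<alpha> \<tau> k x"
  \<comment> \<open>Each further order gains \<rho> - \<delta> > 0, so m more orders outweigh the
    loss 2n\<delta>.\<close>
  obtain m :: nat where "\<delta> * real (2 * CARD('n)) / (\<rho> - \<delta>) \<le> real m" using real_arch_simple by blast
  then have m: "\<delta> * real (2 * CARD('n)) \<le> real m * (\<rho> - \<delta>)" using \<delta> by (simp add: pos_divide_le_eq)
  define N' where "N' = N + m"
  have sub: "{\<alpha> :: nat ^ 'n::{finite,linorder}. mi_size \<alpha> < N} \<subseteq> {\<alpha>. mi_size \<alpha> < N'}" by (auto simp: N'_def)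
  have split: "comp_rem N \<sigma> \<tau> k x = comp_rem N' \<sigma> \<tau> k x + (\<Sum>\<alpha> \<in> {\<alpha>. mi_size \<alpha> < N'} - {\<alpha>. mi_size \<alpha> < N}. ?t \<alpha> k x)" for k x
    unfolding comp_rem_eq[OF \<sigma> \<tau>, of N] comp_rem_eq[OF \<sigma> \<tau>, of N'] sum_diff[OF finite_mi_size sub] by simp
  have "\<exists>C\<ge>0. \<forall>k x. norm (?t \<alpha> k x) \<le> C * bracket k powr ?e" if "\<alpha> \<in> {\<alpha>. mi_size \<alpha> < N'} - {\<alpha>. mi_size \<alpha> < N}" for \<alpha>
  proof -
    let ?a = "real (mi_size \<alpha>)"
    have a: "real N \<le> ?a" using that by auto
    obtain C1 where C1: "C1 > 0" "\<And>k x. norm (D_x \<alpha> \<sigma> k x) \<le> C1 * bracket k powr (\<mu>1 + \<delta> * ?a)"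
      using symbol_class_bound[OF \<sigma>, where \<alpha> = 0 and \<beta> = \<alpha>] by auto
    obtain C2 where C2: "C2 > 0" "\<And>k x. norm (Delta_k \<alpha> \<tau> k x) \<le> C2 * bracket k powr (\<mu>2 - \<rho> * ?a)"
      using symbol_class_bound[OF \<tau>, where \<alpha> = \<alpha> and \<beta> = 0] by (auto simp: D_x_def)
    have "norm (?t \<alpha> k x) \<le> (1 / real (mi_fact \<alpha>) * C1 * C2) * bracket k powr ?e" for k x
    proof -
      have "norm (?t \<alpha> k x) = 1 / real (mi_fact \<alpha>) * norm (D_x \<alpha> \<sigma> k x) * norm (Delta_k \<alpha> \<tau> k x)"
        by (simp add: norm_mult norm_divide)
      also have "\<dots> \<le> 1 / real (mi_fact \<alpha>) * (C1 * bracket k powr (\<mu>1 + \<delta> * ?a)) * (C2 * bracket k powr (\<mu>2 - \<rho> * ?a))"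
        using C1(1) C2(1) by (intro mult_mono C1(2) C2(2)) auto
      also have "\<dots> = (1 / real (mi_fact \<alpha>) * C1 * C2) * bracket k powr ((\<mu>1 + \<delta> * ?a) + (\<mu>2 - \<rho> * ?a))"
        by (simp only: powr_add mult_ac)
      also have "\<dots> \<le> (1 / real (mi_fact \<alpha>) * C1 * C2) * bracket k powr ?e"
      proof (intro mult_left_mono bracket_powr_mono)
        \<comment> \<open>The \<alpha>-th term has order \<mu>1 + \<mu>2 - |\<alpha>|(\<rho> -
          \<delta>), and |\<alpha>| is at least N for every term between the two expansions.\<close>
        have "real N * (\<rho> - \<delta>) \<le> ?a * (\<rho> - \<delta>)" using a \<delta> by (intro mult_right_mono) auto
        then show "(\<mu>1 + \<delta> * ?a) + (\<mu>2 - \<rho> * ?a) \<le> ?e" by (simp add: algebra_simps)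
      qed (use C1(1) C2(1) in auto)
      finally show ?thesis .
    qed
    then show ?thesis using C1(1) C2(1) by (intro exI[of _ "1 / real (mi_fact \<alpha>) * C1 * C2"]) auto
  qed
  then obtain C2 where C2: "C2 \<ge> 0"
    "\<And>k x. norm (\<Sum>\<alpha> \<in> {\<alpha>. mi_size \<alpha> < N'} - {\<alpha>. mi_size \<alpha> < N}. ?t \<alpha> k x) \<le> C2 * bracket k powr ?e"
    using sum_bound[of "{\<alpha>. mi_size \<alpha> < N'} - {\<alpha>. mi_size \<alpha> < N}" ?t "\<lambda>k. bracket k powr ?e"] by blast
  obtain C1 where C1: "C1 \<ge> 0" "\<And>k x. norm (comp_rem N' \<sigma> \<tau> k x) \<le>
      C1 * bracket k powr (\<mu>1 + \<mu>2 - real N' * (\<rho> - \<delta>) + \<delta> * real (2 * CARD('n)))"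
    using comp_rem_bound_with_loss[OF \<sigma> \<tau>, of N'] by blast
  have "norm (comp_rem N \<sigma> \<tau> k x) \<le> (C1 + C2) * bracket k powr ?e" for k x
  proof -
    have "norm (comp_rem N' \<sigma> \<tau> k x) \<le> C1 * bracket k powr ?e"
      by (rule order_trans[OF C1(2)]) (use C1(1) m in \<open>auto simp: N'_def algebra_simps intro!: mult_left_mono bracket_powr_mono\<close>)
    then show ?thesis
      unfolding split distrib_right by (intro order_trans[OF norm_triangle_ineq] add_mono C2(2))
  qed
  then show ?thesis using C1(1) C2(1) by (intro exI[of _ "C1 + C2"]) auto
qed

lemma rem_span_ctorus: "rem_span \<rho> \<delta> N \<mu> \<sigma> \<Longrightarrow> \<sigma> k \<in> ctorus"
  by (induction rule: rem_span.induct) (auto intro: comp_rem_ctorus[OF \<delta>] ctorus_add ctorus_mult[OF ctorus_const])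

text \<open>Existence of the derivative is recorded separately, because additivity of
  \<open>deriv_x\<close> on the span depends on it.\<close>

lemma rem_span_has_pd: "rem_span \<rho> \<delta> N \<mu> \<sigma> \<Longrightarrow> has_pd j (\<sigma> k) (\<lambda>x. 2 * of_real pi * \<i> * deriv_x j \<sigma> k x)"
proof (induction rule: rem_span.induct)
  case (rem \<sigma> \<mu>1 \<tau> \<mu>2 \<mu>)
  then show ?case using comp_rem_has_pd[OF \<delta> rem(1,2)] by (simp add: deriv_x_comp_rem[OF \<delta> rem(1,2)])
next
  case (lin \<mu> \<sigma> \<tau> a b)
  have "has_pd j (\<lambda>x. a * \<sigma> k x + b * \<tau> k x)
      (\<lambda>x. a * (2 * of_real pi * \<i> * deriv_x j \<sigma> k x) + b * (2 * of_real pi * \<i> * deriv_x j \<tau> k x))"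
    by (intro has_pd_add has_pd_cmult lin.IH)
  then show ?case using scaled_pd_has_pd by (fastforce simp: deriv_x_def)
qed

lemma rem_span_bound: "rem_span \<rho> \<delta> N \<mu> \<sigma> \<Longrightarrow> \<exists>C\<ge>0. \<forall>k x. norm (\<sigma> k x) \<le> C * bracket k powr \<mu>"
proof (induction rule: rem_span.induct)
  case (rem \<sigma> \<mu>1 \<tau> \<mu>2 \<mu>)
  then show ?case using comp_rem_bound by blast
next
  case (lin \<mu> \<sigma> \<tau> a b)
  then obtain C1 C2 where C: "C1 \<ge> 0" "C2 \<ge> 0" "\<And>k x. norm (\<sigma> k x) \<le> C1 * bracket k powr \<mu>"
    "\<And>k x. norm (\<tau> k x) \<le> C2 * bracket k powr \<mu>" by blast
  have "norm (a * \<sigma> k x + b * \<tau> k x) \<le> (norm a * C1 + norm b * C2) * bracket k powr \<mu>" for k x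
    unfolding distrib_right mult.assoc
    by (rule order_trans[OF norm_triangle_ineq]) (auto simp: norm_mult intro!: add_mono mult_left_mono C)
  then show ?case using C(1,2) by (intro exI[of _ "norm a * C1 + norm b * C2"]) auto
next
  case (mono \<mu> \<sigma> \<mu>')
  then show ?case by (meson bracket_powr_mono mult_left_mono order_trans)
qed

text \<open>The derivative falls on \<sigma> or on \<tau>, and either way raises the sum of the two
  orders by \<delta>.\<close>

lemma rem_span_deriv_x: "rem_span \<rho> \<delta> N \<mu> \<sigma> \<Longrightarrow> rem_span \<rho> \<delta> N (\<mu> + \<delta>) (deriv_x j \<sigma>)"
proof (induction rule: rem_span.induct)
  case (rem \<sigma> \<mu>1 \<tau> \<mu>2 \<mu>)
  have "rem_span \<rho> \<delta> N (\<mu> + \<delta>) (comp_rem N (deriv_x j \<sigma>) \<tau>)" "rem_span \<rho> \<delta> N (\<mu> + \<delta>) (comp_rem N \<sigma> (deriv_x j \<tau>))"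
    by (rule rem_span.rem[OF deriv_x_symbol_class[OF rem(1) \<delta>(1)] rem(2)], simp add: rem(3))
       (rule rem_span.rem[OF rem(1) deriv_x_symbol_class[OF rem(2) \<delta>(1)]], simp add: rem(3))
  then show ?case
    using rem_span.lin[of \<rho> \<delta> N "\<mu> + \<delta>" _ _ 1 1] by (auto simp: deriv_x_comp_rem[OF \<delta> rem(1,2)])
next
  case (lin \<mu> \<sigma> \<tau> a b)
  have "deriv_x j (\<lambda>k x. a * \<sigma> k x + b * \<tau> k x) = (\<lambda>k x. a * deriv_x j \<sigma> k x + b * deriv_x j \<tau> k x)"
  proof
    fix k
    have "has_pd j (\<lambda>x. a * \<sigma> k x + b * \<tau> k x)
        (\<lambda>x. a * (2 * of_real pi * \<i> * deriv_x j \<sigma> k x) + b * (2 * of_real pi * \<i> * deriv_x j \<tau> k x))"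
      by (intro has_pd_add has_pd_cmult rem_span_has_pd[OF lin.hyps(1)] rem_span_has_pd[OF lin.hyps(2)])
    then show "deriv_x j (\<lambda>k x. a * \<sigma> k x + b * \<tau> k x) k = (\<lambda>x. a * deriv_x j \<sigma> k x + b * deriv_x j \<tau> k x)"
      unfolding deriv_x_def[of j "\<lambda>k x. a * \<sigma> k x + b * \<tau> k x"] by (simp add: scaled_pd_has_pd add_divide_distrib fun_eq_iff)
         (simp add: complex_eq_iff)
  qed
  then show ?case using lin by (simp add: rem_span.lin)
next
  case (mono \<mu> \<sigma> \<mu>')
  then show ?case by (auto intro: rem_span.mono)
qed

lemma rem_span_diff_k: "rem_span \<rho> \<delta> N \<mu> \<sigma> \<Longrightarrow> rem_span \<rho> \<delta> N (\<mu> - \<rho>) (diff_k j \<sigma>)"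
proof (induction rule: rem_span.induct)
  case (rem \<sigma> \<mu>1 \<tau> \<mu>2 \<mu>)
  have "rem_span \<rho> \<delta> N (\<mu> - \<rho>) (comp_rem N (diff_k j \<sigma>) (\<lambda>k. \<tau> (k + axis j 1)))" "rem_span \<rho> \<delta> N (\<mu> - \<rho>) (comp_rem N \<sigma> (diff_k j \<tau>))"
    by (rule rem_span.rem[OF diff_k_symbol_class[OF rem(1)] shift_symbol_class[OF rem(2)]], simp add: rem(3))
       (rule rem_span.rem[OF rem(1) diff_k_symbol_class[OF rem(2)]], simp add: rem(3))
  then show ?case
    using rem_span.lin[of \<rho> \<delta> N "\<mu> - \<rho>" _ _ 1 1] by (auto simp: diff_k_comp_rem[OF \<delta> rem(1,2)])
next
  case (lin \<mu> \<sigma> \<tau> a b)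
  have "diff_k j (\<lambda>k x. a * \<sigma> k x + b * \<tau> k x) = (\<lambda>k x. a * diff_k j \<sigma> k x + b * diff_k j \<tau> k x)"
    by (simp add: diff_k_def fun_eq_iff algebra_simps)
  then show ?case using lin by (simp add: rem_span.lin)
next
  case (mono \<mu> \<sigma> \<mu>')
  then show ?case by (auto intro: rem_span.mono)
qed

text \<open>A derivative or difference of a remainder is a sum of two remainders, so closure is
  available for their span; \<open>symbol_classI\<close> is therefore applied to
  \<open>rem_span\<close>.\<close>

lemma comp_rem_symbol_class:
  assumes "\<sigma> \<in> symbol_class \<mu>1 \<rho> \<delta>" "\<tau> \<in> symbol_class \<mu>2 \<rho> \<delta>"
  shows "comp_rem N \<sigma> \<tau> \<in> symbol_class (\<mu>1 + \<mu>2 - real N * (\<rho> - \<delta>)) \<rho> \<delta>"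
  by (rule symbol_classI[where F = "rem_span \<rho> \<delta> N"])
     (auto intro: \<delta> rem_span.rem[OF assms] rem_span.intros(2,3) rem_span_ctorus rem_span_has_pd rem_span_bound rem_span_deriv_x rem_span_diff_k)

end

subsection \<open>Pseudo-difference operators on rapidly decreasing functions\<close>

text \<open>Passes from \<open>bracket\<close>, in which \<open>schwartz\<close> is defined, to the
  weight \<open>bracket_l1\<close> used for summation; the latter is larger by a factor of at most
  n.\<close>

lemma schwartz_decay:
  fixes f :: "int ^ 'n::finite \<Rightarrow> complex"
  assumes "f \<in> schwartz"
  shows "\<exists>C\<ge>0. \<forall>l. norm (f l) * bracket_l1 l ^ M \<le> C"
proof -
  obtain C where C: "\<And>l. norm (f l) \<le> C * bracket l powr (- real M)"
    using assms unfolding schwartz_def by blast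
  have "norm (f l) * bracket_l1 l ^ M \<le> C * real CARD('n) ^ M" for l
  proof -
    have "norm (f l) * bracket_l1 l ^ M \<le> (C * bracket l powr (- real M)) * (real CARD('n) * bracket l) ^ M"
      by (intro mult_mono C power_mono bracket_l1_le_bracket) (auto intro: order_trans[OF norm_ge_zero C])
    also have "\<dots> = C * real CARD('n) ^ M"
      by (simp add: powr_minus powr_realpow power_mult_distrib field_simps)
    finally show ?thesis .
  qed
  moreover from this[of 0] have "0 \<le> C * real CARD('n) ^ M" by (rule order_trans[rotated]) simp
  ultimately show ?thesis by blast
qed

lemma schwartz_dominated:
  fixes f :: "int ^ 'n::finite \<Rightarrow> complex"
  assumes "f \<in> schwartz"
  obtains C where "C \<ge> 0" "\<And>l. norm (f l) \<le> C * (1 / bracket_l1 l ^ (2 * CARD('n)))"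
  using schwartz_decay[OF assms, of "2 * CARD('n)"] weight_sum by metis

lemma fourier_ctorus:
  assumes "f \<in> schwartz"
  shows "fourier f \<in> ctorus"
proof -
  obtain C where C: "\<And>l. norm (f l) \<le> C * (1 / bracket_l1 l ^ (2 * CARD('a)))"
    using schwartz_dominated[OF assms] by blast
  have "continuous_on UNIV (\<lambda>x. \<Sum>\<^sub>\<infinity>k. character (- k) x * f k)"
    by (rule dominated_continuous[OF _ summable_const_bracket_l1[of C]])
       (use C in \<open>auto simp: norm_mult intro!: continuous_intros\<close>)
  then show ?thesis by (simp add: ctorus_def fourier_def[abs_def] character_periodic)
qed

lemma Op_eq_integral:
  assumes "\<sigma> k \<in> ctorus" "f \<in> schwartz"
  shows "Op \<sigma> f k = integral (cbox 0 1) (\<lambda>x. character k x * \<sigma> k x * fourier f x)"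
proof -
  have "set_integrable lborel (cbox 0 1) (\<lambda>x. character k x * \<sigma> k x * fourier f x)"
    unfolding set_integrable_def
    by (intro borel_integrable_compact compact_cbox ctorus_continuous_on ctorus_mult character_ctorus fourier_ctorus assms)
  then show ?thesis unfolding Op_def by (rule set_borel_integral_eq_integral(2))
qed

text \<open>Inserting the series of \<open>fourier f\<close> and integrating term by term exhibits
  \<open>Op \<sigma>\<close> as an infinite matrix with entries
  \<open>coef (\<sigma> k) (m - k)\<close>.\<close>

lemma Op_has_sum:
  assumes \<sigma>: "\<sigma> k \<in> ctorus" and f: "f \<in> schwartz"
  shows "((\<lambda>m. f m * coef (\<sigma> k) (m - k)) has_sum Op \<sigma> f k) UNIV"
proof -
  obtain C where C: "\<And>l. norm (f l) \<le> C * (1 / bracket_l1 l ^ (2 * CARD('a)))"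
    using schwartz_dominated[OF f] by blast
  obtain K where K: "K > 0" "\<And>x. norm (\<sigma> k x) \<le> K" using ctorus_bounded[OF \<sigma>] by blast
  have "((\<lambda>m. integral (cbox 0 1) (\<lambda>x. character k x * \<sigma> k x * (character (- m) x * f m))) has_sum
      integral (cbox 0 1) (\<lambda>x. \<Sum>\<^sub>\<infinity>m. character k x * \<sigma> k x * (character (- m) x * f m))) UNIV"
  proof (rule dominated_has_sum_integral[OF _ summable_const_bracket_l1])
    show "norm (character k x * \<sigma> k x * (character (- m) x * f m)) \<le> (K * C) * (1 / bracket_l1 m ^ (2 * CARD('a)))" for m x
      using mult_mono[OF K(2)[of x] C[of m]] K(1) by (simp add: norm_mult)
    show "continuous_on (cbox 0 1) (\<lambda>x. character k x * \<sigma> k x * (character (- m) x * f m))" for m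
      by (intro continuous_intros ctorus_continuous_on[OF \<sigma>])
  qed
  moreover have "integral (cbox 0 1) (\<lambda>x. character k x * \<sigma> k x * (character (- m) x * f m)) = f m * coef (\<sigma> k) (m - k)" for m
  proof -
    have "(\<lambda>x. character k x * \<sigma> k x * (character (- m) x * f m)) = (\<lambda>x. f m * (character (- (m - k)) x * \<sigma> k x))"
      using character_add[of k "- m"] by (auto simp: fun_eq_iff)
    then show ?thesis by (simp only: coef_def integral_mult_right)
  qed
  ultimately show ?thesis
    unfolding Op_eq_integral[where \<sigma> = \<sigma>, OF assms] fourier_def by (simp add: infsum_cmult_right')
qed

lemma bracket_l1_uminus [simp]: "bracket_l1 (- l) = bracket_l1 l"
  by (simp add: bracket_l1_def)

text \<open>Powers of \<open>bracket_l1 k\<close> are distributed over m and m - k. Those of m are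
  absorbed by the decay of f, those of m - k by the decay of the symbol's coefficients at the price
  \<delta> each. The net gain 1 - \<delta> per power yields any decay in k.\<close>

lemma Op_schwartz:
  fixes \<tau> :: "int ^ 'n::{finite,linorder} \<Rightarrow> real ^ 'n::{finite,linorder} \<Rightarrow> complex"
  assumes \<delta>: "0 \<le> \<delta>" "\<delta> < 1" and \<tau>: "\<tau> \<in> symbol_class \<mu> \<rho> \<delta>" and f: "f \<in> schwartz"
  shows "Op \<tau> f \<in> schwartz"
  unfolding schwartz_def mem_Collect_eq
proof
  fix Q :: nat
  let ?d = "2 * CARD('n)"
  obtain M :: nat where "(\<bar>\<mu>\<bar> + real Q) / (1 - \<delta>) \<le> real M" using real_arch_simple by blast
  then have M: "\<mu> + \<delta> * real M - real M \<le> - real Q" using \<delta> by (simp add: field_simps)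
  obtain F where F: "F \<ge> 0" "\<And>l. norm (f l) * bracket_l1 l ^ (M + ?d) \<le> F"
    using schwartz_decay[OF f, of "M + ?d"] by blast
  obtain T where T: "T \<ge> 0" "\<And>k l. norm (coef (\<tau> k) l) * bracket_l1 l ^ M \<le> T * bracket k powr (\<mu> + \<delta> * real M)"
    using coef_symbol_decay[OF \<delta>(1) \<tau>, of M] by blast
  let ?S = "\<Sum>\<^sub>\<infinity>l :: int ^ 'n::{finite,linorder}. 1 / bracket_l1 l ^ ?d"
  have "norm (Op \<tau> f k) \<le> (F * T * ?S) * bracket k powr (- real Q)" for k
  proof -
    let ?w = "bracket k powr (\<mu> + \<delta> * real M)"
    have b: "norm (of_real (bracket_l1 k ^ M) * (f m * coef (\<tau> k) (m - k))) \<le> (F * (T * ?w)) * (1 / bracket_l1 m ^ ?d)" for m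
    proof -
      have "bracket_l1 k \<le> bracket_l1 m * bracket_l1 (m - k)" using bracket_l1_add_le[of m "- (m - k)"] unfolding bracket_l1_uminus by simp
      then have "norm (of_real (bracket_l1 k ^ M) * (f m * coef (\<tau> k) (m - k))) \<le> (bracket_l1 m * bracket_l1 (m - k)) ^ M * (norm (f m) * norm (coef (\<tau> k) (m - k)))"
        by (auto simp: norm_mult norm_power intro!: mult_right_mono power_mono)
      also have "\<dots> = (norm (f m) * bracket_l1 m ^ M) * (norm (coef (\<tau> k) (m - k)) * bracket_l1 (m - k) ^ M)"
        by (simp add: power_mult_distrib)
      also have "\<dots> \<le> (F * (1 / bracket_l1 m ^ ?d)) * (T * ?w)"
      proof (rule mult_mono)
        show "norm (f m) * bracket_l1 m ^ M \<le> F * (1 / bracket_l1 m ^ ?d)"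
          using F(2)[of m] by (simp add: power_add pos_le_divide_eq mult.assoc)
      qed (use F(1) T(2) in auto)
      finally show ?thesis by (simp add: mult_ac)
    qed
    have "norm (of_real (bracket_l1 k ^ M) * Op \<tau> f k) \<le> (F * (T * ?w)) * ?S"
    proof (rule norm_infsum_le[OF _ _ b])
      show "((\<lambda>m. of_real (bracket_l1 k ^ M) * (f m * coef (\<tau> k) (m - k))) has_sum of_real (bracket_l1 k ^ M) * Op \<tau> f k) UNIV"
        by (intro has_sum_cmult_right Op_has_sum f smooth_torus_ctorus symbol_class_smooth_torus[OF \<tau>])
      show "((\<lambda>m :: int ^ 'n::{finite,linorder}. (F * (T * ?w)) * (1 / bracket_l1 m ^ ?d)) has_sum (F * (T * ?w)) * ?S) UNIV"
        by (rule has_sum_cmult_right[OF has_sum_infsum[OF summable_bracket_l1]])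
    qed
    then have "norm (Op \<tau> f k) * bracket_l1 k ^ M \<le> (F * T * ?S) * ?w" by (simp add: norm_mult norm_power mult_ac)
    then have 1: "norm (Op \<tau> f k) \<le> (F * T * ?S) * ?w / bracket_l1 k ^ M" by (simp add: pos_le_divide_eq)
    have S: "?S \<ge> 0" by (intro infsum_nonneg) simp
    note 1
    also have "(F * T * ?S) * ?w / bracket_l1 k ^ M \<le> (F * T * ?S) * ?w / bracket k ^ M"
      using F(1) T(1) S bracket_le_bracket_l1[of k] by (intro divide_left_mono power_mono mult_nonneg_nonneg mult_pos_pos zero_less_power) auto
    also have "\<dots> = (F * T * ?S) * bracket k powr (\<mu> + \<delta> * real M - real M)"
      by (simp add: powr_diff powr_realpow)
    also have "\<dots> \<le> (F * T * ?S) * bracket k powr (- real Q)"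
      using F(1) T(1) S by (intro mult_left_mono bracket_powr_mono M) auto
    finally show ?thesis .
  qed
  then show "\<exists>C. \<forall>k. norm (Op \<tau> f k) \<le> C * bracket k powr (- real Q)" by blast
qed

text \<open>The matrix form of \<open>Op \<sigma>\<close>, applied to \<open>Op \<tau> f\<close> and
  indexed by l = m - k, has terms that are integrals of \<open>rem_term 0\<close> against
  \<open>fourier f\<close>, because the character of k + l factors. Moving the sum back under the
  integral gives \<open>comp_rem 0\<close>.\<close>

lemma Op_comp:
  fixes \<sigma> \<tau> :: "int ^ 'n::{finite,linorder} \<Rightarrow> real ^ 'n::{finite,linorder} \<Rightarrow> complex"
  assumes \<delta>: "0 \<le> \<delta>" "\<delta> < \<rho>" "\<rho> \<le> 1"
    and \<sigma>: "\<sigma> \<in> symbol_class \<mu>1 \<rho> \<delta>" and \<tau>: "\<tau> \<in> symbol_class \<mu>2 \<rho> \<delta>" and f: "f \<in> schwartz"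
  shows "Op \<sigma> (Op \<tau> f) k = Op (comp_rem 0 \<sigma> \<tau>) f k"
proof -
  let ?g = "fourier f"
  note s = smooth_torus_ctorus[OF symbol_class_smooth_torus[OF \<sigma>]]
    and t = smooth_torus_ctorus[OF symbol_class_smooth_torus[OF \<tau>]]
  have g: "?g \<in> ctorus" by (rule fourier_ctorus[OF f])
  have "((\<lambda>m. Op \<tau> f m * coef (\<sigma> k) (m - k)) has_sum Op \<sigma> (Op \<tau> f) k) UNIV"
    using \<delta> by (intro Op_has_sum s Op_schwartz[OF _ _ \<tau> f]) auto
  then have 1: "((\<lambda>l. Op \<tau> f (k + l) * coef (\<sigma> k) l) has_sum Op \<sigma> (Op \<tau> f) k) UNIV"
    by (subst (asm) has_sum_reindex_bij_betw[of "\<lambda>l. k + l" UNIV UNIV, symmetric])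
       (auto intro!: bij_betwI[of _ _ _ "\<lambda>l. l - k"])
  obtain C where C: "\<And>l x. norm (rem_term 0 \<sigma> \<tau> k l x) \<le> C * (1 / bracket_l1 l ^ (2 * CARD('n)))"
    using rem_term_dominated[OF \<delta> \<sigma> \<tau>] by blast
  obtain K where K: "K > 0" "\<And>x. norm (?g x) \<le> K" using ctorus_bounded[OF g] by blast
  have "((\<lambda>l. integral (cbox 0 1) (\<lambda>x. character k x * ?g x * rem_term 0 \<sigma> \<tau> k l x)) has_sum
      integral (cbox 0 1) (\<lambda>x. \<Sum>\<^sub>\<infinity>l. character k x * ?g x * rem_term 0 \<sigma> \<tau> k l x)) UNIV"
  proof (rule dominated_has_sum_integral[OF _ summable_const_bracket_l1])
    show "norm (character k x * ?g x * rem_term 0 \<sigma> \<tau> k l x) \<le> (K * C) * (1 / bracket_l1 l ^ (2 * CARD('n)))" for l x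
      using mult_mono[OF K(2)[of x] C[of l x]] K(1) by (simp add: norm_mult)
    show "continuous_on (cbox 0 1) (\<lambda>x. character k x * ?g x * rem_term 0 \<sigma> \<tau> k l x)" for l
      by (intro ctorus_continuous_on ctorus_mult character_ctorus g rem_term_ctorus symbol_class_smooth_torus[OF \<tau>])
  qed
  moreover have "integral (cbox 0 1) (\<lambda>x. character k x * ?g x * rem_term 0 \<sigma> \<tau> k l x) = Op \<tau> f (k + l) * coef (\<sigma> k) l" for l
  proof -
    have "(\<lambda>x. character k x * ?g x * rem_term 0 \<sigma> \<tau> k l x) = (\<lambda>x. (character (k + l) x * \<tau> (k + l) x * ?g x) * coef (\<sigma> k) l)"
      by (simp add: rem_term_def character_add mult_ac)
    then show ?thesis by (simp add: Op_eq_integral[where \<sigma> = \<tau>, OF t f])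
  qed
  moreover have "integral (cbox 0 1) (\<lambda>x. \<Sum>\<^sub>\<infinity>l. character k x * ?g x * rem_term 0 \<sigma> \<tau> k l x) = Op (comp_rem 0 \<sigma> \<tau>) f k"
    unfolding infsum_cmult_right' comp_rem_def[symmetric] Op_eq_integral[where \<sigma> = "comp_rem 0 \<sigma> \<tau>", OF comp_rem_ctorus[OF \<delta> \<sigma> \<tau>] f]
    by (simp add: mult_ac)
  ultimately show ?thesis using has_sum_unique[OF 1] by simp
qed

theorem theorem3p1:
  fixes \<sigma> \<tau> :: "int ^ 'n::{finite,linorder} \<Rightarrow> real ^ 'n::{finite,linorder} \<Rightarrow> complex"
    and \<mu>1 \<mu>2 \<rho> \<delta> :: real
  assumes "0 \<le> \<delta>" and "\<delta> < \<rho>" and "\<rho> \<le> 1"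
    and "\<sigma> \<in> symbol_class \<mu>1 \<rho> \<delta>"
    and "\<tau> \<in> symbol_class \<mu>2 \<rho> \<delta>"
  shows "\<exists>\<xi> \<in> symbol_class (\<mu>1 + \<mu>2) \<rho> \<delta>.
      (\<forall>f \<in> schwartz. Op \<tau> f \<in> schwartz \<and> (Op \<sigma> \<circ> Op \<tau>) f = Op \<xi> f) \<and>
      (\<forall>N::nat.
        (\<lambda>k x. \<xi> k x - (\<Sum>\<alpha> | mi_size \<alpha> < N.
            1 / of_nat (mi_fact \<alpha>) * D_x \<alpha> \<sigma> k x * Delta_k \<alpha> \<tau> k x))
        \<in> symbol_class (\<mu>1 + \<mu>2 - real N * (\<rho> - \<delta>)) \<rho> \<delta>)"
proof (intro bexI conjI ballI allI)
  \<comment> \<open>The witness is the remainder of the empty expansion, that is, the full series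
    for the composition. Subtracting the terms of order below N turns it into
    \<open>comp_rem N\<close>, which the same symbol estimate covers.\<close>
  show "comp_rem 0 \<sigma> \<tau> \<in> symbol_class (\<mu>1 + \<mu>2) \<rho> \<delta>"
    using comp_rem_symbol_class[OF assms, of 0] by simp
  show "(\<lambda>k x. comp_rem 0 \<sigma> \<tau> k x - (\<Sum>\<alpha> | mi_size \<alpha> < N.
            1 / of_nat (mi_fact \<alpha>) * D_x \<alpha> \<sigma> k x * Delta_k \<alpha> \<tau> k x))
        \<in> symbol_class (\<mu>1 + \<mu>2 - real N * (\<rho> - \<delta>)) \<rho> \<delta>" for N
    using comp_rem_symbol_class[OF assms, of N] by (simp only: comp_rem_eq[OF assms, of N, abs_def])
  fix f :: "int ^ 'n::{finite,linorder} \<Rightarrow> complex" assume f: "f \<in> schwartz"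
  show "Op \<tau> f \<in> schwartz"
    using assms by (intro Op_schwartz[OF _ _ assms(5) f]) auto
  show "(Op \<sigma> \<circ> Op \<tau>) f = Op (comp_rem 0 \<sigma> \<tau>) f"
    by (simp add: fun_eq_iff Op_comp[OF assms f])
qed

end
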